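(* Let $\kappa\in\mathbb C\setminus\{0\}$. Then the function $T^{\min}_\kappa(\cdot,\cdot)$ satisfies the following collection of Hamilton–Jacobi–Bellman boundary value problems: (i) For each $\eta_+\in\hat{\mathbb C}$, the function $V^-_{\eta_+}(\cdot):=T^{\min}_\kappa(\cdot,\eta_+)$ is lower semicontinuous and is the unique proximal solution to $$0=V(\eta_+),\qquad 0=1-\mathcal H_\kappa(x,-\mathrm dV(x)),\quad x\in\hat{\mathbb C}\setminus\{\eta_+\}.$$ (ii) For each $\eta_-\in\hat{\mathbb C}$, the function $V^+_{\eta_-}(\cdot):=T^{\min}_\kappa(\eta_-,\cdot)$ is lower semicontinuous and is the unique proximal solution to $$0=V(\eta_-),\qquad 0=1-\mathcal H_{-\kappa}(x,-\mathrm dV(x)),\quad x\in\hat{\mathbb C}\setminus\{\eta_-\}.$$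
   Context: Fix constants $0<n_1<n_2$. $\hat{\mathbb C}=\mathbb C\cup\{\infty\}$ is regarded as a smooth real 2-dimensional manifold with the atlas of two charts $x\mapsto x=x_1+\mathrm i x_2\simeq(x_1,x_2)$ on $\mathbb C$ and $x\mapsto\tilde x=-1/x=\tilde x_1+\mathrm i\tilde x_2\simeq(\tilde x_1,\tilde x_2)$ on $\hat{\mathbb C}\setminus\{0\}$. Control system with spectral parameter $\kappa$: feasible controls are $\varepsilon\in L^\infty((s_-,\infty);\mathbb R)$ with $n_1^2\le\varepsilon\le n_2^2$ a.e.; the state $x(s)\in\hat{\mathbb C}$ satisfies $x'=f(x,\varepsilon)=\mathrm i\kappa(-x^2+\varepsilon)$ in the first chart and $\tilde x'=\tilde f(\tilde x,\varepsilon)=\mathrm i\kappa(-1+\varepsilon\tilde x^2)$ in the second. $T^{\min}_\kappa(\eta_-,\eta_+)\in[0,+\infty]$ is the infimum of $t\ge0$ such that some feasible control steers $x(s_-)=\eta_-$ to $x(s_-+t)=\eta_+$ ($\inf\varnothing=+\infty$). $F_\kappa(x)\subset T_x\hat{\mathbb C}$ is the set of tangent vectors represented in the first chart by $\{\operatorname{Re}f(x,\epsilon)\,\partial_{x_1}+\operatorname{Im}f(x,\epsilon)\,\partial_{x_2}:\epsilon\in[n_1^2,n_2^2]\}$ for $x\in\mathbb C$, and in the second chart by $\{\operatorname{Re}\tilde f(\tilde x,\epsilon)\,\partial_{\tilde x_1}+\operatorname{Im}\tilde f(\tilde x,\epsilon)\,\partial_{\tilde x_2}:\epsilon\in[n_1^2,n_2^2]\}$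 for $x=-1/\tilde x\in\hat{\mathbb C}\setminus\{0\}$. The Hamiltonian is $\mathcal H_\kappa(x,\lambda)=\sup_{v\in F_\kappa(x)}\langle v,\lambda\rangle$ for $x\in\hat{\mathbb C}$, $\lambda\in T_x^*\hat{\mathbb C}$; $\mathcal H_{-\kappa}$ is the same with $\kappa$ replaced by $-\kappa$. For $V:\hat{\mathbb C}\to(-\infty,+\infty]$, $\operatorname{dom}V=\{x:V(x)<+\infty\}$. A covector $\lambda\in T^*_x\hat{\mathbb C}$ is a proximal subgradient of $V$ at $x$ if $x\in\operatorname{dom}V$ and there is a $C^2$-function $m$ on a neighborhood $\Omega\subset\hat{\mathbb C}$ of $x$ with $\lambda=\mathrm dm(x)$ and $V(z)-V(x)\ge m(z)-m(x)$ for all $z\in\Omega$; the set of these is $\partial^{\mathrm P}V(x)$. For $\kappa\in\mathbb C\setminus\{0\}$ and $\eta\in\hat{\mathbb C}$, a lower semicontinuous $V:\hat{\mathbb C}\to(-\infty,+\infty]$ is a proximal solution to the problem $0=V(\eta)$, $0=1-\mathcal H_\kappa(x,-\mathrm dV(x))$ for $x\in\hat{\mathbb C}\setminus\{\eta\}$, if: $0=1-\mathcal H_\kappa(x,-\lambda)$ for all $x\ne\eta$ and $\lambda\in\partial^{\mathrm P}V(x)$; $0\le1-\mathcal H_\kappa(\eta,-\lambda)$ for all $\lambda\in\partial^{\mathrm P}V(\eta)$; and $V(\eta)=0$. *)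

theory Defs
  imports "HOL-Analysis.Analysis"
begin

section \<open>The Riemann sphere as a real 2-manifold\<close>

datatype sphere = Fin complex | Infty

text \<open>The first chart is \<open>x \<mapsto> x\<close> on the finite points, the second one is \<open>x \<mapsto> - 1 / x\<close> on the
  complement of \<open>Fin 0\<close>, sending \<open>Infty\<close> to \<open>0\<close>. The complex plane is identified with
  the real plane in the usual way. Values of \<open>chart_map c\<close> outside \<open>chart_dom c\<close> are meaningless.\<close>

datatype chart = Chart1 | Chart2

fun chart_dom :: "chart \<Rightarrow> sphere set" where
  "chart_dom Chart1 = - {Infty}"
| "chart_dom Chart2 = - {Fin 0}"

fun chart_map :: "chart \<Rightarrow> sphere \<Rightarrow> complex" where
  "chart_map Chart1 (Fin z) = z"
| "chart_map Chart1 Infty = 0"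
| "chart_map Chart2 (Fin z) = - 1 / z"
| "chart_map Chart2 Infty = 0"

fun chart_inv :: "chart \<Rightarrow> complex \<Rightarrow> sphere" where
  "chart_inv Chart1 z = Fin z"
| "chart_inv Chart2 w = (if w = 0 then Infty else Fin (- 1 / w))"

lemma chart_map_inv [simp]: "chart_map c (chart_inv c z) = z"
  by (cases c) auto

lemma chart_inv_dom [simp]: "chart_inv c z \<in> chart_dom c"
  by (cases c) auto

lemma chart_inv_map [simp]: "x \<in> chart_dom c \<Longrightarrow> chart_inv c (chart_map c x) = x"
  by (cases c; cases x) auto

lemma chart_image_eq: "chart_map c ` (U \<inter> chart_dom c) = chart_inv c -` U"
proof
  show "chart_map c ` (U \<inter> chart_dom c) \<subseteq> chart_inv c -` U" by auto
  show "chart_inv c -` U \<subseteq> chart_map c ` (U \<inter> chart_dom c)"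
    by (metis IntI chart_inv_dom chart_map_inv imageI subsetI vimageD)
qed

instantiation sphere :: topological_space
begin

definition open_sphere :: "sphere set \<Rightarrow> bool" where
  "open_sphere U \<longleftrightarrow> (\<forall>c. open (chart_map c ` (U \<inter> chart_dom c)))"

instance
proof
  show "open (UNIV :: sphere set)"
    unfolding open_sphere_def chart_image_eq by simp
next
  fix S T :: "sphere set"
  assume "open S" "open T"
  then show "open (S \<inter> T)"
    unfolding open_sphere_def chart_image_eq vimage_Int by (blast intro: open_Int)
next
  fix K :: "sphere set set"
  assume "\<forall>S\<in>K. open S"
  then show "open (\<Union>K)"
    unfolding open_sphere_def chart_image_eq vimage_Union by (blast intro: open_UN)
qed

end

text \<open>A tangent vector is the family of its representatives in the charts around the base point,
  related by the derivatives of the chart transitions; a covector is the family of the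
  real-linear functionals representing it. In charts not containing the base point both are
  \<open>0\<close> by convention.\<close>

definition transition_deriv :: "sphere \<Rightarrow> chart \<Rightarrow> chart \<Rightarrow> complex \<Rightarrow> complex" where
  "transition_deriv x c d =
     frechet_derivative (chart_map d \<circ> chart_inv c) (at (chart_map c x))"

definition tangent_space :: "sphere \<Rightarrow> (chart \<Rightarrow> complex) set" where
  "tangent_space x = {v.
     (\<forall>c. x \<notin> chart_dom c \<longrightarrow> v c = 0) \<and>
     (\<forall>c d. x \<in> chart_dom c \<inter> chart_dom d \<longrightarrow> v d = transition_deriv x c d (v c))}"

definition cotangent_space :: "sphere \<Rightarrow> (chart \<Rightarrow> complex \<Rightarrow>\<^sub>L real) set" where
  "cotangent_space x = {l.
     (\<forall>c. x \<notin> chart_dom c \<longrightarrow> l c = 0) \<and>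
     (\<forall>c d w. x \<in> chart_dom c \<inter> chart_dom d \<longrightarrow>
        blinfun_apply (l c) w = blinfun_apply (l d) (transition_deriv x c d w))}"

definition pairing :: "sphere \<Rightarrow> (chart \<Rightarrow> complex) \<Rightarrow> (chart \<Rightarrow> complex \<Rightarrow>\<^sub>L real) \<Rightarrow> real" where
  "pairing x v l =
     (let c = (if x \<in> chart_dom Chart1 then Chart1 else Chart2) in blinfun_apply (l c) (v c))"

lemma pairing_chart:
  assumes "v \<in> tangent_space x" "l \<in> cotangent_space x" "x \<in> chart_dom c"
  shows "pairing x v l = blinfun_apply (l c) (v c)"
proof -
  have "blinfun_apply (l b) (v b) = blinfun_apply (l c) (v c)" if "x \<in> chart_dom b" for b
  proof -
    have "blinfun_apply (l b) (v b) = blinfun_apply (l c) (transition_deriv x b c (v b))"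
      using assms that unfolding cotangent_space_def by blast
    also have "transition_deriv x b c (v b) = v c"
      using assms that unfolding tangent_space_def mem_Collect_eq by (metis IntI)
    finally show ?thesis .
  qed
  moreover have "x \<in> chart_dom Chart1 \<or> x \<in> chart_dom Chart2" by auto
  ultimately show ?thesis
    unfolding pairing_def Let_def by presburger
qed


section \<open>The control system and the minimal time\<close>

text \<open>Controls are represented by measurable functions, of which only the values on
  \<open>{s0<..}\<close> up to null sets matter.\<close>

definition feasible_control :: "real \<Rightarrow> real \<Rightarrow> real \<Rightarrow> (real \<Rightarrow> real) \<Rightarrow> bool" where
  "feasible_control n1 n2 s0 \<epsilon> \<longleftrightarrow>
     \<epsilon> \<in> borel_measurable (lebesgue_on {s0<..}) \<and>
     (AE s in lebesgue_on {s0<..}. n1\<^sup>2 \<le> \<epsilon> s \<and> \<epsilon> s \<le> n2\<^sup>2)"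

fun chart_field :: "complex \<Rightarrow> chart \<Rightarrow> complex \<Rightarrow> real \<Rightarrow> complex" where
  "chart_field \<kappa> Chart1 z e = \<i> * \<kappa> * (- (z\<^sup>2) + of_real e)"
| "chart_field \<kappa> Chart2 w e = \<i> * \<kappa> * (- 1 + of_real e * w\<^sup>2)"

definition abs_continuous_on :: "real \<Rightarrow> real \<Rightarrow> (real \<Rightarrow> 'a::real_normed_vector) \<Rightarrow> bool" where
  "abs_continuous_on a b g \<longleftrightarrow>
     (\<forall>e>0. \<exists>d>0. \<forall>I. finite I \<and> (\<forall>(u, v)\<in>I. a \<le> u \<and> u \<le> v \<and> v \<le> b) \<and>
        pairwise (\<lambda>(u, v) (u', v'). {u<..<v} \<inter> {u'<..<v'} = {}) I \<and>
        (\<Sum>(u, v)\<in>I. v - u) < d \<longrightarrow> (\<Sum>(u, v)\<in>I. norm (g v - g u)) < e)"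

text \<open>Caratheodory solutions on \<open>{s0..s1}\<close>: the curve is continuous in the sphere, and on
  every time interval during which it stays in the domain of a chart its representative is
  absolutely continuous and satisfies the equation of that chart almost everywhere.\<close>

definition trajectory ::
    "complex \<Rightarrow> (real \<Rightarrow> real) \<Rightarrow> real \<Rightarrow> real \<Rightarrow> (real \<Rightarrow> sphere) \<Rightarrow> bool" where
  "trajectory \<kappa> \<epsilon> s0 s1 x \<longleftrightarrow>
     continuous_on {s0..s1} x \<and>
     (\<forall>c a b. s0 \<le> a \<and> a \<le> b \<and> b \<le> s1 \<and> x ` {a..b} \<subseteq> chart_dom c \<longrightarrow>
        abs_continuous_on a b (\<lambda>s. chart_map c (x s)) \<and>
        (AE s in lebesgue_on {a..b}.
           ((\<lambda>s. chart_map c (x s)) has_vector_derivative chart_field \<kappa> c (chart_map c (x s)) (\<epsilon> s))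
             (at s within {a..b})))"

definition min_time ::
    "real \<Rightarrow> real \<Rightarrow> real \<Rightarrow> complex \<Rightarrow> sphere \<Rightarrow> sphere \<Rightarrow> ereal" where
  "min_time n1 n2 s0 \<kappa> \<eta>0 \<eta>1 =
     Inf {ereal t | t. 0 \<le> t \<and>
       (\<exists>\<epsilon> x. feasible_control n1 n2 s0 \<epsilon> \<and> trajectory \<kappa> \<epsilon> s0 (s0 + t) x \<and>
              x s0 = \<eta>0 \<and> x (s0 + t) = \<eta>1)}"


section \<open>The Hamiltonian\<close>

definition velocities :: "real \<Rightarrow> real \<Rightarrow> complex \<Rightarrow> sphere \<Rightarrow> (chart \<Rightarrow> complex) set" where
  "velocities n1 n2 \<kappa> x =
     {v \<in> tangent_space x. \<exists>e\<in>{n1\<^sup>2..n2\<^sup>2}.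
        \<forall>c. x \<in> chart_dom c \<longrightarrow> v c = chart_field \<kappa> c (chart_map c x) e}"

text \<open>The supremum is over a nonempty bounded set when \<open>0 < n1 < n2\<close>.\<close>

definition hamiltonian ::
    "real \<Rightarrow> real \<Rightarrow> complex \<Rightarrow> sphere \<Rightarrow> (chart \<Rightarrow> complex \<Rightarrow>\<^sub>L real) \<Rightarrow> real" where
  "hamiltonian n1 n2 \<kappa> x l = (SUP v\<in>velocities n1 n2 \<kappa> x. pairing x v l)"

lemma transition_deriv_eqI:
  assumes "(f has_derivative f') (at (chart_map c x))" "chart_map d \<circ> chart_inv c = f"
  shows "transition_deriv x c d = f'"
  unfolding transition_deriv_def assms(2) by (rule frechet_derivative_at[OF assms(1), symmetric])

lemma transition_deriv_self: "transition_deriv x c c = (\<lambda>w. w)"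
  by (rule transition_deriv_eqI[OF has_derivative_ident]) auto

lemma transition_deriv_other:
  assumes "z \<noteq> 0"
  shows "transition_deriv (Fin z) Chart1 Chart2 = (\<lambda>w. w / z\<^sup>2)"
    and "transition_deriv (Fin z) Chart2 Chart1 = (\<lambda>w. w * z\<^sup>2)"
proof -
  have 1: "((\<lambda>z. - 1 / z) has_derivative (\<lambda>w. w / a\<^sup>2)) (at a)" if "a \<noteq> 0" for a :: complex
  proof -
    have "((\<lambda>z. - 1 / z) has_field_derivative (1 / a\<^sup>2)) (at a)"
      using that by (auto intro!: derivative_eq_intros simp: power2_eq_square)
    then show ?thesis by (simp add: has_field_derivative_def mult.commute[of _ "inverse _"] divide_inverse)
  qed
  show "transition_deriv (Fin z) Chart1 Chart2 = (\<lambda>w. w / z\<^sup>2)"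
    by (rule transition_deriv_eqI[where f = "\<lambda>z. - 1 / z"]) (use 1[OF assms] in auto)
  have "((\<lambda>z. - 1 / z) has_derivative (\<lambda>w. w * z\<^sup>2)) (at (- 1 / z))"
    using 1[of "- 1 / z"] assms by (simp add: power_divide)
  then show "transition_deriv (Fin z) Chart2 Chart1 = (\<lambda>w. w * z\<^sup>2)"
    by (intro transition_deriv_eqI[where f = "\<lambda>z. - 1 / z"]) auto
qed

lemma chart_field_tangent:
  "(\<lambda>c. if x \<in> chart_dom c then chart_field \<kappa> c (chart_map c x) e else 0) \<in> tangent_space x"
proof -
  have "chart_field \<kappa> d (chart_map d x) e = transition_deriv x c d (chart_field \<kappa> c (chart_map c x) e)"
    if cd: "x \<in> chart_dom c" "x \<in> chart_dom d" for c d
  proof (cases "c = d")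
    case True
    then show ?thesis by (simp add: transition_deriv_self)
  next
    case False
    then obtain z where "x = Fin z" "z \<noteq> 0"
      using cd by (cases c; cases d; cases x) auto
    with False show ?thesis
      by (cases c; cases d) (simp_all add: transition_deriv_other field_simps)
  qed
  then show ?thesis unfolding tangent_space_def by auto
qed

lemma velocities_nonempty:
  assumes "0 < n1" "n1 < n2"
  shows "velocities n1 n2 \<kappa> x \<noteq> {}"
proof -
  have "n1\<^sup>2 \<in> {n1\<^sup>2..n2\<^sup>2}" using assms by (simp add: power_mono)
  then have "(\<lambda>c. if x \<in> chart_dom c then chart_field \<kappa> c (chart_map c x) (n1\<^sup>2) else 0)
      \<in> velocities n1 n2 \<kappa> x"
    using chart_field_tangent[of x \<kappa> "n1\<^sup>2"] unfolding velocities_def by auto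
  then show ?thesis by blast
qed


section \<open>Proximal solutions\<close>

definition C2_on :: "complex set \<Rightarrow> (complex \<Rightarrow> real) \<Rightarrow> bool" where
  "C2_on S g \<longleftrightarrow>
     (\<exists>(D :: complex \<Rightarrow> complex \<Rightarrow>\<^sub>L real) (D2 :: complex \<Rightarrow> complex \<Rightarrow>\<^sub>L complex \<Rightarrow>\<^sub>L real).
        (\<forall>z\<in>S. (g has_derivative blinfun_apply (D z)) (at z) \<and>
               (D has_derivative blinfun_apply (D2 z)) (at z)) \<and>
        continuous_on S D2)"

definition sphere_C2_on :: "sphere set \<Rightarrow> (sphere \<Rightarrow> real) \<Rightarrow> bool" where
  "sphere_C2_on \<Omega> m \<longleftrightarrow> (\<forall>c. C2_on (chart_map c ` (\<Omega> \<inter> chart_dom c)) (m \<circ> chart_inv c))"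

definition is_differential ::
    "(sphere \<Rightarrow> real) \<Rightarrow> sphere \<Rightarrow> (chart \<Rightarrow> complex \<Rightarrow>\<^sub>L real) \<Rightarrow> bool" where
  "is_differential m x l \<longleftrightarrow> l \<in> cotangent_space x \<and>
     (\<forall>c. x \<in> chart_dom c \<longrightarrow>
        ((m \<circ> chart_inv c) has_derivative blinfun_apply (l c)) (at (chart_map c x)))"

definition proximal_subdifferential ::
    "(sphere \<Rightarrow> ereal) \<Rightarrow> sphere \<Rightarrow> (chart \<Rightarrow> complex \<Rightarrow>\<^sub>L real) set" where
  "proximal_subdifferential V x = {l \<in> cotangent_space x. V x < \<infinity> \<and>
     (\<exists>m \<Omega>. open \<Omega> \<and> x \<in> \<Omega> \<and> sphere_C2_on \<Omega> m \<and> is_differential m x l \<and>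
        (\<forall>z\<in>\<Omega>. V z - V x \<ge> ereal (m z - m x)))}"

definition lower_semicontinuous :: "('a::topological_space \<Rightarrow> ereal) \<Rightarrow> bool" where
  "lower_semicontinuous V \<longleftrightarrow> (\<forall>x. \<forall>a<V x. \<forall>\<^sub>F z in nhds x. a < V z)"

text \<open>Proximal solutions of \<open>0 = V \<eta>\<close>, \<open>0 = 1 - H x (- dV x)\<close> for \<open>x \<noteq> \<eta>\<close>, where \<open>H\<close> is
  the Hamiltonian with spectral parameter \<open>\<kappa>\<close>.\<close>

definition proximal_solution ::
    "real \<Rightarrow> real \<Rightarrow> complex \<Rightarrow> sphere \<Rightarrow> (sphere \<Rightarrow> ereal) \<Rightarrow> bool" where
  "proximal_solution n1 n2 \<kappa> \<eta> V \<longleftrightarrow>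
     (\<forall>x. V x \<noteq> - \<infinity>) \<and>
     lower_semicontinuous V \<and>
     (\<forall>x l. x \<noteq> \<eta> \<and> l \<in> proximal_subdifferential V x \<longrightarrow>
        0 = 1 - hamiltonian n1 n2 \<kappa> x (\<lambda>c. - l c)) \<and>
     (\<forall>l\<in>proximal_subdifferential V \<eta>. 0 \<le> 1 - hamiltonian n1 n2 \<kappa> \<eta> (\<lambda>c. - l c)) \<and>
     V \<eta> = 0"

end

theory Submission
  imports Defs "HOL-Complex_Analysis.Great_Picard"
begin

text \<open>
  In homogeneous coordinates \<open>x = p / q\<close> the Riccati equation is linear: it is the projection of
  \<open>p' = \<i> \<kappa> \<epsilon> q\<close>, \<open>q' = \<i> \<kappa> p\<close>, and the second chart \<open>- q / p\<close> gives the second form of the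
  equation. The sphere is thus the projective line \<open>proj\<close> of \<open>\<complex>\<^sup>2\<close>, and controls act on it through
  \<open>act\<close> by the unimodular transfer matrices of the linear system. No differential equation with
  measurable coefficients has to be solved. For piecewise constant controls the transfer matrices
  are products of explicit trigonometric matrices (\<open>reach\<close>), and \<open>ctrl\<close> is the closure of the set
  of triples of elapsed time, integral of the control and transfer matrix. An estimate that is
  stable under products and limits (\<open>ctrl_estimate\<close>) replaces the differential equation, and
  \<open>ctrl\<close> is compact for bounded time, closed under composition and can be split at any
  intermediate time. The corresponding minimal time is \<open>hit_time\<close>.

  Uniqueness: let \<open>V\<close> be a proximal solution. The inequality \<open>\<H> \<le> 1\<close> at all subgradients forces
  \<open>V\<close> to grow at most at speed \<open>1\<close> backwards along constant controls
  (\<open>proximal_solution_flow_increase\<close>), hence along all of \<open>ctrl\<close>, so \<open>V \<le> hit_time\<close>. The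
  inequality \<open>\<H> \<ge> 1\<close> away from the target gives the converse by comparison with the penalised
  value functions \<open>penal k\<close>, the infima of elapsed time plus \<open>k\<close> times the squared distance to
  the target at the end (\<open>penal_le_proximal_solution\<close>); these are continuous, and they tend to \<open>hit_time\<close> by
  compactness. Both steps minimise a lower semicontinuous function with a smooth penalty over
  unit vectors. The penalty is the squared chordal distance \<open>chord\<close>, which is explicit, smooth on
  the whole sphere and well adapted to the linear flow.

  Existence: by compactness optimal transfers exist and \<open>hit_time\<close> is lower semicontinuous. A test
  function below \<open>hit_time\<close> is compared with it at points reached by running a constant control
  backwards, which gives \<open>\<H> \<le> 1\<close>, and at points on an optimal transfer, which gives \<open>\<H> \<ge> 1\<close>.

  Finally \<open>hit_time\<close> is the minimal time of the control system (\<open>min_time_eq_hit_time\<close>). A member of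
  \<open>ctrl\<close> is the end of a Lipschitz curve of transfer matrices (\<open>is_curve\<close>) whose accumulated
  control is differentiable almost everywhere, and the projected curve is a trajectory. Conversely
  the integral of a feasible control is interpolated by piecewise constant controls, and the
  trajectory agrees with the projected limit curve by a Gronwall argument in each chart.
  The statement about the initial point follows from the one about the terminal point because the
  transfer matrices for \<open>- \<kappa>\<close> are the inverses of those for \<open>\<kappa>\<close>, with time reversed.
\<close>

section \<open>Differentiation of integrals\<close>

text \<open>The intervals witnessing a bad difference quotient at points of the set, if they are also fine
  for a Henstock gauge, form a Vitali cover. Finitely many disjoint ones are a fine partial
  division on which every Henstock summand is at least \<open>\<epsilon>\<close> times the length, so the Henstock
  lemma bounds their total length.\<close>

lemma negligible_bad_difference_quotients:
  fixes f :: "real \<Rightarrow> real"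
  assumes f: "f integrable_on {a..b}" and "0 < \<epsilon>"
  defines "F \<equiv> \<lambda>t. integral {a..t} f"
  shows "negligible {x\<in>{a<..<b}. \<forall>\<delta>>0. \<exists>y\<in>{a..b}. y \<noteq> x \<and> \<bar>y - x\<bar> < \<delta> \<and>
           \<bar>F y - F x - f x * (y - x)\<bar> > \<epsilon> * \<bar>y - x\<bar>}" (is "negligible ?S")
  unfolding negligible_outer_le
proof (intro allI impI)
  fix e :: real assume "0 < e"
  obtain \<gamma> where \<gamma>: "gauge \<gamma>"
    "\<And>p. \<lbrakk>p tagged_partial_division_of (cbox a b); \<gamma> fine p\<rbrakk> \<Longrightarrow>
             sum (\<lambda>(x,k). norm(measure lborel k *\<^sub>R f x - integral k f)) p < \<epsilon> * e"
    using Henstock_lemma[of f a b "\<epsilon> * e"] f \<open>0 < e\<close> \<open>0 < \<epsilon>\<close> by (auto simp: cbox_interval)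
  have F_diff: "integral {u..v} f = F v - F u" if "a \<le> u" "u \<le> v" "v \<le> b" for u v
  proof -
    have "f integrable_on {a..v}"
      using f that by (meson atLeastatMost_subset_iff integrable_on_subinterval order_refl)
    then have "integral {a..u} f + integral {u..v} f = integral {a..v} f"
      using that by (intro Henstock_Kurzweil_Integration.integral_combine) auto
    then show ?thesis by (simp add: F_def)
  qed
  \<comment> \<open>the interval between \<open>x\<close> and \<open>y\<close>, written as a ball for the Vitali covering theorem\<close>
  define mid where "mid = (\<lambda>(x, y). (x + y) / 2 :: real)"
  define rad where "rad = (\<lambda>(x, y). \<bar>y - x\<bar> / 2 :: real)"
  define J where "J i = cball (mid i) (rad i)" for i
  define K where "K = {(x, y). x \<in> {a<..<b} \<and> y \<in> {a..b} \<and> y \<noteq> x \<and> J (x, y) \<subseteq> \<gamma> x \<and>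
      \<bar>F y - F x - f x * (y - x)\<bar> > \<epsilon> * \<bar>y - x\<bar>}"
  have J_eq: "J (x, y) = {min x y..max x y}" for x y
    unfolding J_def mid_def rad_def case_prod_conv
    by (auto simp: cball_eq_atLeastAtMost min_def max_def field_simps abs_if)
  have rad_pos: "0 < rad i" if "i \<in> K" for i
    using that by (auto simp: K_def rad_def)
  have cov: "\<exists>i. i \<in> K \<and> x \<in> cball (mid i) (rad i) \<and> rad i < d" if "x \<in> ?S" "0 < d" for x d
  proof -
    obtain r where r: "r > 0" "ball x r \<subseteq> \<gamma> x"
      using \<gamma>(1) unfolding gauge_def open_contains_ball by meson
    then obtain y where y: "y \<in> {a..b}" "y \<noteq> x" "\<bar>y - x\<bar> < min r d"
        "\<bar>F y - F x - f x * (y - x)\<bar> > \<epsilon> * \<bar>y - x\<bar>"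
    proof -
      have "\<forall>\<delta>>0. \<exists>y\<in>{a..b}. y \<noteq> x \<and> \<bar>y - x\<bar> < \<delta> \<and> \<bar>F y - F x - f x * (y - x)\<bar> > \<epsilon> * \<bar>y - x\<bar>"
        using \<open>x \<in> ?S\<close> by blast
      moreover have "min r d > 0" using r \<open>0 < d\<close> by simp
      ultimately show thesis using that by blast
    qed
    have "J (x, y) \<subseteq> ball x r"
      using y unfolding J_eq by (auto simp: dist_real_def)
    then have "(x, y) \<in> K" using y r that unfolding K_def by auto
    moreover have "x \<in> J (x, y)" unfolding J_eq by auto
    moreover have "rad (x, y) < d" using y by (auto simp: rad_def)
    ultimately show ?thesis unfolding J_def by blast
  qed
  obtain C where C: "countable C" "C \<subseteq> K"
    and disj: "pairwise (\<lambda>i j. disjnt (cball (mid i) (rad i)) (cball (mid j) (rad j))) C"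
    and neg: "negligible (?S - (\<Union>i\<in>C. cball (mid i) (rad i)))"
    by (rule Vitali_covering_theorem_cballs[of K rad ?S mid, OF rad_pos cov])
  have bound: "measure lebesgue (\<Union>i\<in>D. J i) \<le> e" if D: "D \<subseteq> C" "finite D" for D
  proof -
    define p where "p = (\<lambda>i. (fst i, J i)) ` D"
    have disjD: "J i \<inter> J j = {}" if "i \<in> D" "j \<in> D" "i \<noteq> j" for i j
      using disj that D unfolding pairwise_def J_def disjnt_def by blast
    have fst_in: "fst i \<in> J i" for i by (cases i) (auto simp: J_eq)
    have inj: "inj_on (\<lambda>i. (fst i, J i)) D"
      using disjD fst_in by (intro inj_onI) (metis Int_iff empty_iff prod.inject)
    have KD: "i \<in> K" if "i \<in> D" for i using that C D by blast
    have "p tagged_partial_division_of (cbox a b)"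
      unfolding tagged_partial_division_of_def
    proof (intro conjI allI impI)
      show "finite p" using D by (simp add: p_def)
    next
      fix x k assume "(x, k) \<in> p"
      then obtain i where i: "i \<in> D" "x = fst i" "k = J i" by (auto simp: p_def)
      show "x \<in> k" using i fst_in by simp
      have "J i \<subseteq> {a..b}" using KD[OF i(1)] by (cases i) (auto simp: K_def J_eq)
      then show "k \<subseteq> cbox a b" using i by (simp add: cbox_interval)
      show "\<exists>a b. k = cbox a b" using i by (cases i) (auto simp: J_eq cbox_interval)
    next
      fix x1 K1 x2 K2 assume "(x1, K1) \<in> p \<and> (x2, K2) \<in> p \<and> (x1, K1) \<noteq> (x2, K2)"
      then obtain i j where "i \<in> D" "j \<in> D" "K1 = J i" "K2 = J j" "i \<noteq> j" by (auto simp: p_def)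
      then have "K1 \<inter> K2 = {}" using disjD by blast
      then show "interior K1 \<inter> interior K2 = {}" using interior_subset by blast
    qed
    moreover have "\<gamma> fine p" using KD by (force simp: fine_def p_def K_def)
    ultimately have "sum (\<lambda>(x,k). norm(measure lborel k *\<^sub>R f x - integral k f)) p < \<epsilon> * e"
      using \<gamma> by blast
    then have *: "(\<Sum>i\<in>D. norm (measure lborel (J i) *\<^sub>R f (fst i) - integral (J i) f)) < \<epsilon> * e"
      unfolding p_def by (subst (asm) sum.reindex[OF inj]) (simp add: o_def)
    have "(\<Sum>i\<in>D. \<epsilon> * measure lebesgue (J i))
        \<le> (\<Sum>i\<in>D. norm (measure lborel (J i) *\<^sub>R f (fst i) - integral (J i) f))"
    proof (rule sum_mono)
      fix i assume "i \<in> D"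
      then obtain x y where i: "i = (x, y)" and xy: "x \<in> {a<..<b}" "y \<in> {a..b}"
        "\<bar>F y - F x - f x * (y - x)\<bar> > \<epsilon> * \<bar>y - x\<bar>"
        using KD by (cases i) (force simp: K_def)
      show "\<epsilon> * measure lebesgue (J i) \<le> norm (measure lborel (J i) *\<^sub>R f (fst i) - integral (J i) f)"
      proof (cases "x \<le> y")
        case True
        then show ?thesis using xy F_diff[of x y]
          by (simp add: i J_eq min_def max_def abs_minus_commute mult.commute)
      next
        case False
        then show ?thesis using xy F_diff[of y x]
          by (simp add: i J_eq min_def max_def algebra_simps abs_if split: if_splits)
      qed
    qed
    with * have "\<epsilon> * (\<Sum>i\<in>D. measure lebesgue (J i)) < \<epsilon> * e"
      by (simp add: sum_distrib_left)
    then have "(\<Sum>i\<in>D. measure lebesgue (J i)) \<le> e"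
      using \<open>0 < \<epsilon>\<close> by simp
    moreover have "measure lebesgue (\<Union>i\<in>D. J i) \<le> (\<Sum>i\<in>D. measure lebesgue (J i))"
      by (intro measure_UNION_le) (use D in \<open>auto simp: J_def\<close>)
    ultimately show ?thesis by linarith
  qed
  have meas: "J i \<in> lmeasurable" for i unfolding J_def by simp
  have U: "(\<Union>i\<in>C. J i) \<in> lmeasurable" "measure lebesgue (\<Union>i\<in>C. J i) \<le> e"
    using fmeasurable_UN_bound[OF C(1) meas bound] measure_UN_bound[OF C(1) meas bound] by auto
  have "(?S - (\<Union>i\<in>C. J i)) \<union> (\<Union>i\<in>C. J i) \<in> lmeasurable"
    using negligible_imp_measurable[OF neg] U(1) unfolding J_def by (rule fmeasurable.Un)
  moreover have "measure lebesgue ((?S - (\<Union>i\<in>C. J i)) \<union> (\<Union>i\<in>C. J i)) \<le> e"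
  proof -
    have "measure lebesgue ((?S - (\<Union>i\<in>C. J i)) \<union> (\<Union>i\<in>C. J i)) \<le>
      measure lebesgue (?S - (\<Union>i\<in>C. J i)) + measure lebesgue (\<Union>i\<in>C. J i)"
      using fmeasurableD[OF negligible_imp_measurable[OF neg]] fmeasurableD[OF U(1)] unfolding J_def
      by (rule measure_Un_le)
    also have "measure lebesgue (?S - (\<Union>i\<in>C. J i)) = 0"
      using neg unfolding J_def by (rule negligible_imp_measure0)
    finally show ?thesis using U(2) by simp
  qed
  ultimately show "\<exists>T. ?S \<subseteq> T \<and> T \<in> lmeasurable \<and> measure lebesgue T \<le> e"
    by (intro exI[of _ "(?S - (\<Union>i\<in>C. J i)) \<union> (\<Union>i\<in>C. J i)"]) auto
qed

theorem lebesgue_differentiation: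
  fixes f :: "real \<Rightarrow> real"
  assumes f: "f integrable_on {a..b}"
  shows "negligible {x\<in>{a<..<b}. \<not> ((\<lambda>t. integral {a..t} f) has_real_derivative f x) (at x)}"
proof -
  define F where "F = (\<lambda>t. integral {a..t} f)"
  define bad where "bad \<epsilon> x \<longleftrightarrow> (\<forall>\<delta>>0. \<exists>y\<in>{a..b}. y \<noteq> x \<and> \<bar>y - x\<bar> < \<delta> \<and>
           \<bar>F y - F x - f x * (y - x)\<bar> > \<epsilon> * \<bar>y - x\<bar>)" for \<epsilon> x
  define S where "S \<epsilon> = {x\<in>{a<..<b}. bad \<epsilon> x}" for \<epsilon>
  have "negligible (\<Union>n. S (inverse (real (Suc n))))"
    unfolding S_def bad_def F_def
    by (rule negligible_Union_nat, rule negligible_bad_difference_quotients[OF f]) simp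
  moreover have "{x\<in>{a<..<b}. \<not> (F has_real_derivative f x) (at x)} \<subseteq> (\<Union>n. S (inverse (real (Suc n))))"
  proof
    fix x assume "x \<in> {x\<in>{a<..<b}. \<not> (F has_real_derivative f x) (at x)}"
    then have x: "a < x" "x < b" "\<not> (F has_real_derivative f x) (at x)" by auto
    show "x \<in> (\<Union>n. S (inverse (real (Suc n))))"
    proof (rule ccontr)
      assume nS: "x \<notin> (\<Union>n. S (inverse (real (Suc n))))"
      have "(F has_derivative (\<lambda>h. f x * h)) (at x)"
        unfolding has_derivative_at_alt
      proof (intro conjI allI impI)
        show "bounded_linear ((*) (f x))" by (rule bounded_linear_mult_right)
        fix e :: real assume "0 < e"
        then obtain n where n: "inverse (real (Suc n)) < e" using reals_Archimedean by blast
        from nS have "x \<notin> S (inverse (real (Suc n)))" by blast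
        then obtain \<delta> where \<delta>: "\<delta> > 0" "\<And>y. y \<in> {a..b} \<Longrightarrow> y \<noteq> x \<Longrightarrow> \<bar>y - x\<bar> < \<delta> \<Longrightarrow>
           \<bar>F y - F x - f x * (y - x)\<bar> \<le> inverse (real (Suc n)) * \<bar>y - x\<bar>"
        proof -
          have "\<not> bad (inverse (real (Suc n))) x"
            using x(1,2) \<open>x \<notin> S (inverse (real (Suc n)))\<close> by (simp add: S_def)
          then obtain \<delta> where \<delta>: "\<delta> > 0" and *: "\<not> (\<exists>y\<in>{a..b}. y \<noteq> x \<and> \<bar>y - x\<bar> < \<delta> \<and>
              \<bar>F y - F x - f x * (y - x)\<bar> > inverse (real (Suc n)) * \<bar>y - x\<bar>)"
            unfolding bad_def by blast
          show thesis
          proof (rule that[OF \<delta>])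
            fix y assume "y \<in> {a..b}" "y \<noteq> x" "\<bar>y - x\<bar> < \<delta>"
            with * show "\<bar>F y - F x - f x * (y - x)\<bar> \<le> inverse (real (Suc n)) * \<bar>y - x\<bar>"
              unfolding not_less[symmetric] by blast
          qed
        qed
        show "\<exists>d>0. \<forall>y. norm (y - x) < d \<longrightarrow> norm (F y - F x - f x * (y - x)) \<le> e * norm (y - x)"
        proof (intro exI[of _ "min \<delta> (min (x - a) (b - x))"] conjI allI impI)
          fix y assume y: "norm (y - x) < min \<delta> (min (x - a) (b - x))"
          show "norm (F y - F x - f x * (y - x)) \<le> e * norm (y - x)"
          proof (cases "y = x")
            case False
            have "\<bar>F y - F x - f x * (y - x)\<bar> \<le> inverse (real (Suc n)) * \<bar>y - x\<bar>"
              using y False by (intro \<delta>) (auto simp: abs_if split: if_splits)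
            also have "\<dots> \<le> e * \<bar>y - x\<bar>" using n by (intro mult_right_mono) auto
            finally show ?thesis by simp
          qed simp
        qed (use \<delta> x in auto)
      qed
      then show False using x(3) by (simp add: has_field_derivative_def)
    qed
  qed
  ultimately show ?thesis unfolding F_def by (rule negligible_subset)
qed

text \<open>\<open>E\<close> transports Lebesgue measure to a measure that the upper bound makes absolutely continuous.
  Its Radon-Nikodym density integrates to the increments of \<open>E\<close>, so it is the derivative of \<open>E\<close>
  at almost every point. The derivative is chosen Borel measurable and with the bounds holding
  everywhere, so that it can serve as a control.\<close>

lemma bilipschitz_ae_derivative:
  fixes E :: "real \<Rightarrow> real"
  assumes "0 < c1" and slope: "\<And>s t. s \<le> t \<Longrightarrow> c1 * (t - s) \<le> E t - E s \<and> E t - E s \<le> c2 * (t - s)"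
  obtains f where "f \<in> borel_measurable borel" "\<And>x. c1 \<le> f x \<and> f x \<le> c2"
    "negligible {x. \<not> (E has_real_derivative f x) (at x)}"
proof -
  have "c1 \<le> c2" using slope[of 0 1] by simp
  have lower: "c1 * \<bar>t - s\<bar> \<le> \<bar>E t - E s\<bar>" and upper: "\<bar>E t - E s\<bar> \<le> c2 * \<bar>t - s\<bar>" for s t
  proof -
    have *: "c1 * \<bar>t - s\<bar> \<le> \<bar>E t - E s\<bar> \<and> \<bar>E t - E s\<bar> \<le> c2 * \<bar>t - s\<bar>" if "s \<le> t" for s t
    proof -
      have "0 \<le> c1 * (t - s)" using that \<open>0 < c1\<close> by simp
      then show ?thesis using slope[OF that] that by simp
    qed
    show "c1 * \<bar>t - s\<bar> \<le> \<bar>E t - E s\<bar>" "\<bar>E t - E s\<bar> \<le> c2 * \<bar>t - s\<bar>"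
      using *[of s t] *[of t s] by (metis abs_minus_commute linear)+
  qed
  have E_mono: "E s \<le> E t" if "s \<le> t" for s t
  proof -
    have "0 \<le> c1 * (t - s)" using that \<open>0 < c1\<close> by simp
    then show ?thesis using slope[OF that] by linarith
  qed
  have cont: "continuous_on S E" for S
    unfolding continuous_on_iff
  proof (intro ballI allI impI)
    fix x and e :: real assume "e > 0"
    show "\<exists>d>0. \<forall>x'\<in>S. dist x' x < d \<longrightarrow> dist (E x') (E x) < e"
    proof (intro exI[of _ "e / c2"] conjI ballI impI)
      show "e / c2 > 0" using \<open>e > 0\<close> \<open>0 < c1\<close> \<open>c1 \<le> c2\<close> by simp
      fix y assume "dist y x < e / c2"
      then have "c2 * \<bar>y - x\<bar> < e" using \<open>0 < c1\<close> \<open>c1 \<le> c2\<close> by (simp add: dist_real_def field_simps)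
      then show "dist (E y) (E x) < e" using upper[of y x] by (simp add: dist_real_def)
    qed
  qed
  have "inj E"
  proof (rule injI)
    fix x y assume "E x = E y"
    then have "c1 * \<bar>x - y\<bar> \<le> 0" using lower[of x y] by simp
    then show "x = y" using \<open>0 < c1\<close> by (simp add: mult_le_0_iff)
  qed
  have "surj E"
    unfolding surj_def
  proof
    fix y
    define r where "r = \<bar>y - E 0\<bar> / c1"
    have "r \<ge> 0" using \<open>0 < c1\<close> by (simp add: r_def)
    have "c1 * r = \<bar>y - E 0\<bar>" using \<open>0 < c1\<close> by (simp add: r_def)
    then have "E (- r) \<le> y" "y \<le> E r"
      using slope[of "- r" 0] slope[of 0 r] \<open>r \<ge> 0\<close> by auto
    then show "\<exists>x. y = E x" using IVT'[of E "- r" y r] cont \<open>r \<ge> 0\<close> by force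
  qed
  define G where "G = inv E"
  have GE [simp]: "G (E x) = x" and EG [simp]: "E (G y) = y" for x y
    using \<open>inj E\<close> \<open>surj E\<close> by (simp_all add: G_def surj_f_inv_f)
  have vimage_G: "G -` A = E ` A" for A
    by (metis EG GE bij_betw_def bij_vimage_eq_inv_image \<open>inj E\<close> \<open>surj E\<close> G_def inj_imp_inv_eq inv_inv_eq surj_imp_inj_inv bij_imp_bij_inv)
  have "continuous_on UNIV G"
    unfolding continuous_on_iff
  proof (intro ballI allI impI)
    fix x and e :: real assume "e > 0"
    show "\<exists>d>0. \<forall>x'\<in>UNIV. dist x' x < d \<longrightarrow> dist (G x') (G x) < e"
    proof (intro exI[of _ "c1 * e"] conjI ballI impI)
      show "c1 * e > 0" using \<open>e > 0\<close> \<open>0 < c1\<close> by simp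
      fix y assume "dist y x < c1 * e"
      then have "c1 * \<bar>G y - G x\<bar> < c1 * e" using lower[of "G y" "G x"] by (simp add: dist_real_def)
      then show "dist (G y) (G x) < e" using \<open>0 < c1\<close> by (simp add: dist_real_def)
    qed
  qed
  then have G_meas: "G \<in> borel_measurable borel" by (rule borel_measurable_continuous_onI)
  \<comment> \<open>\<open>\<mu> A\<close> is the length of \<open>E ` A\<close>\<close>
  define \<mu> where "\<mu> = distr lborel borel G"
  have em_\<mu>: "emeasure \<mu> A = emeasure lborel (E ` A)" if "A \<in> sets borel" for A
    using that G_meas by (simp add: \<mu>_def emeasure_distr vimage_G)
  have "absolutely_continuous lborel \<mu>"
    unfolding absolutely_continuous_def
  proof
    fix A :: "real set" assume A: "A \<in> null_sets lborel"
    then have "A \<in> sets borel" and "negligible A"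
      by (auto simp: negligible_iff_null_sets null_sets_completionI)
    have "negligible (E ` A)"
    proof (rule negligible_locally_Lipschitz_image)
      fix x
      show "\<exists>T B. open T \<and> x \<in> T \<and> (\<forall>y \<in> A \<inter> T. norm (E y - E x) \<le> B * norm (y - x))"
        using upper by (intro exI[of _ UNIV] exI[of _ c2]) auto
    qed (use \<open>negligible A\<close> in auto)
    moreover have "E ` A \<in> sets borel"
      using measurable_sets[OF G_meas \<open>A \<in> sets borel\<close>] by (simp add: vimage_G)
    ultimately have "emeasure lborel (E ` A) = 0"
      by (simp add: negligible_iff_null_sets null_sets_def)
    then show "A \<in> null_sets \<mu>"
      using em_\<mu> \<open>A \<in> sets borel\<close> by (simp add: null_sets_def \<mu>_def)
  qed
  moreover have "sets \<mu> = sets lborel" by (simp add: \<mu>_def)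
  ultimately obtain \<phi> where \<phi>: "\<phi> \<in> borel_measurable lborel" "density lborel \<phi> = \<mu>"
    using sigma_finite_measure.Radon_Nikodym[OF sigma_finite_lborel] by blast
  have \<phi>_int: "(\<integral>\<^sup>+x. \<phi> x * indicator {a..b} x \<partial>lborel) = ennreal (E b - E a)" if "a \<le> b" for a b
  proof -
    have "E ` {a..b} = {E a..E b}"
    proof
      show "E ` {a..b} \<subseteq> {E a..E b}" using E_mono by auto
      show "{E a..E b} \<subseteq> E ` {a..b}"
        using IVT'[of E a _ b] cont \<open>a \<le> b\<close> by force
    qed
    moreover have "E a \<le> E b" by (rule E_mono[OF that])
    ultimately have "emeasure \<mu> {a..b} = ennreal (E b - E a)" by (simp add: em_\<mu>)
    moreover have "emeasure (density lborel \<phi>) {a..b} = (\<integral>\<^sup>+x. \<phi> x * indicator {a..b} x \<partial>lborel)"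
      using \<phi>(1) by (rule emeasure_density) simp
    ultimately show ?thesis unfolding \<phi>(2) by simp
  qed
  define g where "g x = enn2real (\<phi> x)" for x
  have g_meas: "g \<in> borel_measurable borel" using \<phi>(1) unfolding g_def by measurable
  have g_int: "(g has_integral (E b - E a)) {a..b}" if "a \<le> b" for a b
  proof -
    have Eab: "0 \<le> E b - E a" using E_mono[OF that] by simp
    have meas: "(\<lambda>x. g x * indicator {a..b} x) \<in> borel_measurable borel" using g_meas by measurable
    have nonneg: "0 \<le> g x * indicator {a..b} x" for x by (simp add: g_def)
    have "AE x in lborel. \<phi> x * indicator {a..b} x \<noteq> \<infinity>"
      using \<phi>(1) \<phi>_int[OF that] by (intro nn_integral_noteq_infinite) auto
    then have "(\<integral>\<^sup>+x. ennreal (g x * indicator {a..b} x) \<partial>lborel) = (\<integral>\<^sup>+x. \<phi> x * indicator {a..b} x \<partial>lborel)"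
      by (intro nn_integral_cong_AE) (auto simp: g_def indicator_def less_top elim!: eventually_mono)
    then have "((\<lambda>x. g x * indicator {a..b} x) has_integral (E b - E a)) UNIV"
      using Eab \<phi>_int[OF that] by (intro nn_integral_has_integral meas nonneg) simp_all
    moreover have "(\<lambda>x. g x * indicator {a..b} x) = (\<lambda>x. if x \<in> {a..b} then g x else 0)"
      by (auto simp: indicator_def)
    ultimately show ?thesis by (simp only: has_integral_restrict_UNIV)
  qed
  \<comment> \<open>truncation leaves \<open>g\<close> unchanged wherever it is the derivative of \<open>E\<close>\<close>
  define f where "f x = max c1 (min c2 (g x))" for x
  have "f \<in> borel_measurable borel" using g_meas unfolding f_def by measurable
  moreover have "c1 \<le> f x \<and> f x \<le> c2" for x using \<open>c1 \<le> c2\<close> by (auto simp: f_def)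
  moreover have "negligible {x. \<not> (E has_real_derivative f x) (at x)}"
  proof (rule negligible_subset)
    define B where "B n = {x\<in>{- real n<..<real n}.
        \<not> ((\<lambda>t. integral {- real n..t} g) has_real_derivative g x) (at x)}" for n
    have "g integrable_on {- real n..real n}" for n
      using g_int[of "- real n" "real n"] by (auto simp: integrable_on_def)
    then show "negligible (\<Union>n. B n)"
      unfolding B_def by (intro negligible_Union_nat lebesgue_differentiation)
    show "{x. \<not> (E has_real_derivative f x) (at x)} \<subseteq> (\<Union>n. B n)"
    proof (rule subsetI, rule ccontr)
      fix x assume x: "x \<in> {x. \<not> (E has_real_derivative f x) (at x)}" "x \<notin> (\<Union>n. B n)"
      obtain n where n: "\<bar>x\<bar> < real n" using reals_Archimedean2 by blast
      then have F: "((\<lambda>t. integral {- real n..t} g) has_real_derivative g x) (at x)"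
        using x by (auto simp: B_def)
      have F_eq: "integral {- real n..t} g = E t - E (- real n)" if "t \<in> {- real n<..}" for t
        using g_int[of "- real n" t] that by (auto intro: integral_unique)
      have "((\<lambda>t. E t - E (- real n)) has_real_derivative g x) (at x)"
        by (rule has_field_derivative_transform_within_open[OF F open_greaterThan _ F_eq]) (use n in auto)
      then have "((\<lambda>t. (E t - E (- real n)) + E (- real n)) has_real_derivative g x + 0) (at x)"
        by (intro DERIV_add) auto
      then have deriv: "(E has_real_derivative g x) (at x)" by simp
      then have lim: "((\<lambda>h. (E (x + h) - E x) / h) \<longlongrightarrow> g x) (at 0)" by (simp add: DERIV_def)
      have quot: "c1 \<le> (E (x + h) - E x) / h \<and> (E (x + h) - E x) / h \<le> c2" if "h \<noteq> 0" for h
      proof (cases "h > 0")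
        case True
        then show ?thesis using slope[of x "x + h"] by (simp add: field_simps)
      next
        case False
        then show ?thesis using slope[of "x + h" x] that by (simp add: field_simps)
      qed
      have "c1 \<le> g x" by (rule tendsto_lowerbound[OF lim]) (use quot in \<open>auto simp: eventually_at intro: exI[of _ 1]\<close>)
      moreover have "g x \<le> c2" by (rule tendsto_upperbound[OF lim]) (use quot in \<open>auto simp: eventually_at intro: exI[of _ 1]\<close>)
      ultimately have "f x = g x" by (simp add: f_def)
      then show False using deriv x by simp
    qed
  qed
  ultimately show thesis by (rule that)
qed

section \<open>Semicontinuity and compactness\<close>

text \<open>Functions on the sphere are studied through their lifts to \<open>\<complex>\<^sup>2\<close>, which behave well only away
  from the origin; this calls for lower semicontinuity at a point.\<close>

definition lsc_at :: "('a::topological_space \<Rightarrow> ereal) \<Rightarrow> 'a \<Rightarrow> bool" where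
  "lsc_at F x \<longleftrightarrow> (\<forall>a<F x. \<forall>\<^sub>F y in nhds x. a < F y)"

lemma lower_semicontinuous_iff_lsc_at: "lower_semicontinuous V \<longleftrightarrow> (\<forall>x. lsc_at V x)"
  unfolding lower_semicontinuous_def lsc_at_def ..

lemma lsc_at_compose:
  assumes "lsc_at F (f x)" "isCont f x"
  shows "lsc_at (\<lambda>y. F (f y)) x"
proof -
  have "filterlim f (nhds (f x)) (nhds x)"
    using assms(2) by (simp add: isCont_def tendsto_at_iff_tendsto_nhds)
  then show ?thesis
    using assms(1) unfolding lsc_at_def filterlim_iff by blast
qed

lemma lsc_at_add_continuous:
  fixes F :: "'a::t2_space \<Rightarrow> ereal" and g :: "'a \<Rightarrow> real"
  assumes F: "lsc_at F x" and g: "isCont g x"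
  shows "lsc_at (\<lambda>y. F y + ereal (g y)) x"
  unfolding lsc_at_def
proof (intro allI impI)
  fix a assume a: "a < F x + ereal (g x)"
  have "a - ereal (g x) < F x"
    using a by (cases a; cases "F x") auto
  then obtain r where r: "a - ereal (g x) < ereal r" "ereal r < F x"
    using ereal_dense2 by blast
  have ar: "a < ereal (r + g x)" using r(1) by (cases a) auto
  have lim: "filterlim g (nhds (g x)) (nhds x)"
    using g by (simp add: isCont_def tendsto_at_iff_tendsto_nhds)
  have "filterlim (\<lambda>y. ereal (r + g y)) (nhds (ereal (r + g x))) (nhds x)"
    by (intro tendsto_intros lim)
  then have "\<forall>\<^sub>F y in nhds x. a < ereal (r + g y)"
    using ar by (rule order_tendstoD)
  moreover have "\<forall>\<^sub>F y in nhds x. ereal r < F y"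
    using F r(2) unfolding lsc_at_def by blast
  ultimately show "\<forall>\<^sub>F y in nhds x. a < F y + ereal (g y)"
  proof eventually_elim
    case (elim y)
    have "ereal (r + g y) \<le> F y + ereal (g y)"
      using elim(2) by (cases "F y") auto
    then show ?case using elim(1) by simp
  qed
qed

lemma lsc_attains_min:
  assumes "compact K" "K \<noteq> {}" and lsc: "\<And>x. x \<in> K \<Longrightarrow> lsc_at F x"
  obtains x where "x \<in> K" "\<And>y. y \<in> K \<Longrightarrow> F x \<le> F y"
proof (rule ccontr)
  assume "\<not> thesis"
  with that have "\<And>x. x \<in> K \<Longrightarrow> \<exists>y\<in>K. F y < F x" by (meson not_le)
  then obtain b where b: "\<And>x. x \<in> K \<Longrightarrow> b x \<in> K \<and> F (b x) < F x" by metis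
  have "\<exists>U. open U \<and> x \<in> U \<and> (\<forall>y\<in>U. F (b x) < F y)" if "x \<in> K" for x
    using lsc[OF that] b[OF that] unfolding lsc_at_def eventually_nhds by blast
  then obtain U where U: "\<And>x. x \<in> K \<Longrightarrow> open (U x) \<and> x \<in> U x \<and> (\<forall>y\<in>U x. F (b x) < F y)"
    by metis
  have "K \<subseteq> (\<Union>x\<in>K. U x)" using U by blast
  then obtain C where C: "C \<subseteq> K" "finite C" "K \<subseteq> (\<Union>x\<in>C. U x)"
    using compactE_image[OF \<open>compact K\<close>, of K U] U by metis
  have "C \<noteq> {}" using C(3) \<open>K \<noteq> {}\<close> by auto
  \<comment> \<open>a finite subcover leaves finitely many values \<open>F (b x)\<close>, and the smallest of them cannot be undercut\<close>
  define j where "j = arg_min_on (\<lambda>x. F (b x)) C"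
  have j: "j \<in> C" "\<And>i. i \<in> C \<Longrightarrow> F (b j) \<le> F (b i)"
    unfolding j_def using arg_min_if_finite(1)[OF C(2) \<open>C \<noteq> {}\<close>] arg_min_least[OF C(2) \<open>C \<noteq> {}\<close>] by auto
  have "b j \<in> K" using b j(1) C(1) by blast
  then obtain i where "i \<in> C" "b j \<in> U i" using C(3) by blast
  then have "F (b i) < F (b j)" using U C(1) by blast
  then show False using j(2)[OF \<open>i \<in> C\<close>] by simp
qed

lemma compact_pos_lower_bound:
  fixes f :: "'a::topological_space \<Rightarrow> real"
  assumes "compact K" "continuous_on K f" "\<And>x. x \<in> K \<Longrightarrow> 0 < f x"
  obtains c where "0 < c" "\<And>x. x \<in> K \<Longrightarrow> c \<le> f x"
proof (cases "K = {}")
  case True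
  then show thesis by (intro that[of 1]) auto
next
  case False
  then obtain x where "x \<in> K" "\<And>y. y \<in> K \<Longrightarrow> f x \<le> f y"
    using continuous_attains_inf[OF assms(1) _ assms(2)] by blast
  then show thesis using assms(3) that by blast
qed

text \<open>Uniform continuity on the compact product makes the functions \<open>\<lambda>u. g (u, k)\<close> equicontinuous, and
  an infimum of equicontinuous functions is continuous.\<close>

lemma continuous_on_INF_compact:
  fixes g :: "'a::metric_space \<times> 'b::metric_space \<Rightarrow> real"
  assumes "compact S" "compact K" "K \<noteq> {}" "continuous_on (S \<times> K) g"
  shows "continuous_on S (\<lambda>u. INF k\<in>K. g (u, k))"
  unfolding continuous_on_iff
proof (intro ballI allI impI)
  fix u and e :: real assume u: "u \<in> S" and e: "e > 0"
  have uc: "uniformly_continuous_on (S \<times> K) g"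
    using assms by (intro compact_uniformly_continuous compact_Times)
  obtain d where d: "d > 0" "\<And>x y. x \<in> S \<times> K \<Longrightarrow> y \<in> S \<times> K \<Longrightarrow> dist y x < d \<Longrightarrow> dist (g y) (g x) < e / 2"
    using uc e unfolding uniformly_continuous_on_def by (metis half_gt_zero)
  have bdd: "bdd_below ((\<lambda>k. g (v, k)) ` K)" if "v \<in> S" for v
  proof -
    have "continuous_on K (\<lambda>k. g (v, k))"
      by (rule continuous_on_compose2[OF assms(4)]) (use that in \<open>auto intro!: continuous_intros\<close>)
    then show ?thesis using assms(2) by (intro bounded_imp_bdd_below compact_imp_bounded compact_continuous_image)
  qed
  have le: "(INF k\<in>K. g (v, k)) \<le> (INF k\<in>K. g (w, k)) + e / 2" if "v \<in> S" "w \<in> S" "dist v w < d" for v w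
  proof -
    have "(INF k\<in>K. g (v, k)) - e / 2 \<le> (INF k\<in>K. g (w, k))"
    proof (rule cINF_greatest[OF assms(3)])
      fix k assume k: "k \<in> K"
      have "(INF k\<in>K. g (v, k)) \<le> g (v, k)" by (rule cINF_lower[OF bdd[OF that(1)] k])
      moreover have "dist (g (v, k)) (g (w, k)) < e / 2"
        using d(2)[of "(w, k)" "(v, k)"] that k by (simp add: dist_Pair_Pair)
      then have "g (v, k) - g (w, k) < e / 2" unfolding dist_real_def by linarith
      ultimately show "(INF k\<in>K. g (v, k)) - e / 2 \<le> g (w, k)" by linarith
    qed
    then show ?thesis by simp
  qed
  show "\<exists>d>0. \<forall>x'\<in>S. dist x' u < d \<longrightarrow> dist (INF k\<in>K. g (x', k)) (INF k\<in>K. g (u, k)) < e"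
  proof (intro exI[of _ d] conjI ballI impI)
    fix v assume v: "v \<in> S" "dist v u < d"
    show "dist (INF k\<in>K. g (v, k)) (INF k\<in>K. g (u, k)) < e"
      using le[OF v(1) u v(2)] le[OF u v(1) v(2)[unfolded dist_commute[of v u]]] e
      unfolding dist_real_def by linarith
  qed (use d in auto)
qed

lemma bdd_above_continuous_image:
  fixes f :: "real \<Rightarrow> real"
  assumes "continuous_on {a..b} f"
  shows "bdd_above (f ` {a..b})"
  using assms by (intro bounded_imp_bdd_above compact_imp_bounded compact_continuous_image) auto

section \<open>Absolutely continuous functions\<close>

definition interval_family :: "real \<Rightarrow> real \<Rightarrow> (real \<times> real) set \<Rightarrow> bool" where
  "interval_family a b I \<longleftrightarrow> finite I \<and> (\<forall>(u, v)\<in>I. a \<le> u \<and> u \<le> v \<and> v \<le> b) \<and>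
     pairwise (\<lambda>(u, v) (u', v'). {u<..<v} \<inter> {u'<..<v'} = {}) I"

lemma abs_continuous_on_iff:
  "abs_continuous_on a b g \<longleftrightarrow>
     (\<forall>e>0. \<exists>d>0. \<forall>I. interval_family a b I \<and> (\<Sum>(u, v)\<in>I. v - u) < d \<longrightarrow>
        (\<Sum>(u, v)\<in>I. norm (g v - g u)) < e)"
  unfolding abs_continuous_on_def interval_family_def by (simp only: conj_assoc)

lemma interval_familyD:
  "interval_family a b I \<Longrightarrow> (u, v) \<in> I \<Longrightarrow> a \<le> u \<and> u \<le> v \<and> v \<le> b"
  unfolding interval_family_def by auto

lemma abs_continuous_onE:
  assumes "abs_continuous_on a b g" "e > 0"
  obtains d where "d > 0" "\<And>I. interval_family a b I \<Longrightarrow> (\<Sum>(u, v)\<in>I. v - u) < d \<Longrightarrow>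
        (\<Sum>(u, v)\<in>I. norm (g v - g u)) < e"
  using assms unfolding abs_continuous_on_iff by meson

lemma abs_continuous_on_subset:
  assumes "abs_continuous_on a b g" "a \<le> a'" "b' \<le> b"
  shows "abs_continuous_on a' b' g"
proof -
  have "interval_family a b I" if "interval_family a' b' I" for I
    using that assms(2,3) unfolding interval_family_def by fastforce
  then show ?thesis using assms(1) unfolding abs_continuous_on_iff by meson
qed

lemma abs_continuous_on_cong:
  assumes "abs_continuous_on a b f" "\<And>s. s \<in> {a..b} \<Longrightarrow> g s = f s"
  shows "abs_continuous_on a b g"
proof -
  have "(\<Sum>(u, v)\<in>I. norm (g v - g u)) = (\<Sum>(u, v)\<in>I. norm (f v - f u))"
    if "interval_family a b I" for I
    using interval_familyD[OF that] assms(2) by (intro sum.cong) force+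
  then show ?thesis using assms(1) unfolding abs_continuous_on_iff by metis
qed

lemma abs_continuous_on_imp_continuous_on:
  assumes "abs_continuous_on a b g"
  shows "continuous_on {a..b} g"
  unfolding continuous_on_iff
proof (intro ballI allI impI)
  fix x and e :: real assume x: "x \<in> {a..b}" and "e > 0"
  with assms obtain d where "d > 0" and d: "\<And>I. interval_family a b I \<and> (\<Sum>(u, v)\<in>I. v - u) < d \<Longrightarrow> (\<Sum>(u, v)\<in>I. norm (g v - g u)) < e"
    unfolding abs_continuous_on_iff by meson
  show "\<exists>d>0. \<forall>x'\<in>{a..b}. dist x' x < d \<longrightarrow> dist (g x') (g x) < e"
  proof (intro exI[of _ d] conjI ballI impI)
    fix y assume y: "y \<in> {a..b}" "dist y x < d"
    show "dist (g y) (g x) < e"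
      using d[of "{(min x y, max x y)}"] x y unfolding interval_family_def
      by (cases "x \<le> y") (auto simp: dist_norm min_def max_def norm_minus_commute)
  qed fact
qed

lemma abs_continuous_on_if_lipschitz:
  assumes "\<And>u v. a \<le> u \<Longrightarrow> u \<le> v \<Longrightarrow> v \<le> b \<Longrightarrow> norm (g v - g u) \<le> L * (v - u)"
  shows "abs_continuous_on a b g"
  unfolding abs_continuous_on_iff
proof (intro allI impI)
  fix e :: real assume "e > 0"
  show "\<exists>d>0. \<forall>I. interval_family a b I \<and> (\<Sum>(u, v)\<in>I. v - u) < d \<longrightarrow> (\<Sum>(u, v)\<in>I. norm (g v - g u)) < e"
  proof (intro exI[of _ "e / (\<bar>L\<bar> + 1)"] conjI allI impI)
    show "e / (\<bar>L\<bar> + 1) > 0" using \<open>e > 0\<close> by simp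
    fix I :: "(real \<times> real) set"
    assume I: "interval_family a b I \<and> (\<Sum>(u, v)\<in>I. v - u) < e / (\<bar>L\<bar> + 1)"
    have "(\<Sum>(u, v)\<in>I. norm (g v - g u)) \<le> (\<Sum>(u, v)\<in>I. (\<bar>L\<bar> + 1) * (v - u))"
    proof (rule sum_mono, clarify)
      fix u v assume "(u, v) \<in> I"
      then have uv: "a \<le> u" "u \<le> v" "v \<le> b" using I interval_familyD by blast+
      have "norm (g v - g u) \<le> L * (v - u)" using assms uv by blast
      also have "\<dots> \<le> (\<bar>L\<bar> + 1) * (v - u)" using uv by (intro mult_right_mono) auto
      finally show "norm (g v - g u) \<le> (\<bar>L\<bar> + 1) * (v - u)" .
    qed
    also have "\<dots> = (\<bar>L\<bar> + 1) * (\<Sum>(u, v)\<in>I. v - u)" by (simp add: sum_distrib_left split_def)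
    also have "\<dots> < e" using I by (simp add: field_simps)
    finally show "(\<Sum>(u, v)\<in>I. norm (g v - g u)) < e" .
  qed
qed

lemma abs_continuous_on_diff:
  assumes "abs_continuous_on a b f" "abs_continuous_on a b g"
  shows "abs_continuous_on a b (\<lambda>s. f s - g s)"
  unfolding abs_continuous_on_iff
proof (intro allI impI)
  fix e :: real assume "e > 0"
  then have "e / 2 > 0" by simp
  with assms(1) obtain d1 where "d1 > 0" and d1: "\<And>I. interval_family a b I \<and> (\<Sum>(u, v)\<in>I. v - u) < d1 \<Longrightarrow> (\<Sum>(u, v)\<in>I. norm (f v - f u)) < e / 2"
    unfolding abs_continuous_on_iff by meson
  from \<open>e / 2 > 0\<close> assms(2) obtain d2 where "d2 > 0" and d2: "\<And>I. interval_family a b I \<and> (\<Sum>(u, v)\<in>I. v - u) < d2 \<Longrightarrow> (\<Sum>(u, v)\<in>I. norm (g v - g u)) < e / 2"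
    unfolding abs_continuous_on_iff by meson
  show "\<exists>d>0. \<forall>I. interval_family a b I \<and> (\<Sum>(u, v)\<in>I. v - u) < d \<longrightarrow> (\<Sum>(u, v)\<in>I. norm ((f v - g v) - (f u - g u))) < e"
  proof (intro exI[of _ "min d1 d2"] conjI allI impI)
    fix I :: "(real \<times> real) set"
    assume I: "interval_family a b I \<and> (\<Sum>(u, v)\<in>I. v - u) < min d1 d2"
    have "(\<Sum>(u, v)\<in>I. norm ((f v - g v) - (f u - g u)))
        \<le> (\<Sum>(u, v)\<in>I. norm (f v - f u) + norm (g v - g u))"
    proof (rule sum_mono, clarify)
      fix u v
      have "(f v - g v) - (f u - g u) = (f v - f u) - (g v - g u)" by simp
      then show "norm ((f v - g v) - (f u - g u)) \<le> norm (f v - f u) + norm (g v - g u)"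
        by (metis norm_triangle_ineq4)
    qed
    also have "\<dots> = (\<Sum>(u, v)\<in>I. norm (f v - f u)) + (\<Sum>(u, v)\<in>I. norm (g v - g u))"
      by (simp add: split_def sum.distrib)
    also have "\<dots> < e" using d1[of I] d2[of I] I by simp
    finally show "(\<Sum>(u, v)\<in>I. norm ((f v - g v) - (f u - g u))) < e" .
  qed (use \<open>d1 > 0\<close> \<open>d2 > 0\<close> in auto)
qed

lemma abs_continuous_on_mult_lipschitz:
  fixes f g :: "real \<Rightarrow> 'a::real_normed_algebra"
  assumes f: "abs_continuous_on a b f"
    and g: "\<And>u v. a \<le> u \<Longrightarrow> u \<le> v \<Longrightarrow> v \<le> b \<Longrightarrow> norm (g v - g u) \<le> L * (v - u)"
  shows "abs_continuous_on a b (\<lambda>s. f s * g s)"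
proof -
  have bounded: "bounded (h ` {a..b})" if "abs_continuous_on a b h" for h :: "real \<Rightarrow> 'a"
    using that by (intro compact_imp_bounded compact_continuous_image
        abs_continuous_on_imp_continuous_on compact_Icc)
  have "bounded (f ` {a..b})" "bounded (g ` {a..b})"
    using bounded[OF f] bounded[OF abs_continuous_on_if_lipschitz[OF g]] by simp_all
  then obtain B1 B2 where B: "0 < B1" "\<And>s. s \<in> {a..b} \<Longrightarrow> norm (f s) \<le> B1"
      "0 < B2" "\<And>s. s \<in> {a..b} \<Longrightarrow> norm (g s) \<le> B2"
    unfolding bounded_pos by blast
  have prod: "norm (f v * g v - f u * g u) \<le> B2 * norm (f v - f u) + B1 * \<bar>L\<bar> * (v - u)"
    if "a \<le> u" "u \<le> v" "v \<le> b" for u v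
  proof -
    have "f v * g v - f u * g u = (f v - f u) * g v + f u * (g v - g u)" by (simp add: algebra_simps)
    then have "norm (f v * g v - f u * g u) \<le> norm ((f v - f u) * g v) + norm (f u * (g v - g u))"
      using norm_triangle_ineq by simp
    also have "\<dots> \<le> norm (f v - f u) * norm (g v) + norm (f u) * norm (g v - g u)"
      by (intro add_mono norm_mult_ineq)
    also have "\<dots> \<le> norm (f v - f u) * B2 + B1 * (\<bar>L\<bar> * (v - u))"
    proof (intro add_mono mult_mono B)
      show "norm (g v - g u) \<le> \<bar>L\<bar> * (v - u)"
        using g[OF that] mult_right_mono[OF abs_ge_self, of "v - u" L] that by linarith
    qed (use that B(1,3) in simp_all)
    finally show ?thesis by (simp add: algebra_simps)
  qed
  show ?thesis
    unfolding abs_continuous_on_iff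
  proof (intro allI impI)
    fix e :: real assume "e > 0"
    then have "e / (2 * B2) > 0" using B by simp
    with f obtain d1 where "d1 > 0" and d1: "\<And>I. interval_family a b I \<and> (\<Sum>(u, v)\<in>I. v - u) < d1 \<Longrightarrow> (\<Sum>(u, v)\<in>I. norm (f v - f u)) < e / (2 * B2)"
      unfolding abs_continuous_on_iff by meson
    define c where "c = B1 * (\<bar>L\<bar> + 1)"
    have "c > 0" using B by (simp add: c_def)
    define d where "d = min d1 (e / (2 * c))"
    show "\<exists>d>0. \<forall>I. interval_family a b I \<and> (\<Sum>(u, v)\<in>I. v - u) < d \<longrightarrow> (\<Sum>(u, v)\<in>I. norm (f v * g v - f u * g u)) < e"
    proof (intro exI[of _ d] conjI allI impI)
      show "d > 0" using \<open>c > 0\<close> \<open>d1 > 0\<close> \<open>e > 0\<close> by (simp add: d_def)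
      fix I :: "(real \<times> real) set"
      assume I: "interval_family a b I \<and> (\<Sum>(u, v)\<in>I. v - u) < d"
      have len: "0 \<le> (\<Sum>(u, v)\<in>I. v - u)" using I by (intro sum_nonneg) (auto dest: interval_familyD)
      have "(\<Sum>(u, v)\<in>I. norm (f v * g v - f u * g u))
          \<le> (\<Sum>(u, v)\<in>I. B2 * norm (f v - f u) + B1 * \<bar>L\<bar> * (v - u))"
        using I by (intro sum_mono) (auto intro!: prod dest: interval_familyD)
      also have "\<dots> = B2 * (\<Sum>(u, v)\<in>I. norm (f v - f u)) + B1 * \<bar>L\<bar> * (\<Sum>(u, v)\<in>I. v - u)"
        by (simp add: split_def sum.distrib sum_distrib_left)
      also have "\<dots> < e / 2 + e / 2"
      proof (rule add_less_le_mono)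
        show "B2 * (\<Sum>(u, v)\<in>I. norm (f v - f u)) < e / 2"
          using d1[of I] I B by (simp add: d_def field_simps)
        have "B1 * \<bar>L\<bar> \<le> c" using B by (simp add: c_def)
        then have "B1 * \<bar>L\<bar> * (\<Sum>(u, v)\<in>I. v - u) \<le> c * (e / (2 * c))"
          using I \<open>c > 0\<close> len by (intro mult_mono) (auto simp: d_def)
        also have "\<dots> = e / 2" using \<open>c > 0\<close> by simp
        finally show "B1 * \<bar>L\<bar> * (\<Sum>(u, v)\<in>I. v - u) \<le> e / 2" .
      qed
      finally show "(\<Sum>(u, v)\<in>I. norm (f v * g v - f u * g u)) < e" by simp
    qed
  qed
qed

lemma abs_continuous_on_lipschitz_quotient:
  fixes p q :: "real \<Rightarrow> complex"
  assumes p: "\<And>u v. a \<le> u \<Longrightarrow> u \<le> v \<Longrightarrow> v \<le> b \<Longrightarrow> norm (p v - p u) \<le> L * (v - u)"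
    and q: "\<And>u v. a \<le> u \<Longrightarrow> u \<le> v \<Longrightarrow> v \<le> b \<Longrightarrow> norm (q v - q u) \<le> L * (v - u)"
    and nz: "\<And>s. s \<in> {a..b} \<Longrightarrow> q s \<noteq> 0"
  shows "abs_continuous_on a b (\<lambda>s. p s / q s)"
proof -
  have cont: "continuous_on {a..b} p" "continuous_on {a..b} q"
    by (rule abs_continuous_on_imp_continuous_on[OF abs_continuous_on_if_lipschitz[OF p]], assumption+)
      (rule abs_continuous_on_imp_continuous_on[OF abs_continuous_on_if_lipschitz[OF q]], assumption+)
  have "continuous_on {a..b} (\<lambda>s. norm (q s))" using cont by (intro continuous_intros)
  moreover have "0 < norm (q s)" if "s \<in> {a..b}" for s using nz[OF that] by simp
  ultimately obtain \<delta> where \<delta>: "0 < \<delta>" "\<And>s. s \<in> {a..b} \<Longrightarrow> \<delta> \<le> norm (q s)"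
    using compact_pos_lower_bound[of "{a..b}" "\<lambda>s. norm (q s)"] by (metis compact_Icc)
  have inv: "norm (inverse (q v) - inverse (q u)) \<le> (L / \<delta>\<^sup>2) * (v - u)" if uv: "a \<le> u" "u \<le> v" "v \<le> b" for u v
  proof -
    have qu: "q u \<noteq> 0" "q v \<noteq> 0" "\<delta> \<le> norm (q u)" "\<delta> \<le> norm (q v)" using nz \<delta> uv by auto
    have "inverse (q v) - inverse (q u) = (q u - q v) / (q v * q u)" using qu by (simp add: field_simps)
    then have "norm (inverse (q v) - inverse (q u)) = norm (q v - q u) / (norm (q v) * norm (q u))"
      by (simp add: norm_divide norm_mult norm_minus_commute)
    also have "\<dots> \<le> (L * (v - u)) / (\<delta> * \<delta>)"
      using q[OF uv] qu \<delta>(1) order_trans[OF norm_ge_zero q[OF uv]] by (intro frac_le mult_mono mult_pos_pos) auto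
    finally show ?thesis by (simp add: power2_eq_square)
  qed
  have "abs_continuous_on a b (\<lambda>s. p s * inverse (q s))"
    by (rule abs_continuous_on_mult_lipschitz[OF abs_continuous_on_if_lipschitz[OF p] inv])
  then show ?thesis by (simp add: divide_inverse)
qed

lemma negligible_imp_AE_lebesgue_on:
  fixes S N :: "'a::euclidean_space set"
  assumes "negligible N" "S \<in> sets lebesgue" "\<And>s. s \<in> S - N \<Longrightarrow> P s"
  shows "AE s in lebesgue_on S. P s"
proof -
  have "AE s in lebesgue. s \<notin> N"
    using assms(1) by (intro AE_not_in) (simp add: negligible_iff_null_sets)
  then have "AE s in lebesgue. s \<in> S \<longrightarrow> P s"
    by (rule AE_mp) (use assms(3) in auto)
  then show ?thesis using assms(2) by (simp add: AE_restrict_space_iff)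
qed

lemma AE_lebesgue_on_imp_negligible:
  fixes S :: "'a::euclidean_space set"
  assumes "AE s in lebesgue_on S. P s" "S \<in> sets lebesgue"
  obtains N where "negligible N" "\<And>s. s \<in> S - N \<Longrightarrow> P s"
proof -
  have "AE s in lebesgue. s \<in> S \<longrightarrow> P s"
    using assms by (simp add: AE_restrict_space_iff)
  then obtain N where "N \<in> null_sets lebesgue" "{s \<in> space lebesgue. \<not> (s \<in> S \<longrightarrow> P s)} \<subseteq> N"
    unfolding eventually_ae_filter by blast
  then show thesis by (intro that[of N]) (auto simp: negligible_iff_null_sets)
qed

text \<open>Take a tagged division that is fine for a gauge which confines intervals tagged outside \<open>N\<close> to the
  region where the difference quotient is close to the derivative, and intervals tagged in \<open>N\<close> to
  an open set of small measure. The first kind contributes at most \<open>L\<close> times its length up to a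
  small error, the second kind is negligible by absolute continuity.\<close>

lemma abs_continuous_on_mean_value:
  fixes g :: "real \<Rightarrow> 'a::real_normed_vector"
  assumes ac: "abs_continuous_on a b g" and "a \<le> b" and N: "negligible N"
    and deriv: "\<And>s. s \<in> {a..b} - N \<Longrightarrow>
      \<exists>v. (g has_vector_derivative v) (at s within {a..b}) \<and> norm v \<le> L"
  shows "norm (g b - g a) \<le> L * (b - a)"
proof (rule field_le_epsilon)
  fix e :: real assume "0 < e"
  define \<eta> where "\<eta> = e / (b - a + 1)"
  have "\<eta> > 0" using \<open>0 < e\<close> \<open>a \<le> b\<close> by (simp add: \<eta>_def)
  obtain d where "d > 0" and d: "\<And>I. interval_family a b I \<Longrightarrow> (\<Sum>(u, v)\<in>I. v - u) < d \<Longrightarrow>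
        (\<Sum>(u, v)\<in>I. norm (g v - g u)) < \<eta>"
    using abs_continuous_onE[OF ac \<open>\<eta> > 0\<close>] by metis
  obtain U where U: "open U" "N \<subseteq> U" "(U - N) \<in> lmeasurable" "emeasure lebesgue (U - N) < ennreal d"
    using sets_lebesgue_outer_open[OF negligible_imp_sets[OF N] \<open>d > 0\<close>] by metis
  have UN: "U = (U - N) \<union> N" using U by blast
  have U_meas: "U \<in> lmeasurable"
    using fmeasurable.Un[OF U(3) negligible_imp_measurable[OF N]] UN by metis
  have "measure lebesgue ((U - N) \<union> N) \<le> measure lebesgue (U - N) + measure lebesgue N"
    using fmeasurableD[OF U(3)] negligible_imp_sets[OF N] by (rule measure_Un_le)
  then have "measure lebesgue U \<le> measure lebesgue (U - N)"
    using UN negligible_imp_measure0[OF N] by simp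
  also have "\<dots> < d"
    using U(4) \<open>d > 0\<close> by (subst (asm) emeasure_eq_measure2[OF U(3)]) (simp add: ennreal_less_iff)
  finally have U_less: "measure lebesgue U < d" .
  define ok where "ok s r \<longleftrightarrow> r > 0 \<and> (\<forall>y\<in>{a..b}. \<bar>y - s\<bar> < r \<longrightarrow> norm (g y - g s) \<le> (L + \<eta>) * \<bar>y - s\<bar>)"
    for s r :: real
  have ex_ok: "\<exists>r. ok s r" if s: "s \<in> {a..b} - N" for s
  proof -
    obtain v where v: "(g has_vector_derivative v) (at s within {a..b})" "norm v \<le> L"
      using deriv[OF s] by blast
    then obtain r where r: "r > 0" "\<And>y. y \<in> {a..b} \<Longrightarrow> norm (y - s) < r \<Longrightarrow>
        norm (g y - g s - (y - s) *\<^sub>R v) \<le> \<eta> * norm (y - s)"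
      unfolding has_vector_derivative_def has_derivative_within_alt using \<open>\<eta> > 0\<close> by blast
    have "norm (g y - g s) \<le> (L + \<eta>) * \<bar>y - s\<bar>" if "y \<in> {a..b}" "\<bar>y - s\<bar> < r" for y
    proof -
      have "norm (g y - g s) \<le> norm (g y - g s - (y - s) *\<^sub>R v) + norm ((y - s) *\<^sub>R v)"
        using norm_triangle_ineq[of "g y - g s - (y - s) *\<^sub>R v" "(y - s) *\<^sub>R v"] by simp
      also have "\<dots> \<le> \<eta> * \<bar>y - s\<bar> + \<bar>y - s\<bar> * L"
        using r(2)[of y] that v(2) by (intro add_mono) (auto intro: mult_left_mono)
      finally show ?thesis by (simp add: algebra_simps)
    qed
    then show ?thesis using r(1) unfolding ok_def by blast
  qed
  then obtain r where r: "\<And>s. s \<in> {a..b} - N \<Longrightarrow> ok s (r s)" by metis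
  \<comment> \<open>intervals tagged in \<open>N\<close> are confined to \<open>U\<close>, the others to the radius \<open>r\<close>\<close>
  define \<gamma> where "\<gamma> s = (if s \<in> N then U else if s \<in> {a..b} then ball s (r s) else UNIV)" for s
  have "gauge \<gamma>"
    unfolding gauge_def \<gamma>_def using U r by (auto simp: ok_def)
  then obtain p where p: "p tagged_division_of {a..b}" "\<gamma> fine p"
    by (rule fine_division_exists_real)
  have fin: "finite p" using p(1) by blast
  have Kab: "\<exists>u v. K = {u..v} \<and> u \<le> s \<and> s \<le> v \<and> a \<le> u \<and> v \<le> b" if sK: "(s, K) \<in> p" for s K
  proof -
    obtain u v where "K = cbox u v" using tagged_division_ofD(4)[OF p(1) sK] by blast
    then have "K = {u..v}" by (simp add: cbox_interval)
    moreover have "s \<in> K" "K \<subseteq> {a..b}" using tagged_division_ofD(2,3)[OF p(1) sK] by auto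
    ultimately show ?thesis by (intro exI[of _ u] exI[of _ v]) auto
  qed
  define bad where "bad = {x \<in> p. fst x \<in> N}"
  have bad_p: "bad \<subseteq> p" by (auto simp: bad_def)
  have "(\<Sum>(s, K)\<in>p. g (Sup K) - g (Inf K)) = g b - g a"
    by (rule additive_tagged_division_1[OF \<open>a \<le> b\<close> p(1)])
  then have "norm (g b - g a) \<le> (\<Sum>(s, K)\<in>p. norm (g (Sup K) - g (Inf K)))"
    by (metis (mono_tags, lifting) norm_sum split_def sum.cong)
  also have "\<dots> = (\<Sum>(s, K)\<in>p - bad. norm (g (Sup K) - g (Inf K))) + (\<Sum>(s, K)\<in>bad. norm (g (Sup K) - g (Inf K)))"
    by (rule sum.subset_diff[OF bad_p fin])
  also have "(\<Sum>(s, K)\<in>p - bad. norm (g (Sup K) - g (Inf K))) \<le> (\<Sum>(s, K)\<in>p - bad. (L + \<eta>) * (Sup K - Inf K))"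
  proof (rule sum_mono, clarify)
    fix s K assume sK: "(s, K) \<in> p" "(s, K) \<notin> bad"
    then have "s \<notin> N" by (auto simp: bad_def)
    obtain u v where K: "K = {u..v}" "u \<le> s" "s \<le> v" "a \<le> u" "v \<le> b" using Kab[OF sK(1)] by blast
    then have sab: "s \<in> {a..b}" by auto
    have "K \<subseteq> \<gamma> s" using p(2) sK(1) by (auto simp: fine_def)
    then have "K \<subseteq> ball s (r s)" using \<open>s \<notin> N\<close> sab by (simp add: \<gamma>_def)
    then have "\<bar>u - s\<bar> < r s" "\<bar>v - s\<bar> < r s"
      using K subsetD[of K "ball s (r s)" u] subsetD[of K "ball s (r s)" v]
      by (auto simp: dist_real_def abs_minus_commute)
    moreover have okr: "norm (g y - g s) \<le> (L + \<eta>) * \<bar>y - s\<bar>" if "y \<in> {a..b}" "\<bar>y - s\<bar> < r s" for y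
      using r[of s] sab \<open>s \<notin> N\<close> that unfolding ok_def by blast
    ultimately have "norm (g u - g s) \<le> (L + \<eta>) * \<bar>u - s\<bar>" "norm (g v - g s) \<le> (L + \<eta>) * \<bar>v - s\<bar>"
      using okr[of u] okr[of v] K by simp_all
    then have "norm (g v - g u) \<le> (L + \<eta>) * \<bar>u - s\<bar> + (L + \<eta>) * \<bar>v - s\<bar>"
      using norm_triangle_ineq4[of "g v - g s" "g u - g s"] by simp
    also have "\<dots> = (L + \<eta>) * (v - u)" using K by (simp add: algebra_simps abs_if)
    finally show "norm (g (Sup K) - g (Inf K)) \<le> (L + \<eta>) * (Sup K - Inf K)" using K by simp
  qed
  also have "\<dots> = (L + \<eta>) * (\<Sum>(s, K)\<in>p - bad. Sup K - Inf K)"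
    by (simp add: sum_distrib_left split_def)
  also have "(\<Sum>(s, K)\<in>p - bad. Sup K - Inf K) = (b - a) - (\<Sum>(s, K)\<in>bad. Sup K - Inf K)"
    using additive_tagged_division_1[OF \<open>a \<le> b\<close> p(1), of "\<lambda>x. x"] sum.subset_diff[OF bad_p fin, of "\<lambda>(s, K). Sup K - Inf K"]
    by (simp add: split_def)
  finally have main: "norm (g b - g a) \<le> (L + \<eta>) * ((b - a) - (\<Sum>(s, K)\<in>bad. Sup K - Inf K)) +
      (\<Sum>(s, K)\<in>bad. norm (g (Sup K) - g (Inf K)))" by simp
  have bad_part: "bad tagged_partial_division_of {a..b}"
    using p(1) bad_p unfolding tagged_division_of_def by (blast intro: tagged_partial_division_subset)
  note div = partial_division_of_tagged_division[OF bad_part]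
  define I where "I = (\<lambda>(s, K). (Inf K, Sup K)) ` bad"
  \<comment> \<open>only degenerate intervals of a division can have the same end points\<close>
  have reindex: "sum (\<lambda>(u, v). h u v) I = (\<Sum>(s, K)\<in>bad. h (Inf K) (Sup K))"
    if "\<And>u. h u u = 0" for h :: "real \<Rightarrow> real \<Rightarrow> real"
    unfolding I_def
  proof (subst sum.reindex_nontrivial)
    show "finite bad" using fin bad_p by (rule finite_subset[rotated])
  next
    fix x y assume xy: "x \<in> bad" "y \<in> bad" "x \<noteq> y" "(case x of (s, K) \<Rightarrow> (Inf K, Sup K)) = (case y of (s, K) \<Rightarrow> (Inf K, Sup K))"
    obtain s K s' K' where s: "x = (s, K)" "y = (s', K')" by (cases x; cases y) auto
    have "(s, K) \<in> p" "(s', K') \<in> p" using xy s bad_p by auto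
    from Kab[OF this(1)] Kab[OF this(2)] obtain u v u' v'
      where K: "K = {u..v}" "u \<le> v" "K' = {u'..v'}" "u' \<le> v'" by fastforce
    with xy s have "u = u'" "v = v'" by auto
    have "interior K \<inter> interior K' = {}"
      using tagged_partial_division_ofD(5)[OF bad_part, of s K s' K'] xy s by auto
    then have "u = v" using K \<open>u = u'\<close> \<open>v = v'\<close> by (auto simp: interior_atLeastAtMost_real)
    then show "(case case x of (s, K) \<Rightarrow> (Inf K, Sup K) of (u, v) \<Rightarrow> h u v) = 0" using s K that by simp
  qed (simp add: o_def split_def)
  have fam: "interval_family a b I"
    unfolding interval_family_def
  proof (intro conjI)
    show "finite I" using fin bad_p unfolding I_def by (meson finite_imageI finite_subset)
    show "\<forall>(u, v)\<in>I. a \<le> u \<and> u \<le> v \<and> v \<le> b"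
    proof clarify
      fix u v assume "(u, v) \<in> I"
      then obtain s K where "(s, K) \<in> p" "u = Inf K" "v = Sup K" using bad_p by (auto simp: I_def)
      with Kab show "a \<le> u \<and> u \<le> v \<and> v \<le> b" by fastforce
    qed
    show "pairwise (\<lambda>(u, v) (u', v'). {u<..<v} \<inter> {u'<..<v'} = {}) I"
    proof (rule pairwiseI)
      fix i j assume ij: "i \<in> I" "j \<in> I" "i \<noteq> j"
      obtain s K s' K' where s: "(s, K) \<in> bad" "(s', K') \<in> bad" "i = (Inf K, Sup K)" "j = (Inf K', Sup K')"
        using ij by (auto simp: I_def)
      from s have p': "(s, K) \<in> p" "(s', K') \<in> p" using bad_p by auto
      from Kab[OF this(1)] Kab[OF this(2)] obtain u v u' v'
        where K: "K = {u..v}" "u \<le> v" "K' = {u'..v'}" "u' \<le> v'" by fastforce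
      have "interior K \<inter> interior K' = {}"
        using tagged_partial_division_ofD(5)[OF bad_part s(1,2)] ij s by auto
      then show "(case i of (u, v) \<Rightarrow> \<lambda>(u', v'). {u<..<v} \<inter> {u'<..<v'} = {}) j"
        using s K by (simp add: interior_atLeastAtMost_real)
    qed
  qed
  have "(\<Sum>(u, v)\<in>I. v - u) = (\<Sum>(s, K)\<in>bad. Sup K - Inf K)"
    by (rule reindex) simp
  also have "\<dots> = (\<Sum>(s, K)\<in>bad. measure lebesgue K)"
  proof (rule sum.cong[OF refl], clarify)
    fix s K assume "(s, K) \<in> bad"
    then have "(s, K) \<in> p" using bad_p by auto
    then show "Sup K - Inf K = measure lebesgue K" using Kab by fastforce
  qed
  also have "\<dots> = sum (measure lebesgue) (snd ` bad)"
  proof -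
    have "sum (measure lebesgue) (snd ` bad) = sum (measure lebesgue \<circ> snd) bad"
    proof (rule sum.reindex_nontrivial)
      show "finite bad" using fin bad_p by (rule finite_subset[rotated])
    next
      fix x y assume xy: "x \<in> bad" "y \<in> bad" "x \<noteq> y" "snd x = snd y"
      obtain s K s' K' where s: "x = (s, K)" "y = (s', K')" by (cases x; cases y) auto
      have "(s, K) \<in> p" using xy s bad_p by auto
      from Kab[OF this] obtain u v where K: "K = {u..v}" "u \<le> v" by fastforce
      have "interior K \<inter> interior K' = {}"
        using tagged_partial_division_ofD(5)[OF bad_part, of s K s' K'] xy s by auto
      then have "u = v" using K xy s by (auto simp: interior_atLeastAtMost_real)
      then show "measure lebesgue (snd x) = 0" using s K by simp
    qed
    then show ?thesis by (simp add: o_def split_def)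
  qed
  also have "\<dots> = measure lebesgue (\<Union>(snd ` bad))"
    by (rule content_division[OF div])
  also have "\<dots> \<le> measure lebesgue U"
  proof (rule measure_mono_fmeasurable[OF _ _ U_meas])
    show "\<Union>(snd ` bad) \<subseteq> U"
      using p(2) by (force simp: bad_def fine_def \<gamma>_def)
    show "\<Union>(snd ` bad) \<in> sets lebesgue"
      using lmeasurable_division[OF div] by (rule fmeasurableD)
  qed
  finally have small: "(\<Sum>(u, v)\<in>I. v - u) < d" using U_less by linarith
  have bad_sum: "(\<Sum>(s, K)\<in>bad. norm (g (Sup K) - g (Inf K))) < \<eta>"
    using d[OF fam small] by (subst (asm) reindex) auto
  show "norm (g b - g a) \<le> L * (b - a) + e"
  proof (cases "a < b")
    case False
    then show ?thesis using \<open>a \<le> b\<close> \<open>0 < e\<close> by simp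
  next
    case True
    have "{a..b} - N \<noteq> {}"
    proof
      assume "{a..b} - N = {}"
      then have "negligible {a..b}" using N negligible_subset by blast
      then show False using True by (simp add: negligible_iff_measure)
    qed
    then have "L \<ge> 0" using deriv by (meson all_not_in_conv norm_ge_zero order_trans)
    have "0 \<le> (\<Sum>(s, K)\<in>bad. Sup K - Inf K)"
      using Kab bad_p by (intro sum_nonneg) fastforce
    then have "(L + \<eta>) * ((b - a) - (\<Sum>(s, K)\<in>bad. Sup K - Inf K)) \<le> (L + \<eta>) * (b - a)"
      using \<open>L \<ge> 0\<close> \<open>\<eta> > 0\<close> by (intro mult_left_mono) auto
    then have "norm (g b - g a) \<le> L * (b - a) + \<eta> * (b - a + 1)"
      using main bad_sum by (simp add: algebra_simps)
    also have "\<eta> * (b - a + 1) = e" using \<open>a \<le> b\<close> by (simp add: \<eta>_def)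
    finally show ?thesis .
  qed
qed

text \<open>On an interval so short that \<open>\<bar>C\<bar>\<close> times its length is at most \<open>1 / 2\<close>, the mean value
  inequality bounds the maximum of \<open>norm g\<close> by half of itself once \<open>g\<close> vanishes at the left end.\<close>

lemma abs_continuous_on_gronwall_zero:
  fixes g :: "real \<Rightarrow> 'a::real_normed_vector"
  assumes ac: "abs_continuous_on a b g" and N: "negligible N" and "g a = 0"
    and deriv: "\<And>s. s \<in> {a..b} - N \<Longrightarrow>
      \<exists>v. (g has_vector_derivative v) (at s within {a..b}) \<and> norm v \<le> C * norm (g s)"
    and s: "s \<in> {a..b}"
  shows "g s = 0"
proof -
  \<comment> \<open>then \<open>\<bar>C\<bar> * h \<le> 1 / 2\<close>; the conclusion is extended by steps of length \<open>h\<close>\<close>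
  define h where "h = 1 / (2 * (\<bar>C\<bar> + 1))"
  have "h > 0" by (simp add: h_def)
  have Ch: "\<bar>C\<bar> * h \<le> 1 / 2" by (simp add: h_def field_simps)
  have "g s = 0" if "s \<in> {a..b}" "s \<le> a + real n * h" for n s
    using that
  proof (induction n arbitrary: s)
    case 0
    then show ?case using \<open>g a = 0\<close> by auto
  next
    case (Suc n)
    define c where "c = min (a + real n * h) b"
    define c' where "c' = min (c + h) b"
    have "a \<le> b" using Suc.prems by auto
    then have c: "a \<le> c" "c \<le> c'" "c' \<le> b" "c' - c \<le> h" using \<open>h > 0\<close> by (auto simp: c_def c'_def)
    have "g c = 0" using Suc.IH[of c] c by (simp add: c_def)
    show ?case
    proof (cases "s \<le> c")
      case True
      then show ?thesis using Suc by (simp add: c_def)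
    next
      case False
      then have sc: "s \<in> {c..c'}" using Suc.prems unfolding c_def c'_def
        by (auto simp: algebra_simps min_def split: if_splits)
      have "continuous_on {c..c'} (\<lambda>s. norm (g s))"
        using abs_continuous_on_imp_continuous_on[OF ac] c
        by (intro continuous_on_norm) (auto elim: continuous_on_subset)
      then obtain t where t: "t \<in> {c..c'}" "\<And>s. s \<in> {c..c'} \<Longrightarrow> norm (g s) \<le> norm (g t)"
        using continuous_attains_sup[of "{c..c'}" "\<lambda>s. norm (g s)"] c by auto
      have "norm (g t - g c) \<le> (\<bar>C\<bar> * norm (g t)) * (t - c)"
      proof (rule abs_continuous_on_mean_value[OF _ _ N])
        show "abs_continuous_on c t g" by (rule abs_continuous_on_subset[OF ac]) (use c t in auto)
        show "c \<le> t" using t by simp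
        fix s assume sN: "s \<in> {c..t} - N"
        then have "s \<in> {a..b} - N" using c t by auto
        then obtain v where v: "(g has_vector_derivative v) (at s within {a..b})" "norm v \<le> C * norm (g s)"
          using deriv by blast
        have "(g has_vector_derivative v) (at s within {c..t})"
          using v(1) by (rule has_vector_derivative_within_subset) (use c t in auto)
        moreover have "C * norm (g s) \<le> \<bar>C\<bar> * norm (g t)"
          using t(2)[of s] sN t(1) by (intro mult_mono) auto
        ultimately show "\<exists>v. (g has_vector_derivative v) (at s within {c..t}) \<and> norm v \<le> \<bar>C\<bar> * norm (g t)"
          using v(2) by (intro exI[of _ v]) auto
      qed
      also have "\<dots> = norm (g t) * (\<bar>C\<bar> * (t - c))" by simp
      also have "\<dots> \<le> norm (g t) * (1 / 2)"
      proof (rule mult_left_mono)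
        have "\<bar>C\<bar> * (t - c) \<le> \<bar>C\<bar> * h" using t c by (intro mult_left_mono) auto
        then show "\<bar>C\<bar> * (t - c) \<le> 1 / 2" using Ch by linarith
      qed simp
      finally have "norm (g t) \<le> 0" using \<open>g c = 0\<close> by simp
      then show ?thesis using t(2)[OF sc] by simp
    qed
  qed
  moreover obtain n :: nat where "(s - a) / h < real n" using reals_Archimedean2 by blast
  then have "s \<le> a + real n * h" using \<open>h > 0\<close> by (simp add: field_simps)
  ultimately show ?thesis using s by blast
qed

section \<open>Twice continuously differentiable functions\<close>

lemma C2_onE:
  assumes "C2_on S f"
  obtains D D2 where "\<And>z. z \<in> S \<Longrightarrow> (f has_derivative blinfun_apply (D z)) (at z)"
    "\<And>z. z \<in> S \<Longrightarrow> (D has_derivative blinfun_apply (D2 z)) (at z)"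
    "continuous_on S f" "continuous_on S D" "continuous_on S D2"
proof -
  obtain D D2 where D: "\<And>z. z \<in> S \<Longrightarrow> (f has_derivative blinfun_apply (D z)) (at z)"
    "\<And>z. z \<in> S \<Longrightarrow> (D has_derivative blinfun_apply (D2 z)) (at z)" "continuous_on S D2"
    using assms unfolding C2_on_def by blast
  have "continuous_on S f" "continuous_on S D"
    using D by (meson continuous_at_imp_continuous_on has_derivative_continuous)+
  with D that show thesis by blast
qed

lemma C2_on_affine:
  assumes "bounded_linear L"
  shows "C2_on S (\<lambda>z. L z + k)"
  unfolding C2_on_def
proof (intro exI[of _ "\<lambda>_. Blinfun L"] exI[of _ "\<lambda>_. 0"] conjI ballI)
  fix z
  show "((\<lambda>z. L z + k) has_derivative blinfun_apply (Blinfun L)) (at z)"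
    using assms by (simp add: bounded_linear_Blinfun_apply bounded_linear_imp_has_derivative has_derivative_add_const)
qed (simp_all add: zero_blinfun.rep_eq)

lemma C2_on_const: "C2_on S (\<lambda>z. k)"
  using C2_on_affine[OF bounded_linear_zero, of S k] by simp

lemma C2_on_add:
  assumes "C2_on S f" "C2_on S g"
  shows "C2_on S (\<lambda>z. f z + g z)"
proof -
  obtain Df D2f where f: "\<And>z. z \<in> S \<Longrightarrow> (f has_derivative blinfun_apply (Df z)) (at z)"
    "\<And>z. z \<in> S \<Longrightarrow> (Df has_derivative blinfun_apply (D2f z)) (at z)" "continuous_on S D2f"
    using C2_onE[OF assms(1)] by metis
  obtain Dg D2g where g: "\<And>z. z \<in> S \<Longrightarrow> (g has_derivative blinfun_apply (Dg z)) (at z)"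
    "\<And>z. z \<in> S \<Longrightarrow> (Dg has_derivative blinfun_apply (D2g z)) (at z)" "continuous_on S D2g"
    using C2_onE[OF assms(2)] by metis
  show ?thesis
    unfolding C2_on_def
  proof (intro exI[of _ "\<lambda>z. Df z + Dg z"] exI[of _ "\<lambda>z. D2f z + D2g z"] conjI ballI)
    fix z assume z: "z \<in> S"
    show "((\<lambda>z. f z + g z) has_derivative blinfun_apply (Df z + Dg z)) (at z)"
      using has_derivative_add[OF f(1)[OF z] g(1)[OF z]] by (simp add: plus_blinfun.rep_eq)
    show "((\<lambda>z. Df z + Dg z) has_derivative blinfun_apply (D2f z + D2g z)) (at z)"
      using has_derivative_add[OF f(2)[OF z] g(2)[OF z]] by (simp add: plus_blinfun.rep_eq)
  qed (intro continuous_intros f g)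
qed

lemma C2_on_mult:
  assumes "C2_on S f" "C2_on S g"
  shows "C2_on S (\<lambda>z. f z * g z)"
proof -
  obtain Df D2f where f: "\<And>z. z \<in> S \<Longrightarrow> (f has_derivative blinfun_apply (Df z)) (at z)"
    "\<And>z. z \<in> S \<Longrightarrow> (Df has_derivative blinfun_apply (D2f z)) (at z)"
    "continuous_on S f" "continuous_on S Df" "continuous_on S D2f"
    using C2_onE[OF assms(1)] by metis
  obtain Dg D2g where g: "\<And>z. z \<in> S \<Longrightarrow> (g has_derivative blinfun_apply (Dg z)) (at z)"
    "\<And>z. z \<in> S \<Longrightarrow> (Dg has_derivative blinfun_apply (D2g z)) (at z)"
    "continuous_on S g" "continuous_on S Dg" "continuous_on S D2g"
    using C2_onE[OF assms(2)] by metis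
  show ?thesis
    unfolding C2_on_def
  proof (intro exI[of _ "\<lambda>z. f z *\<^sub>R Dg z + g z *\<^sub>R Df z"]
      exI[of _ "\<lambda>z. (f z *\<^sub>R D2g z + (blinfun_scaleR_left (Dg z) o\<^sub>L Df z)) +
        (g z *\<^sub>R D2f z + (blinfun_scaleR_left (Df z) o\<^sub>L Dg z))"] conjI ballI)
    fix z assume z: "z \<in> S"
    have "((\<lambda>z. f z * g z) has_derivative (\<lambda>h. f z * Dg z h + Df z h * g z)) (at z)"
      by (rule has_derivative_mult[OF f(1)[OF z] g(1)[OF z]])
    then show "((\<lambda>z. f z * g z) has_derivative blinfun_apply (f z *\<^sub>R Dg z + g z *\<^sub>R Df z)) (at z)"
      by (simp add: plus_blinfun.rep_eq scaleR_blinfun.rep_eq mult.commute)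
    have "((\<lambda>z. f z *\<^sub>R Dg z + g z *\<^sub>R Df z) has_derivative
        (\<lambda>h. (f z *\<^sub>R D2g z h + Df z h *\<^sub>R Dg z) + (g z *\<^sub>R D2f z h + Dg z h *\<^sub>R Df z))) (at z)"
      by (intro has_derivative_add has_derivative_scaleR f(1,2) g(1,2) z)
    then show "((\<lambda>z. f z *\<^sub>R Dg z + g z *\<^sub>R Df z) has_derivative
        blinfun_apply ((f z *\<^sub>R D2g z + (blinfun_scaleR_left (Dg z) o\<^sub>L Df z)) +
        (g z *\<^sub>R D2f z + (blinfun_scaleR_left (Df z) o\<^sub>L Dg z)))) (at z)"
      by (simp add: plus_blinfun.rep_eq scaleR_blinfun.rep_eq)
  next
    show "continuous_on S (\<lambda>z. (f z *\<^sub>R D2g z + (blinfun_scaleR_left (Dg z) o\<^sub>L Df z)) +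
        (g z *\<^sub>R D2f z + (blinfun_scaleR_left (Df z) o\<^sub>L Dg z)))"
      by (intro continuous_intros f(3-5) g(3-5)
          bounded_bilinear.continuous_on[OF bounded_bilinear_blinfun_compose]
          bounded_linear.continuous_on[OF bounded_linear_blinfun_scaleR_left])
  qed
qed

lemma C2_on_inverse:
  assumes "C2_on S f" and nz: "\<And>z. z \<in> S \<Longrightarrow> f z \<noteq> 0"
  shows "C2_on S (\<lambda>z. inverse (f z))"
proof -
  obtain Df D2f where f: "\<And>z. z \<in> S \<Longrightarrow> (f has_derivative blinfun_apply (Df z)) (at z)"
    "\<And>z. z \<in> S \<Longrightarrow> (Df has_derivative blinfun_apply (D2f z)) (at z)"
    "continuous_on S f" "continuous_on S Df" "continuous_on S D2f"
    using C2_onE[OF assms(1)] by metis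
  define r where "r z = inverse (f z)" for z
  have r: "(r has_derivative (\<lambda>h. - (r z)\<^sup>2 * Df z h)) (at z)" if z: "z \<in> S" for z
    using DERIV_compose_FDERIV[OF DERIV_inverse[OF nz[OF z]] f(1)[OF z]] unfolding r_def[abs_def]
    by (simp add: mult.commute numeral_2_eq_2)
  have r_cont: "continuous_on S r"
    unfolding r_def[abs_def] using nz by (intro continuous_intros f) auto
  have "C2_on S r"
    unfolding C2_on_def
  proof (intro exI[of _ "\<lambda>z. (- (r z)\<^sup>2) *\<^sub>R Df z"]
      exI[of _ "\<lambda>z. (- (r z)\<^sup>2) *\<^sub>R D2f z + (blinfun_scaleR_left (Df z) o\<^sub>L ((2 * (r z) ^ 3) *\<^sub>R Df z))"]
      conjI ballI)
    fix z assume z: "z \<in> S"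
    show "(r has_derivative blinfun_apply ((- (r z)\<^sup>2) *\<^sub>R Df z)) (at z)"
      using r[OF z] by (simp add: scaleR_blinfun.rep_eq uminus_blinfun.rep_eq)
    have "((\<lambda>z. - (r z * r z)) has_derivative (\<lambda>h. - (r z * (- (r z)\<^sup>2 * Df z h) + (- (r z)\<^sup>2 * Df z h) * r z))) (at z)"
      by (intro has_derivative_minus has_derivative_mult r z)
    moreover have "(\<lambda>h. - (r z * (- (r z)\<^sup>2 * Df z h) + (- (r z)\<^sup>2 * Df z h) * r z)) = (\<lambda>h. 2 * r z ^ 3 * Df z h)"
      by (auto simp: power2_eq_square power3_eq_cube)
    ultimately have "((\<lambda>z. - (r z)\<^sup>2) has_derivative (\<lambda>h. 2 * r z ^ 3 * Df z h)) (at z)"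
      by (simp add: power2_eq_square)
    then have "((\<lambda>z. (- (r z)\<^sup>2) *\<^sub>R Df z) has_derivative
        (\<lambda>h. (- (r z)\<^sup>2) *\<^sub>R D2f z h + (2 * r z ^ 3 * Df z h) *\<^sub>R Df z)) (at z)"
      by (rule has_derivative_scaleR[OF _ f(2)[OF z]])
    moreover have "(\<lambda>h. (- (r z)\<^sup>2) *\<^sub>R D2f z h + (2 * r z ^ 3 * Df z h) *\<^sub>R Df z) =
       blinfun_apply ((- (r z)\<^sup>2) *\<^sub>R D2f z + (blinfun_scaleR_left (Df z) o\<^sub>L ((2 * (r z) ^ 3) *\<^sub>R Df z)))"
      by (rule ext) (simp only: plus_blinfun.rep_eq scaleR_blinfun.rep_eq blinfun_apply_blinfun_compose
        blinfun_scaleR_left.rep_eq real_scaleR_def)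
    ultimately show "((\<lambda>z. (- (r z)\<^sup>2) *\<^sub>R Df z) has_derivative
       blinfun_apply ((- (r z)\<^sup>2) *\<^sub>R D2f z + (blinfun_scaleR_left (Df z) o\<^sub>L ((2 * (r z) ^ 3) *\<^sub>R Df z)))) (at z)"
      by simp
  next
    show "continuous_on S (\<lambda>z. (- (r z)\<^sup>2) *\<^sub>R D2f z + (blinfun_scaleR_left (Df z) o\<^sub>L ((2 * (r z) ^ 3) *\<^sub>R Df z)))"
      by (intro continuous_intros f(3-5) r_cont
          bounded_bilinear.continuous_on[OF bounded_bilinear_blinfun_compose]
          bounded_linear.continuous_on[OF bounded_linear_blinfun_scaleR_left])
  qed
  then show ?thesis by (simp add: r_def[abs_def])
qed

text \<open>The chordal distance is built from such terms, written in a chart.\<close>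

lemma C2_on_cmod_affine: "C2_on S (\<lambda>z. (cmod (\<alpha> * z + \<beta>))\<^sup>2)"
proof -
  have 1: "bounded_linear (\<lambda>z. Re (\<alpha> * z))" "bounded_linear (\<lambda>z. Im (\<alpha> * z))"
    by (rule bounded_linear_compose[OF bounded_linear_Re bounded_linear_mult_right]
        bounded_linear_compose[OF bounded_linear_Im bounded_linear_mult_right])+
  have "(\<lambda>z. (cmod (\<alpha> * z + \<beta>))\<^sup>2) = (\<lambda>z. (Re (\<alpha> * z) + Re \<beta>) * (Re (\<alpha> * z) + Re \<beta>)
      + (Im (\<alpha> * z) + Im \<beta>) * (Im (\<alpha> * z) + Im \<beta>))"
    by (rule ext) (simp only: cmod_power2 plus_complex.sel, simp only: power2_eq_square)
  then show ?thesis
    by (simp only:) (intro C2_on_add C2_on_mult C2_on_affine 1)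
qed

section \<open>The sphere as a projective line\<close>

text \<open>The determinant of the matrix with columns \<open>u\<close> and \<open>v\<close>.\<close>

definition wedge :: "complex^2 \<Rightarrow> complex^2 \<Rightarrow> complex" where
  "wedge u v = u $ 1 * v $ 2 - u $ 2 * v $ 1"

text \<open>Only nonzero vectors represent points of the sphere; the origin is sent to \<open>Infty\<close>.\<close>

definition proj :: "complex^2 \<Rightarrow> sphere" where
  "proj u = (if u $ 2 = 0 then Infty else Fin (u $ 1 / u $ 2))"

fun lift :: "sphere \<Rightarrow> complex^2" where
  "lift (Fin z) = vector [z, 1]"
| "lift Infty = vector [1, 0]"

text \<open>The affine section of \<open>proj\<close> belonging to a chart: the representative whose denominator
  \<open>chart_den\<close> is \<open>1\<close>.\<close>

fun chart_lift :: "chart \<Rightarrow> complex \<Rightarrow> complex^2" where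
  "chart_lift Chart1 z = vector [z, 1]"
| "chart_lift Chart2 z = vector [1, - z]"

text \<open>With \<open>chart_num\<close>, the homogeneous form of the chart maps: the chart \<open>c\<close> is
  \<open>chart_num c / chart_den c\<close>.\<close>

fun chart_den :: "chart \<Rightarrow> complex^2 \<Rightarrow> complex" where
  "chart_den Chart1 u = u $ 2"
| "chart_den Chart2 u = u $ 1"

fun chart_num :: "chart \<Rightarrow> complex^2 \<Rightarrow> complex" where
  "chart_num Chart1 u = u $ 1"
| "chart_num Chart2 u = - (u $ 2)"

fun chart_quot :: "chart \<Rightarrow> complex^2 \<Rightarrow> complex" where
  "chart_quot Chart1 u = u $ 1 / u $ 2"
| "chart_quot Chart2 u = - (u $ 2) / u $ 1"

lemma vec2_eq_iff: "u = v \<longleftrightarrow> u $ 1 = v $ 1 \<and> u $ 2 = v $ 2" for u v :: "complex^2"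
  by (auto simp: vec_eq_iff forall_2)

lemma norm_vec2_power2: "(norm u)\<^sup>2 = (cmod (u $ 1))\<^sup>2 + (cmod (u $ 2))\<^sup>2" for u :: "complex^2"
  by (simp add: norm_vec_def L2_set_def sum_2)

lemma lift_nonzero [simp]: "lift x \<noteq> 0"
  by (cases x) (auto simp: vec2_eq_iff)

lemma proj_lift [simp]: "proj (lift x) = x"
  by (cases x) (auto simp: proj_def)

lemma chart_lift_nonzero [simp]: "chart_lift c z \<noteq> 0"
  by (cases c) (auto simp: vec2_eq_iff)

lemma proj_chart_lift [simp]: "proj (chart_lift c z) = chart_inv c z"
  by (cases c) (auto simp: proj_def)

lemma chart_quot_lift [simp]: "chart_quot c (chart_lift c z) = z"
  by (cases c) auto

lemma chart_den_lift [simp]: "chart_den c (chart_lift c z) = 1"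
  by (cases c) auto

lemma chart_quot_eq: "chart_quot c u = chart_num c u / chart_den c u"
  by (cases c) auto

lemma proj_in_chart_dom: "u \<noteq> 0 \<Longrightarrow> proj u \<in> chart_dom c \<longleftrightarrow> chart_den c u \<noteq> 0"
  by (cases c) (auto simp: proj_def vec2_eq_iff)

lemma chart_map_proj: "chart_den c u \<noteq> 0 \<Longrightarrow> chart_map c (proj u) = chart_quot c u"
  by (cases c) (auto simp: proj_def)

lemma chart_inv_quot: "chart_den c u \<noteq> 0 \<Longrightarrow> chart_inv c (chart_quot c u) = proj u"
  by (cases c) (auto simp: proj_def)

lemma proj_eq_iff:
  assumes "u \<noteq> 0" "v \<noteq> 0"
  shows "proj u = proj v \<longleftrightarrow> wedge u v = 0"
  using assms by (auto simp: proj_def wedge_def vec2_eq_iff field_simps)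

text \<open>The linear expression on the right measures how far a lifted curve is from lying over a curve in
  the chart; unlike a difference of chart values it makes sense also where the denominator
  vanishes.\<close>

lemma proj_eq_chart_inv_iff:
  assumes "u \<noteq> 0"
  shows "proj u = chart_inv c z \<longleftrightarrow> chart_num c u - z * chart_den c u = 0"
proof -
  have "proj u = chart_inv c z \<longleftrightarrow> wedge u (chart_lift c z) = 0"
    using proj_eq_iff[OF assms chart_lift_nonzero, of c z] by simp
  also have "wedge u (chart_lift c z) = chart_num c u - z * chart_den c u"
    by (cases c) (simp_all add: wedge_def)
  finally show ?thesis .
qed

lemma lift_proj:
  assumes "u \<noteq> 0"
  obtains k where "k \<noteq> 0" "u = k *s lift (proj u)"
proof (cases "u $ 2 = 0")
  case True
  then show thesis using assms by (intro that[of "u $ 1"]) (auto simp: proj_def vec2_eq_iff)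
next
  case False
  then show thesis by (intro that[of "u $ 2"]) (auto simp: proj_def vec2_eq_iff)
qed

lemma proj_scale [simp]: "k \<noteq> 0 \<Longrightarrow> proj (k *s u) = proj u"
  by (auto simp: proj_def)

lemma chart_cover: "\<exists>c. x \<in> chart_dom c"
proof (cases x)
  case (Fin z)
  then show ?thesis by (intro exI[of _ Chart1]) simp
next
  case Infty
  then show ?thesis by (intro exI[of _ Chart2]) simp
qed

text \<open>Minimisation over the sphere is carried out over the compact set of unit vectors.\<close>

lemma unit_lift:
  obtains u where "norm u = 1" "proj u = x"
proof
  let ?k = "complex_of_real (inverse (norm (lift x)))"
  show "proj (?k *s lift x) = x" by simp
  show "norm (?k *s lift x) = 1"
  proof -
    have "?k *s lift x = inverse (norm (lift x)) *\<^sub>R lift x"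
      unfolding vec2_eq_iff vector_scaleR_component by (simp add: scaleR_conv_of_real)
    then show ?thesis by simp
  qed
qed

lemma bounded_linear_chart_num: "bounded_linear (chart_num c)"
proof (cases c)
  case Chart1
  then have "chart_num c = (\<lambda>u. u $ 1)" by auto
  then show ?thesis by (simp add: bounded_linear_vec_nth)
next
  case Chart2
  then have "chart_num c = (\<lambda>u. - (u $ 2))" by auto
  then show ?thesis by (simp add: bounded_linear_vec_nth bounded_linear_minus)
qed

lemma bounded_linear_chart_den: "bounded_linear (chart_den c)"
proof (cases c)
  case Chart1
  then have "chart_den c = (\<lambda>u. u $ 2)" by auto
  then show ?thesis by (simp add: bounded_linear_vec_nth)
next
  case Chart2
  then have "chart_den c = (\<lambda>u. u $ 1)" by auto
  then show ?thesis by (simp add: bounded_linear_vec_nth)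
qed

lemma cmod_chart_num_le: "cmod (chart_num c u) \<le> norm u"
  by (cases c) (auto simp: Finite_Cartesian_Product.norm_nth_le)

lemma cmod_chart_den_le: "cmod (chart_den c u) \<le> norm u"
  by (cases c) (auto simp: Finite_Cartesian_Product.norm_nth_le)

lemma open_chart_preimage:
  assumes "open U"
  shows "open {z. chart_inv c z \<in> U}"
  using assms unfolding open_sphere_def chart_image_eq vimage_def by blast

lemma open_chart_den: "open {v. chart_den c v \<noteq> 0}"
  by (cases c) (auto intro!: open_Collect_neq continuous_intros)

lemma isCont_proj:
  assumes "u \<noteq> 0"
  shows "isCont proj u"
  unfolding continuous_at_open
proof (intro allI impI)
  fix U assume U: "open U \<and> proj u \<in> U"
  obtain c where c: "chart_den c u \<noteq> 0"
    using assms by (metis chart_den.simps vec2_eq_iff zero_index)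
  have 1: "open {v :: complex^2. chart_den c v \<noteq> 0}"
    by (cases c) (auto intro!: open_Collect_neq continuous_intros)
  have 2: "continuous_on {v. chart_den c v \<noteq> 0} (chart_quot c)"
    by (cases c) (auto intro!: continuous_intros)
  have "open ({v. chart_den c v \<noteq> 0} \<inter> chart_quot c -` {z. chart_inv c z \<in> U})"
    using continuous_open_preimage[OF 2 1 open_chart_preimage] U by blast
  then show "\<exists>S. open S \<and> u \<in> S \<and> (\<forall>v\<in>S. proj v \<in> U)"
    using c U by (intro exI[of _ "{v. chart_den c v \<noteq> 0} \<inter> chart_quot c -` {z. chart_inv c z \<in> U}"])
      (auto simp: chart_inv_quot)
qed

lemma continuous_on_vector2:
  fixes f g :: "'a::topological_space \<Rightarrow> complex"
  assumes "continuous_on S f" "continuous_on S g"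
  shows "continuous_on S (\<lambda>z. vector [f z, g z] :: complex^2)"
proof -
  have "(\<lambda>z. vector [f z, g z] :: complex^2) = (\<lambda>z. \<chi> i. if i = 1 then f z else g z)"
    by (auto simp: vec2_eq_iff)
  moreover have "continuous_on S (\<lambda>z. \<chi> i. if i = (1::2) then f z else g z)"
  proof (rule continuous_on_vec_lambda)
    show "continuous_on S (\<lambda>z. if i = 1 then f z else g z)" for i :: 2
      by (cases "i = 1") (use assms in simp_all)
  qed
  ultimately show ?thesis by (simp only:)
qed

lemma isCont_chart_lift: "isCont (chart_lift c) z"
proof -
  have "chart_lift Chart1 = (\<lambda>z. vector [z, 1])" "chart_lift Chart2 = (\<lambda>z. vector [1, - z])" by auto
  then have "continuous_on UNIV (chart_lift c)"
    by (cases c) (auto intro!: continuous_on_vector2 continuous_intros)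
  then show ?thesis by (simp add: continuous_on_eq_continuous_at)
qed

lemma open_chart_dom: "open (chart_dom c)"
  unfolding open_sphere_def chart_image_eq
proof
  fix d
  have "chart_inv d -` chart_dom c = chart_lift d -` {v. chart_den c v \<noteq> 0}"
    using proj_in_chart_dom[of "chart_lift d _" c] by auto
  moreover have "open (chart_lift d -` {v. chart_den c v \<noteq> 0})"
    by (intro continuous_open_vimage isCont_chart_lift open_chart_den)
  ultimately show "open (chart_inv d -` chart_dom c)" by simp
qed

lemma lsc_bounded_below:
  fixes V :: "sphere \<Rightarrow> ereal"
  assumes "lower_semicontinuous V" "\<And>x. V x \<noteq> - \<infinity>"
  obtains B where "\<And>x. ereal B \<le> V x"
proof -
  have lsc: "lsc_at (\<lambda>u. V (proj u)) u" if "u \<in> sphere 0 1" for u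
    using assms(1) that by (intro lsc_at_compose[of V proj] isCont_proj) (auto simp: lower_semicontinuous_iff_lsc_at)
  obtain u0 :: "complex^2" where "norm u0 = 1" by (rule unit_lift[of Infty])
  then have ne: "sphere (0 :: complex^2) 1 \<noteq> {}" by (metis empty_iff mem_sphere_0)
  obtain u where u: "u \<in> sphere 0 1" "\<And>w. w \<in> sphere 0 1 \<Longrightarrow> V (proj u) \<le> V (proj w)"
    by (rule lsc_attains_min[OF compact_sphere ne lsc], assumption) (rule that)
  have "V (proj u) \<le> V x" for x
  proof -
    obtain w where "norm w = 1" "proj w = x" by (rule unit_lift)
    then show ?thesis using u(2)[of w] by simp
  qed
  moreover have "\<exists>B. ereal B \<le> V (proj u)"
    using assms(2)[of "proj u"] by (cases "V (proj u)") auto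
  ultimately show thesis using that order_trans by blast
qed

section \<open>Action of unimodular matrices\<close>

text \<open>The adjugate, which is the inverse for determinant \<open>1\<close>.\<close>

definition adj2 :: "complex^2^2 \<Rightarrow> complex^2^2" where
  "adj2 M = vector [vector [M $ 2 $ 2, - (M $ 1 $ 2)], vector [- (M $ 2 $ 1), M $ 1 $ 1]]"

lemma mat2_eq_iff: "M = N \<longleftrightarrow> M $ 1 $ 1 = N $ 1 $ 1 \<and> M $ 1 $ 2 = N $ 1 $ 2 \<and>
    M $ 2 $ 1 = N $ 2 $ 1 \<and> M $ 2 $ 2 = N $ 2 $ 2" for M N :: "complex^2^2"
  by (auto simp: vec_eq_iff forall_2)

lemma matvec_component: "(M *v u) $ i = M $ i $ 1 * u $ 1 + M $ i $ 2 * u $ 2"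
  for M :: "complex^2^2"
  by (simp add: matrix_vector_mult_def sum_2)

lemma matmul_component: "(M ** N) $ i $ j = M $ i $ 1 * N $ 1 $ j + M $ i $ 2 * N $ 2 $ j"
  for M N :: "complex^2^2"
  by (simp add: matrix_matrix_mult_def sum_2)

lemma adj2_component [simp]: "adj2 M $ 1 $ 1 = M $ 2 $ 2" "adj2 M $ 1 $ 2 = - (M $ 1 $ 2)"
  "adj2 M $ 2 $ 1 = - (M $ 2 $ 1)" "adj2 M $ 2 $ 2 = M $ 1 $ 1"
  by (simp_all add: adj2_def)

lemma mat1_component: "(mat 1 :: complex^2^2) $ i $ j = (if i = j then 1 else 0)"
  by (simp add: mat_def)

lemma adj2_one [simp]: "adj2 (mat 1) = mat 1"
  by (simp add: mat2_eq_iff mat1_component)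

lemma adj2_mult: "det M = 1 \<Longrightarrow> adj2 M ** M = mat 1" "det M = 1 \<Longrightarrow> M ** adj2 M = mat 1"
  by (auto simp: mat2_eq_iff matmul_component mat1_component det_2 algebra_simps)

lemma det_adj2 [simp]: "det (adj2 M) = det M"
  by (simp add: det_2 algebra_simps)

lemma adj2_mul: "adj2 (M ** N) = adj2 N ** adj2 M"
  by (simp add: mat2_eq_iff matmul_component algebra_simps)

lemma adj2_cancel:
  assumes "det M = 1"
  shows "adj2 M *v (M *v u) = u" "M *v (adj2 M *v u) = u"
  using adj2_mult[OF assms] by (simp_all add: matrix_vector_mul_assoc)

lemma matvec_nonzero: "det M = 1 \<Longrightarrow> u \<noteq> 0 \<Longrightarrow> M *v u \<noteq> 0" for M :: "complex^2^2"
  by (metis adj2_cancel(1) matrix_vector_mult_0_right)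

lemma matvec_scale: "M *v (k *s u) = k *s (M *v u)" for M :: "complex^2^2"
  by (simp add: vec2_eq_iff matvec_component algebra_simps)

definition act :: "complex^2^2 \<Rightarrow> sphere \<Rightarrow> sphere" where
  "act M x = proj (M *v lift x)"

lemma act_proj: "u \<noteq> 0 \<Longrightarrow> act M (proj u) = proj (M *v u)"
  by (metis act_def lift_proj matvec_scale proj_scale)

lemma act_mult: "det M = 1 \<Longrightarrow> act (N ** M) x = act N (act M x)"
  by (metis act_def act_proj lift_nonzero matrix_vector_mul_assoc matvec_nonzero)

lemma act_one [simp]: "act (mat 1) x = x"
  by (simp add: act_def)

lemma act_adj2: "det M = 1 \<Longrightarrow> act (adj2 M) (act M x) = x" "det M = 1 \<Longrightarrow> act M (act (adj2 M) x) = x"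
  by (metis act_mult act_one adj2_mult(1), metis act_mult act_one adj2_mult(2) det_adj2)

section \<open>The squared chordal distance\<close>

lemma norm_scale_vec2: "norm (k *s u) = cmod k * norm u" for u :: "complex^2"
proof -
  have "(norm (k *s u))\<^sup>2 = (cmod k * norm u)\<^sup>2"
    by (simp add: norm_vec2_power2 norm_mult power_mult_distrib algebra_simps)
  then show ?thesis by (simp add: power2_eq_iff_nonneg)
qed

text \<open>Up to a constant factor the square of the Euclidean distance between the points of the round sphere
  represented by \<open>u\<close> and \<open>v\<close>.\<close>

definition chord :: "complex^2 \<Rightarrow> complex^2 \<Rightarrow> real" where
  "chord u v = (cmod (wedge u v))\<^sup>2 / ((norm u)\<^sup>2 * (norm v)\<^sup>2)"

lemma chord_scale: "k \<noteq> 0 \<Longrightarrow> chord (k *s u) v = chord u v"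
proof -
  assume "k \<noteq> 0"
  have "wedge (k *s u) v = k * wedge u v" by (simp add: wedge_def algebra_simps)
  with \<open>k \<noteq> 0\<close> show ?thesis
    by (simp add: chord_def norm_scale_vec2 norm_mult power_mult_distrib)
qed

lemma chord_matvec_lift_proj: "u \<noteq> 0 \<Longrightarrow> chord (M *v lift (proj u)) v = chord (M *v u) v"
  by (metis chord_scale lift_proj matvec_scale)

lemma chord_lift_proj: "u \<noteq> 0 \<Longrightarrow> chord (lift (proj u)) v = chord u v"
  by (metis chord_scale lift_proj)

lemma chord_nonneg [simp]: "0 \<le> chord u v"
  by (simp add: chord_def)

lemma chord_eq_0_iff: "u \<noteq> 0 \<Longrightarrow> v \<noteq> 0 \<Longrightarrow> chord u v = 0 \<longleftrightarrow> proj u = proj v"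
  by (simp add: chord_def proj_eq_iff)

lemma chord_commute: "chord u v = chord v u"
proof -
  have "wedge u v = - wedge v u" by (simp add: wedge_def)
  then show ?thesis by (simp add: chord_def mult.commute)
qed

lemma chord_self [simp]: "chord u u = 0"
  by (simp add: chord_def wedge_def)

lemma chord_le_2: "chord u v \<le> 2"
proof (cases "u = 0 \<or> v = 0")
  case True
  then show ?thesis by (auto simp: chord_def)
next
  case False
  define a b c d where "a = cmod (u $ 1)" "b = cmod (u $ 2)" "c = cmod (v $ 1)" "d = cmod (v $ 2)"
  have "cmod (wedge u v) \<le> a * d + b * c"
    unfolding wedge_def a_b_c_d_def by (metis norm_mult norm_triangle_ineq4)
  then have "(cmod (wedge u v))\<^sup>2 \<le> (a * d + b * c)\<^sup>2" by (intro power_mono) auto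
  also have "\<dots> \<le> 2 * ((a * d)\<^sup>2 + (b * c)\<^sup>2)"
    using sum_squares_bound[of "a * d" "b * c"] by (simp add: power2_sum)
  also have "\<dots> \<le> 2 * ((a\<^sup>2 + b\<^sup>2) * (c\<^sup>2 + d\<^sup>2))"
    by (simp add: algebra_simps power_mult_distrib)
  also have "\<dots> = 2 * ((norm u)\<^sup>2 * (norm v)\<^sup>2)"
    by (simp add: norm_vec2_power2 a_b_c_d_def)
  finally show ?thesis using False by (simp add: chord_def divide_le_eq)
qed

lemma isCont_chord:
  assumes "isCont f x" "isCont g x" "f x \<noteq> 0" "g x \<noteq> 0"
  shows "isCont (\<lambda>y. chord (f y) (g y)) x"
  unfolding chord_def wedge_def
  by (intro continuous_intros assms) (use assms in auto)

lemma continuous_on_chord: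
  assumes "continuous_on S f" "continuous_on S g" "\<And>x. x \<in> S \<Longrightarrow> f x \<noteq> 0" "\<And>x. x \<in> S \<Longrightarrow> g x \<noteq> 0"
  shows "continuous_on S (\<lambda>y. chord (f y) (g y))"
  unfolding chord_def wedge_def
  by (intro continuous_intros assms) (use assms in auto)

text \<open>In a chart the section \<open>chart_lift\<close> is affine, so the numerator and the denominator of \<open>chord\<close>
  are sums of squared moduli of affine functions, and the denominator has no zeros. Precomposition
  with \<open>N\<close> is included because the penalty is transported by the flow.\<close>

lemma sphere_C2_on_chord:
  assumes "det N = 1" "v \<noteq> 0"
  shows "sphere_C2_on \<Omega> (\<lambda>x. k * chord (N *v lift x) v)"
  unfolding sphere_C2_on_def
proof
  fix c
  let ?S = "chart_map c ` (\<Omega> \<inter> chart_dom c)"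
  have affine: "\<exists>\<alpha> \<beta>. (\<lambda>z. a * (N *v chart_lift c z) $ 1 + b * (N *v chart_lift c z) $ 2) = (\<lambda>z. \<alpha> * z + \<beta>)" for a b
  proof (cases c)
    case Chart1
    then show ?thesis
      by (intro exI[of _ "a * N $ 1 $ 1 + b * N $ 2 $ 1"] exI[of _ "a * N $ 1 $ 2 + b * N $ 2 $ 2"])
        (simp add: matvec_component algebra_simps)
  next
    case Chart2
    then show ?thesis
      by (intro exI[of _ "- (a * N $ 1 $ 2 + b * N $ 2 $ 2)"] exI[of _ "a * N $ 1 $ 1 + b * N $ 2 $ 1"])
        (simp add: matvec_component algebra_simps)
  qed
  have C2: "C2_on ?S (\<lambda>z. (cmod (a * (N *v chart_lift c z) $ 1 + b * (N *v chart_lift c z) $ 2))\<^sup>2)" for a b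
    using affine[of a b] C2_on_cmod_affine by (auto simp: fun_eq_iff)
  have "C2_on ?S (\<lambda>z. (cmod (wedge (N *v chart_lift c z) v))\<^sup>2)"
    using C2[of "v $ 2" "- (v $ 1)"] by (simp add: wedge_def mult.commute)
  moreover have "C2_on ?S (\<lambda>z. inverse ((norm (N *v chart_lift c z))\<^sup>2))"
  proof (rule C2_on_inverse)
    show "C2_on ?S (\<lambda>z. (norm (N *v chart_lift c z))\<^sup>2)"
      unfolding norm_vec2_power2 using C2_on_add[OF C2[of 1 0] C2[of 0 1]] by simp
    show "(norm (N *v chart_lift c z))\<^sup>2 \<noteq> 0" for z
      using matvec_nonzero[OF assms(1), of "chart_lift c z"] by simp
  qed
  ultimately have "C2_on ?S (\<lambda>z. (k / (norm v)\<^sup>2) * ((cmod (wedge (N *v chart_lift c z) v))\<^sup>2 *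
      inverse ((norm (N *v chart_lift c z))\<^sup>2)))"
    by (intro C2_on_mult C2_on_const)
  moreover have "(\<lambda>x. k * chord (N *v lift x) v) \<circ> chart_inv c = (\<lambda>z. (k / (norm v)\<^sup>2) *
      ((cmod (wedge (N *v chart_lift c z) v))\<^sup>2 * inverse ((norm (N *v chart_lift c z))\<^sup>2)))"
  proof
    fix z
    have eq: "chord (N *v lift (chart_inv c z)) v = chord (N *v chart_lift c z) v"
      using chord_matvec_lift_proj[of "chart_lift c z" N v] by simp
    then show "((\<lambda>x. k * chord (N *v lift x) v) \<circ> chart_inv c) z = (k / (norm v)\<^sup>2) *
      ((cmod (wedge (N *v chart_lift c z) v))\<^sup>2 * inverse ((norm (N *v chart_lift c z))\<^sup>2))"
      unfolding o_def eq unfolding chord_def by (simp add: field_simps)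
  qed
  ultimately show "C2_on ?S ((\<lambda>x. k * chord (N *v lift x) v) \<circ> chart_inv c)" by simp
qed

section \<open>Differentials and proximal subgradients\<close>

lemma deriv_le_of_increment_le:
  fixes f :: "real \<Rightarrow> real"
  assumes "(f has_real_derivative d) (at 0)" "0 < r" "\<And>h. 0 < h \<Longrightarrow> h < r \<Longrightarrow> f h - f 0 \<le> k * h"
  shows "d \<le> k"
proof -
  have "((\<lambda>h. (f (0 + h) - f 0) / h) \<longlongrightarrow> d) (at 0)"
    using assms(1) by (simp add: DERIV_def)
  then have lim: "((\<lambda>h. (f h - f 0) / h) \<longlongrightarrow> d) (at_right 0)"
    by (simp add: filterlim_at_split)
  have "\<forall>\<^sub>F h in at_right 0. (f h - f 0) / h \<le> k"
    unfolding eventually_at_right_field using assms(2,3)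
    by (intro exI[of _ r]) (auto simp: divide_le_eq)
  then show ?thesis by (rule tendsto_upperbound[OF lim]) simp
qed

text \<open>The derivative along a sequence that approaches \<open>x\<close> with limiting direction \<open>\<zeta>\<close> but not
  along any fixed differentiable curve.\<close>

lemma has_derivative_quotient_limit:
  fixes f :: "'a::real_normed_vector \<Rightarrow> real"
  assumes f: "(f has_derivative D) (at x)"
    and h: "h \<longlonglongrightarrow> 0" "\<And>n :: nat. 0 < h n"
    and y: "(\<lambda>n. (y n - x) /\<^sub>R h n) \<longlonglongrightarrow> \<zeta>"
  shows "(\<lambda>n. (f (y n) - f x) / h n) \<longlonglongrightarrow> D \<zeta>"
proof -
  have bl: "bounded_linear D" using f by (rule has_derivative_bounded_linear)
  define z where "z n = (y n - x) /\<^sub>R h n" for n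
  have yz: "y n - x = h n *\<^sub>R z n" for n using h(2)[of n] by (simp add: z_def)
  have z: "z \<longlonglongrightarrow> \<zeta>" using y unfolding z_def .
  have "(\<lambda>n. h n *\<^sub>R z n) \<longlonglongrightarrow> 0 *\<^sub>R \<zeta>" by (intro tendsto_scaleR h z)
  then have yx: "(\<lambda>n. y n - x) \<longlonglongrightarrow> 0" by (simp add: yz)
  have Dz: "(\<lambda>n. D (z n)) \<longlonglongrightarrow> D \<zeta>" by (rule bounded_linear.tendsto[OF bl z])
  have "(\<lambda>n. (f (y n) - f x) / h n - D (z n)) \<longlonglongrightarrow> 0"
  proof (rule LIMSEQ_I)
    fix r :: real assume r: "0 < r"
    define K where "K = norm \<zeta> + 1"
    have K: "0 < K" by (simp add: K_def add_nonneg_pos)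
    obtain d where d: "d > 0" "\<And>w. norm (w - x) < d \<Longrightarrow> norm (f w - f x - D (w - x)) \<le> r / (2 * K) * norm (w - x)"
      using f r K unfolding has_derivative_at_alt by (metis divide_pos_pos mult_pos_pos zero_less_numeral)
    obtain N1 where N1: "\<And>n. n \<ge> N1 \<Longrightarrow> norm (y n - x) < d"
      using LIMSEQ_D[OF yx d(1)] by auto
    have "(\<lambda>n. norm (z n)) \<longlonglongrightarrow> norm \<zeta>" by (intro tendsto_norm z)
    then have "\<forall>\<^sub>F n in sequentially. norm (z n) < K"
      by (rule order_tendstoD) (simp add: K_def)
    then obtain N2 where N2: "\<And>n. n \<ge> N2 \<Longrightarrow> norm (z n) < K" by (auto simp: eventually_sequentially)
    show "\<exists>N. \<forall>n\<ge>N. norm ((f (y n) - f x) / h n - D (z n) - 0) < r"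
    proof (intro exI[of _ "max N1 N2"] allI impI)
      fix n assume n: "max N1 N2 \<le> n"
      have hn: "0 < h n" by (rule h)
      have "D (y n - x) = h n * D (z n)" using yz by (simp add: linear_scale[OF bounded_linear.linear[OF bl]])
      then have "(f (y n) - f x) / h n - D (z n) = (f (y n) - f x - D (y n - x)) / h n"
        using hn by (simp add: field_simps)
      then have "norm ((f (y n) - f x) / h n - D (z n)) = norm (f (y n) - f x - D (y n - x)) / h n"
        using hn by (simp add: norm_divide)
      also have "\<dots> \<le> (r / (2 * K) * norm (y n - x)) / h n"
        using d(2)[OF N1] n hn by (intro divide_right_mono) auto
      also have "\<dots> = r / (2 * K) * norm (z n)" using hn by (simp add: yz)
      also have "\<dots> \<le> r / (2 * K) * K" using N2[of n] n r K by (intro mult_left_mono) auto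
      also have "\<dots> < r" using r K by simp
      finally show "norm ((f (y n) - f x) / h n - D (z n) - 0) < r" by simp
    qed
  qed
  from tendsto_add[OF this Dz] show ?thesis by simp
qed

text \<open>The derivatives in the two charts are related by the chain rule for \<open>w \<mapsto> - 1 / w\<close>, which is the
  compatibility demanded of a covector.\<close>

lemma sphere_C2_on_imp_differential:
  assumes m: "sphere_C2_on \<Omega> m" and x: "x \<in> \<Omega>"
  obtains l where "is_differential m x l"
proof -
  have "\<exists>D. ((m \<circ> chart_inv c) has_derivative blinfun_apply D) (at (chart_map c x))"
    if "x \<in> chart_dom c" for c
    using m x that unfolding sphere_C2_on_def C2_on_def by blast
  then obtain D where D: "\<And>c. x \<in> chart_dom c \<Longrightarrow>
      ((m \<circ> chart_inv c) has_derivative blinfun_apply (D c)) (at (chart_map c x))"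
    by metis
  define l where "l c = (if x \<in> chart_dom c then D c else 0)" for c
  have "blinfun_apply (D c) w = blinfun_apply (D d) (transition_deriv x c d w)"
    if cd: "x \<in> chart_dom c" "x \<in> chart_dom d" for c d w
  proof (cases "c = d")
    case True
    then show ?thesis by (simp add: transition_deriv_self)
  next
    case False
    have inv: "chart_map d (chart_inv c w) = - 1 / w" "chart_inv d (- 1 / w) = chart_inv c w" if "w \<noteq> 0" for w
      using False that by (cases c; cases d; simp)+
    define w0 where "w0 = chart_map c x"
    have w0: "w0 \<noteq> 0" using cd False unfolding w0_def by (cases c; cases d; cases x) auto
    have dx: "chart_map d x = - 1 / w0"
      using inv(1)[OF w0] cd by (simp add: w0_def)
    have "((\<lambda>w. - 1 / w) has_field_derivative (1 / w0\<^sup>2)) (at w0)"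
      using w0 by (auto intro!: derivative_eq_intros simp: power2_eq_square)
    then have d1: "((\<lambda>w. - 1 / w) has_derivative (\<lambda>h. h / w0\<^sup>2)) (at w0)"
      by (simp add: has_field_derivative_def mult.commute[of _ "inverse _"] divide_inverse)
    have "transition_deriv x c d = (\<lambda>h. h / w0\<^sup>2)"
      unfolding transition_deriv_def w0_def[symmetric]
    proof (rule frechet_derivative_at[symmetric])
      show "(chart_map d \<circ> chart_inv c has_derivative (\<lambda>h. h / w0\<^sup>2)) (at w0)"
        by (rule has_derivative_transform_within_open[OF d1, of "- {0}"]) (use w0 inv in auto)
    qed
    moreover have "((m \<circ> chart_inv d) \<circ> (\<lambda>w. - 1 / w) has_derivative (blinfun_apply (D d) \<circ> (\<lambda>h. h / w0\<^sup>2))) (at w0)"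
      using D[OF cd(2)] d1 unfolding dx by (intro diff_chain_at)
    then have "((m \<circ> chart_inv c) has_derivative (blinfun_apply (D d) \<circ> (\<lambda>h. h / w0\<^sup>2))) (at w0)"
      by (rule has_derivative_transform_within_open[of _ _ _ _ "- {0}"]) (use w0 inv in auto)
    then have "blinfun_apply (D c) = blinfun_apply (D d) \<circ> (\<lambda>h. h / w0\<^sup>2)"
      using D[OF cd(1)] unfolding w0_def[symmetric] by (rule has_derivative_unique[rotated])
    ultimately show ?thesis by simp
  qed
  then have "l \<in> cotangent_space x"
    unfolding cotangent_space_def l_def by auto
  then have "is_differential m x l"
    unfolding is_differential_def using D by (simp add: l_def)
  then show thesis by (rule that)
qed

text \<open>The derivative of \<open>chart_quot\<close> at the point \<open>chart_lift c z\<close>.\<close>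

fun chart_quot_deriv :: "chart \<Rightarrow> complex \<Rightarrow> complex^2 \<Rightarrow> complex" where
  "chart_quot_deriv Chart1 z \<xi> = \<xi> $ 1 - z * \<xi> $ 2"
| "chart_quot_deriv Chart2 z \<xi> = - (\<xi> $ 2) - z * \<xi> $ 1"

lemma has_derivative_chart_quot:
  "(chart_quot c has_derivative chart_quot_deriv c z) (at (chart_lift c z))"
proof -
  have nth: "((\<lambda>u :: complex^2. u $ i) has_derivative (\<lambda>\<xi>. \<xi> $ i)) (at u)" for i u
    by (intro bounded_linear_imp_has_derivative bounded_linear_vec_nth)
  show ?thesis
  proof (cases c)
    case Chart1
    have "((\<lambda>u. u $ 1 / u $ 2) has_derivative (\<lambda>\<xi>. \<xi> $ 1 - z * \<xi> $ 2)) (at (vector [z, 1] :: complex^2))"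
      by (rule has_derivative_eq_rhs[OF has_derivative_divide'[OF nth nth]]) auto
    then show ?thesis using Chart1 by (simp add: chart_quot.simps[abs_def] chart_quot_deriv.simps[abs_def])
  next
    case Chart2
    have "((\<lambda>u. - (u $ 2) / u $ 1) has_derivative (\<lambda>\<xi>. - (\<xi> $ 2) - z * \<xi> $ 1)) (at (vector [1, - z] :: complex^2))"
      by (rule has_derivative_eq_rhs[OF has_derivative_divide'[OF has_derivative_minus[OF nth] nth]]) auto
    then show ?thesis using Chart2 by (simp add: chart_quot.simps[abs_def] chart_quot_deriv.simps[abs_def])
  qed
qed

lemma has_derivative_comp_proj:
  assumes "is_differential m x l" "x \<in> chart_dom c"
  shows "((\<lambda>u. m (proj u)) has_derivative (\<lambda>\<xi>. blinfun_apply (l c) (chart_quot_deriv c (chart_map c x) \<xi>)))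
     (at (chart_lift c (chart_map c x)))"
proof -
  let ?u = "chart_lift c (chart_map c x)"
  have "((m \<circ> chart_inv c) has_derivative blinfun_apply (l c)) (at (chart_quot c ?u))"
    using assms unfolding is_differential_def by simp
  then have "((m \<circ> chart_inv c) \<circ> chart_quot c has_derivative
      (blinfun_apply (l c) \<circ> chart_quot_deriv c (chart_map c x))) (at ?u)"
    by (intro diff_chain_at has_derivative_chart_quot)
  then have "((\<lambda>u. m (proj u)) has_derivative (blinfun_apply (l c) \<circ> chart_quot_deriv c (chart_map c x))) (at ?u)"
    by (rule has_derivative_transform_within_open[OF _ open_chart_den[of c]]) (auto simp: chart_inv_quot)
  then show ?thesis by (simp add: o_def)
qed

lemma proximal_subdifferentialI:
  assumes "V x = ereal r" "sphere_C2_on UNIV m" "is_differential m x l"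
    and "\<And>z. ereal (r - m x) \<le> V z + ereal (- m z)"
  shows "l \<in> proximal_subdifferential V x"
  unfolding proximal_subdifferential_def mem_Collect_eq
proof (intro conjI exI[of _ m] exI[of _ UNIV])
  show "\<forall>z\<in>UNIV. ereal (m z - m x) \<le> V z - V x"
  proof
    fix z show "ereal (m z - m x) \<le> V z - V x"
      using assms(1) assms(4)[of z] by (cases "V z") auto
  qed
qed (use assms in \<open>auto simp: is_differential_def\<close>)

lemma proximal_subdifferentialE:
  assumes "l \<in> proximal_subdifferential V x" "V x \<noteq> - \<infinity>"
  obtains m \<Omega> r where "open \<Omega>" "x \<in> \<Omega>" "is_differential m x l" "V x = ereal r"
    "\<And>z q. z \<in> \<Omega> \<Longrightarrow> V z \<le> ereal q \<Longrightarrow> m z - m x \<le> q - r"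
proof -
  obtain m \<Omega> where *: "open \<Omega>" "x \<in> \<Omega>" "is_differential m x l" "V x < \<infinity>"
    "\<And>z. z \<in> \<Omega> \<Longrightarrow> ereal (m z - m x) \<le> V z - V x"
    using assms(1) unfolding proximal_subdifferential_def by blast
  obtain r where r: "V x = ereal r" using *(4) assms(2) by (cases "V x") auto
  have "m z - m x \<le> q - r" if "z \<in> \<Omega>" "V z \<le> ereal q" for z q
    using *(5)[OF that(1)] that(2) r by (cases "V z") auto
  then show thesis using that * r by blast
qed

section \<open>Matrix estimates\<close>

text \<open>A submultiplicative norm for which bounds can be collected entry by entry.\<close>

definition mnorm :: "complex^2^2 \<Rightarrow> real" where
  "mnorm M = cmod (M $ 1 $ 1) + cmod (M $ 1 $ 2) + cmod (M $ 2 $ 1) + cmod (M $ 2 $ 2)"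

lemma mnorm_nonneg [simp]: "0 \<le> mnorm M"
  by (simp add: mnorm_def)

lemma mnorm_add: "mnorm (M + N) \<le> mnorm M + mnorm N"
  unfolding mnorm_def
  using norm_triangle_ineq[of "M $ 1 $ 1" "N $ 1 $ 1"] norm_triangle_ineq[of "M $ 1 $ 2" "N $ 1 $ 2"]
    norm_triangle_ineq[of "M $ 2 $ 1" "N $ 2 $ 1"] norm_triangle_ineq[of "M $ 2 $ 2" "N $ 2 $ 2"]
  by simp

lemma mnorm_mult: "mnorm (M ** N) \<le> mnorm M * mnorm N"
proof -
  have c: "cmod ((M ** N) $ i $ j) \<le> cmod (M $ i $ 1) * cmod (N $ 1 $ j) + cmod (M $ i $ 2) * cmod (N $ 2 $ j)" for i j
    unfolding matmul_component norm_mult[symmetric] by (rule norm_triangle_ineq)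
  have "mnorm (M ** N) \<le>
     (cmod (M $ 1 $ 1) * cmod (N $ 1 $ 1) + cmod (M $ 1 $ 2) * cmod (N $ 2 $ 1)) +
     (cmod (M $ 1 $ 1) * cmod (N $ 1 $ 2) + cmod (M $ 1 $ 2) * cmod (N $ 2 $ 2)) +
     (cmod (M $ 2 $ 1) * cmod (N $ 1 $ 1) + cmod (M $ 2 $ 2) * cmod (N $ 2 $ 1)) +
     (cmod (M $ 2 $ 1) * cmod (N $ 1 $ 2) + cmod (M $ 2 $ 2) * cmod (N $ 2 $ 2))"
    unfolding mnorm_def by (intro add_mono c)
  also have "\<dots> \<le> mnorm M * mnorm N"
    unfolding mnorm_def by (simp add: algebra_simps)
  finally show ?thesis .
qed

lemma norm_vec2_le: "norm u \<le> cmod (u $ 1) + cmod (u $ 2)" for u :: "complex^2"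
  unfolding norm_vec_def L2_set_def sum_2 by (intro sqrt_sum_squares_le_sum norm_ge_zero)

lemma norm_matvec_le: "norm (M *v u) \<le> mnorm M * norm u"
proof -
  have c: "cmod ((M *v u) $ i) \<le> cmod (M $ i $ 1) * norm u + cmod (M $ i $ 2) * norm u" for i
  proof -
    have "cmod ((M *v u) $ i) \<le> cmod (M $ i $ 1) * cmod (u $ 1) + cmod (M $ i $ 2) * cmod (u $ 2)"
      unfolding matvec_component norm_mult[symmetric] by (rule norm_triangle_ineq)
    also have "\<dots> \<le> cmod (M $ i $ 1) * norm u + cmod (M $ i $ 2) * norm u"
      by (intro add_mono mult_left_mono Finite_Cartesian_Product.norm_nth_le norm_ge_zero)
    finally show ?thesis .
  qed
  have "norm (M *v u) \<le> cmod ((M *v u) $ 1) + cmod ((M *v u) $ 2)" by (rule norm_vec2_le)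
  also have "\<dots> \<le> (cmod (M $ 1 $ 1) * norm u + cmod (M $ 1 $ 2) * norm u) +
      (cmod (M $ 2 $ 1) * norm u + cmod (M $ 2 $ 2) * norm u)"
    by (intro add_mono c)
  also have "\<dots> = mnorm M * norm u" by (simp add: mnorm_def algebra_simps)
  finally show ?thesis .
qed

lemma norm_le_mnorm: "norm M \<le> mnorm M"
proof -
  have "norm M \<le> norm (M $ 1) + norm (M $ 2)"
    unfolding norm_vec_def[of M] L2_set_def sum_2 by (intro sqrt_sum_squares_le_sum norm_ge_zero)
  also have "\<dots> \<le> mnorm M"
    using norm_vec2_le[of "M $ 1"] norm_vec2_le[of "M $ 2"] by (simp add: mnorm_def)
  finally show ?thesis .
qed

lemma tendsto_matmul:
  fixes A B :: "'a \<Rightarrow> complex^2^2"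
  assumes "(A \<longlongrightarrow> a) F" "(B \<longlongrightarrow> b) F"
  shows "((\<lambda>n. A n ** B n) \<longlongrightarrow> a ** b) F"
  by (intro vec_tendstoI) (simp add: matmul_component, intro tendsto_intros tendsto_vec_nth assms)

lemma tendsto_matvec:
  fixes A :: "'a \<Rightarrow> complex^2^2"
  assumes "(A \<longlongrightarrow> a) F" "(u \<longlongrightarrow> v) F"
  shows "((\<lambda>n. A n *v u n) \<longlongrightarrow> a *v v) F"
  by (intro vec_tendstoI) (simp add: matvec_component, intro tendsto_intros tendsto_vec_nth assms)

lemma tendsto_adj2:
  assumes "(A \<longlongrightarrow> a) F"
  shows "((\<lambda>n. adj2 (A n)) \<longlongrightarrow> adj2 a) F"
proof (intro vec_tendstoI)
  fix i j :: 2
  show "((\<lambda>n. adj2 (A n) $ i $ j) \<longlongrightarrow> adj2 a $ i $ j) F"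
    using exhaust_2[of i] exhaust_2[of j]
    by (elim disjE; simp; intro tendsto_intros tendsto_vec_nth assms)
qed

text \<open>The size allowed for the second order remainder of a transfer matrix. The exponential is chosen
  because it is exactly compatible with products: if \<open>1 + a + exp_rem a\<close> and
  \<open>1 + b + exp_rem b\<close> are multiplied, the result is \<open>1 + (a + b) + exp_rem (a + b)\<close>.\<close>

definition exp_rem :: "real \<Rightarrow> real" where
  "exp_rem x = exp x - 1 - x"

lemma exp_rem_nonneg [simp]: "0 \<le> exp_rem x"
  unfolding exp_rem_def using exp_ge_add_one_self[of x] by linarith

lemma exp_rem_mono:
  assumes "0 \<le> x" "x \<le> y"
  shows "exp_rem x \<le> exp_rem y"
proof -
  have "1 + (y - x) \<le> exp (y - x)" by (rule exp_ge_add_one_self)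
  moreover have "exp (y - x) \<ge> 1" using assms by simp
  moreover have "exp y - exp x = exp x * (exp (y - x) - 1)" by (simp add: exp_diff field_simps)
  moreover have "1 * (exp (y - x) - 1) \<le> exp x * (exp (y - x) - 1)"
    using assms by (intro mult_right_mono) auto
  ultimately have "exp (y - x) - 1 \<le> exp y - exp x" by simp
  then show ?thesis using \<open>1 + (y - x) \<le> exp (y - x)\<close> unfolding exp_rem_def by linarith
qed

lemma exp_rem_le_square:
  assumes "0 \<le> x"
  shows "exp_rem x \<le> x\<^sup>2 * exp x"
proof -
  have "(1 + - x) * exp x \<le> exp (- x) * exp x"
    by (intro mult_right_mono exp_ge_add_one_self) auto
  then have *: "exp x - 1 \<le> x * exp x" by (simp add: exp_minus algebra_simps)
  then have "exp_rem x \<le> x * (exp x - 1)" by (simp add: exp_rem_def algebra_simps)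
  also have "\<dots> \<le> x * (x * exp x)" using * assms by (rule mult_left_mono)
  finally show ?thesis by (simp add: power2_eq_square mult.assoc)
qed

text \<open>Convexity of the exponential; it absorbs a factor in front of the remainder into its argument.\<close>

lemma exp_rem_scale:
  assumes "1 \<le> k" "0 \<le> x"
  shows "k * exp_rem x \<le> exp_rem (k * x)"
proof -
  have "convex_on UNIV (exp :: real \<Rightarrow> real)" by (rule exp_convex)
  then have "exp ((1 - 1 / k) *\<^sub>R 0 + (1 / k) *\<^sub>R (k * x)) \<le> (1 - 1 / k) * exp 0 + (1 / k) * exp (k * x)"
    by (rule convex_onD) (use assms in auto)
  then have "exp x \<le> (1 - 1 / k) + (1 / k) * exp (k * x)" using assms by simp
  then have "k * exp x \<le> k * ((1 - 1 / k) + (1 / k) * exp (k * x))" using assms by (intro mult_left_mono) auto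
  also have "\<dots> = k - 1 + exp (k * x)" using assms by (simp add: field_simps)
  finally show ?thesis by (simp add: exp_rem_def algebra_simps)
qed

lemma norm_exp_minus_affine_le: "norm (exp w - 1 - w) \<le> exp_rem (norm w)" for w :: complex
proof -
  have eq: "exp x - 1 - x = (\<Sum>n. inverse (fact (n + 2)) *\<^sub>R (x ^ (n + 2)))" for x :: "'a::{real_normed_field,banach}"
    using exp_first_two_terms[of x] by simp
  have "summable (\<lambda>n. norm (inverse (fact (n + 2)) *\<^sub>R (w ^ (n + 2))))"
    using summable_ignore_initial_segment[OF summable_norm_exp[of w], of 2] by (simp only:)
  then have "norm (\<Sum>n. inverse (fact (n + 2)) *\<^sub>R (w ^ (n + 2))) \<le> (\<Sum>n. norm (inverse (fact (n + 2)) *\<^sub>R (w ^ (n + 2))))"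
    by (rule summable_norm)
  also have "\<dots> = (\<Sum>n. inverse (fact (n + 2)) *\<^sub>R (norm w ^ (n + 2)))"
    by (simp add: norm_mult norm_power)
  also have "\<dots> = exp_rem (norm w)" unfolding exp_rem_def eq ..
  finally show ?thesis unfolding eq .
qed

lemma cmod_cos_minus_one_le: "cmod (cos z - 1) \<le> exp_rem (cmod z)"
proof -
  define a where "a = exp (\<i> * z) - 1 - \<i> * z"
  define b where "b = exp (- (\<i> * z)) - 1 - (- (\<i> * z))"
  have "cos z - 1 = (a + b) / 2"
    by (simp add: cos_exp_eq a_def b_def field_simps)
  then have "cmod (cos z - 1) = cmod (a + b) / 2"
    by (simp only: norm_divide norm_numeral)
  also have "\<dots> \<le> (cmod a + cmod b) / 2"
    by (intro divide_right_mono norm_triangle_ineq) auto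
  also have "\<dots> \<le> (exp_rem (cmod (\<i> * z)) + exp_rem (cmod (- (\<i> * z)))) / 2"
    unfolding a_def b_def by (intro divide_right_mono add_mono norm_exp_minus_affine_le) auto
  finally show ?thesis by (simp add: norm_mult)
qed

lemma cmod_sin_minus_le: "cmod (sin z - z) \<le> exp_rem (cmod z)"
proof -
  define a where "a = exp (\<i> * z) - 1 - \<i> * z"
  define b where "b = exp (- (\<i> * z)) - 1 - (- (\<i> * z))"
  have "sin z - z = (a - b) / (2 * \<i>)"
    by (simp add: sin_exp_eq a_def b_def field_simps)
  then have "cmod (sin z - z) = cmod (a - b) / 2"
    by (simp only: norm_divide norm_mult norm_numeral norm_ii mult_1_right)
  also have "\<dots> \<le> (cmod a + cmod b) / 2"
    by (intro divide_right_mono norm_triangle_ineq4) auto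
  also have "\<dots> \<le> (exp_rem (cmod (\<i> * z)) + exp_rem (cmod (- (\<i> * z)))) / 2"
    unfolding a_def b_def by (intro divide_right_mono add_mono norm_exp_minus_affine_le) auto
  finally show ?thesis by (simp add: norm_mult)
qed

text \<open>Expand the product of \<open>1 + X + R\<close> and \<open>1 + Y + S\<close>; the bounds for the terms other than
  \<open>X + Y\<close> add up to \<open>exp_rem (a + b)\<close>.\<close>

lemma mnorm_remainder_mult:
  assumes "mnorm X \<le> a" "mnorm (M - mat 1 - X) \<le> exp_rem a"
    and "mnorm Y \<le> b" "mnorm (N - mat 1 - Y) \<le> exp_rem b"
  shows "mnorm (N ** M - mat 1 - (X + Y)) \<le> exp_rem (a + b)"
proof -
  define R where "R = M - mat 1 - X"
  define S where "S = N - mat 1 - Y"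
  have "N ** M - mat 1 - (X + Y) = Y ** X + (Y ** R + (S ** X + (S ** R + (R + S))))"
    by (simp add: mat2_eq_iff matmul_component mat1_component R_def S_def algebra_simps)
  then have "mnorm (N ** M - mat 1 - (X + Y)) \<le> mnorm (Y ** X) + (mnorm (Y ** R) + (mnorm (S ** X) + (mnorm (S ** R) + (mnorm R + mnorm S))))"
    by (simp only:) (intro order_trans[OF mnorm_add] add_mono order_refl)
  also have "\<dots> \<le> mnorm Y * mnorm X + (mnorm Y * mnorm R + (mnorm S * mnorm X + (mnorm S * mnorm R + (mnorm R + mnorm S))))"
    by (intro add_mono mnorm_mult order_refl)
  also have "\<dots> \<le> b * a + (b * exp_rem a + (exp_rem b * a + (exp_rem b * exp_rem a + (exp_rem a + exp_rem b))))"
    using assms order_trans[OF mnorm_nonneg assms(1)] order_trans[OF mnorm_nonneg assms(3)]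
    by (intro add_mono mult_mono) (auto simp: R_def S_def)
  also have "\<dots> = exp_rem (a + b)"
    by (simp add: exp_rem_def exp_add algebra_simps)
  finally show ?thesis .
qed

section \<open>Transfer matrices of the linear system\<close>

text \<open>The linear system with controls between \<open>c1\<close> and \<open>c2\<close>. For the Riccati equation these are
  the squares of \<open>n1\<close> and \<open>n2\<close>.\<close>

locale control =
  fixes \<kappa> :: complex and c1 c2 :: real
  assumes c1_pos: "0 < c1" and c1_less_c2: "c1 < c2"

context control
begin

text \<open>The linear system behind the Riccati equation is \<open>u' = gen e *v u\<close>.\<close>

definition gen :: "real \<Rightarrow> complex^2^2" where
  "gen e = vector [vector [0, \<i> * \<kappa> * of_real e], vector [\<i> * \<kappa>, 0]]"

text \<open>The integral of \<open>gen\<close> over a time \<open>\<tau>\<close> in which the control has integral \<open>E\<close>.\<close>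

definition drift :: "real \<Rightarrow> real \<Rightarrow> complex^2^2" where
  "drift \<tau> E = vector [vector [0, \<i> * \<kappa> * of_real E], vector [\<i> * \<kappa> * of_real \<tau>, 0]]"

text \<open>For positive \<open>e\<close> this is the exponential of \<open>t\<close> times \<open>gen e\<close>, whose square is
  \<open>- \<kappa>\<^sup>2 e\<close> times the identity matrix.\<close>

definition flow :: "real \<Rightarrow> real \<Rightarrow> complex^2^2" where
  "flow e t = vector
     [vector [cos (\<kappa> * of_real (sqrt e) * of_real t), \<i> * of_real (sqrt e) * sin (\<kappa> * of_real (sqrt e) * of_real t)],
      vector [\<i> / of_real (sqrt e) * sin (\<kappa> * of_real (sqrt e) * of_real t), cos (\<kappa> * of_real (sqrt e) * of_real t)]]"

text \<open>The entries of \<open>flow\<close> carry the factors \<open>sqrt e\<close> and \<open>1 / sqrt e\<close>; the constant comes from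
  \<open>(2 + s + 1 / s) * s = (s + 1)\<^sup>2 \<le> 2 * s\<^sup>2 + 2\<close> with \<open>s = sqrt e\<close>.\<close>

definition rate :: real where "rate = cmod \<kappa> * (2 * c2 + 2)"

lemma c2_pos: "0 < c2" using c1_pos c1_less_c2 by simp

lemma rate_nonneg: "0 \<le> rate" using c2_pos by (simp add: rate_def)

lemma gen_component [simp]: "gen e $ 1 $ 1 = 0" "gen e $ 1 $ 2 = \<i> * \<kappa> * of_real e" "gen e $ 2 $ 1 = \<i> * \<kappa>" "gen e $ 2 $ 2 = 0"
  by (simp_all add: gen_def)

lemma drift_component [simp]: "drift t E $ 1 $ 1 = 0" "drift t E $ 1 $ 2 = \<i> * \<kappa> * of_real E"
  "drift t E $ 2 $ 1 = \<i> * \<kappa> * of_real t" "drift t E $ 2 $ 2 = 0"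
  by (simp_all add: drift_def)

lemma flow_component:
  "flow e t $ 1 $ 1 = cos (\<kappa> * of_real (sqrt e) * of_real t)"
  "flow e t $ 1 $ 2 = \<i> * of_real (sqrt e) * sin (\<kappa> * of_real (sqrt e) * of_real t)"
  "flow e t $ 2 $ 1 = \<i> / of_real (sqrt e) * sin (\<kappa> * of_real (sqrt e) * of_real t)"
  "flow e t $ 2 $ 2 = cos (\<kappa> * of_real (sqrt e) * of_real t)"
  by (simp_all add: flow_def)

lemma drift_add: "drift (s + t) (E + F) = drift s E + drift t F"
  by (simp add: mat2_eq_iff algebra_simps)

lemma flow_0 [simp]: "flow e 0 = mat 1"
  by (simp add: mat2_eq_iff flow_component mat1_component)

lemma det_flow [simp]:
  assumes "0 < e"
  shows "det (flow e t) = 1"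
proof -
  have "det (flow e t) = (cos (\<kappa> * of_real (sqrt e) * of_real t))\<^sup>2 + (sin (\<kappa> * of_real (sqrt e) * of_real t))\<^sup>2"
    using assms by (simp add: det_2 flow_component power2_eq_square algebra_simps)
  then show ?thesis by simp
qed

lemma flow_add:
  assumes "0 < e"
  shows "flow e (s + t) = flow e s ** flow e t"
  using assms
  by (simp add: mat2_eq_iff matmul_component flow_component of_real_add distrib_left cos_add sin_add)
    (simp add: algebra_simps)

lemma flow_minus: "0 < e \<Longrightarrow> flow e (- t) = adj2 (flow e t)"
  by (simp add: mat2_eq_iff flow_component)

lemma mnorm_gen_le: "0 \<le> e \<Longrightarrow> e \<le> c2 \<Longrightarrow> mnorm (gen e) \<le> rate"
proof -
  assume e: "0 \<le> e" "e \<le> c2"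
  have "mnorm (gen e) = cmod \<kappa> * (e + 1)" using e by (simp add: mnorm_def norm_mult algebra_simps)
  also have "\<dots> \<le> cmod \<kappa> * (2 * c2 + 2)" using e c2_pos by (intro mult_left_mono) auto
  finally show ?thesis by (simp add: rate_def)
qed

lemma mnorm_drift_le:
  assumes "0 \<le> t" "0 \<le> E" "E \<le> c2 * t"
  shows "mnorm (drift t E) \<le> rate * t"
proof -
  have "mnorm (drift t E) = cmod \<kappa> * (E + t)"
    using assms by (simp add: mnorm_def norm_mult algebra_simps)
  also have "\<dots> \<le> cmod \<kappa> * ((2 * c2 + 2) * t)"
    using assms c2_pos by (intro mult_left_mono) (auto simp: algebra_simps)
  finally show ?thesis by (simp add: rate_def)
qed

text \<open>The diagonal entries of the difference are \<open>cos z - 1\<close> and the others multiples of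
  \<open>sin z - z\<close>, where \<open>z = \<kappa> * sqrt e * t\<close>; both are bounded by \<open>exp_rem (cmod z)\<close>.\<close>

lemma flow_estimate:
  assumes "0 \<le> t" "0 < e" "e \<le> c2"
  shows "mnorm (flow e t - mat 1 - drift t (t * e)) \<le> exp_rem (rate * t)"
proof -
  define s where "s = sqrt e"
  have s: "0 < s" "s * s = e" using assms by (auto simp: s_def)
  define z where "z = \<kappa> * of_real s * of_real t"
  have e: "complex_of_real e = of_real s * of_real s" using s(2) by (metis of_real_mult)
  have c: "(flow e t - mat 1 - drift t (t * e)) $ 1 $ 1 = cos z - 1"
    "(flow e t - mat 1 - drift t (t * e)) $ 2 $ 2 = cos z - 1"
    by (simp_all add: flow_component mat1_component s_def z_def)
  have c12: "(flow e t - mat 1 - drift t (t * e)) $ 1 $ 2 = \<i> * of_real s * (sin z - z)"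
    by (simp add: flow_component mat1_component s_def[symmetric] z_def[symmetric])
      (simp add: z_def e algebra_simps)
  have c21: "(flow e t - mat 1 - drift t (t * e)) $ 2 $ 1 = \<i> / of_real s * (sin z - z)"
    using s(1) by (simp add: flow_component mat1_component s_def[symmetric] z_def[symmetric])
      (simp add: z_def field_simps)
  have "mnorm (flow e t - mat 1 - drift t (t * e)) =
      2 * cmod (cos z - 1) + cmod (\<i> * of_real s * (sin z - z)) + cmod (\<i> / of_real s * (sin z - z))"
    unfolding mnorm_def c c12 c21 by simp
  also have "\<dots> = 2 * cmod (cos z - 1) + s * cmod (sin z - z) + (1 / s) * cmod (sin z - z)"
    using s(1) by (simp add: norm_mult norm_divide)
  also have "\<dots> \<le> 2 * exp_rem (cmod z) + s * exp_rem (cmod z) + (1 / s) * exp_rem (cmod z)"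
    using s(1) by (intro add_mono mult_left_mono cmod_cos_minus_one_le cmod_sin_minus_le) auto
  also have "\<dots> = (2 + s + 1 / s) * exp_rem (cmod z)" by (simp add: algebra_simps)
  also have "\<dots> \<le> exp_rem ((2 + s + 1 / s) * cmod z)"
    using s(1) by (intro exp_rem_scale) (auto simp: field_simps)
  also have "\<dots> \<le> exp_rem (rate * t)"
  proof (rule exp_rem_mono)
    have "cmod z = cmod \<kappa> * s * t" using s(1) assms by (simp add: z_def norm_mult)
    then have "(2 + s + 1 / s) * cmod z = cmod \<kappa> * t * (s + 1)\<^sup>2"
      using s(1) by (simp add: field_simps power2_eq_square)
    also have "\<dots> \<le> cmod \<kappa> * t * (2 * c2 + 2)"
    proof (rule mult_left_mono)
      have "(s + 1)\<^sup>2 \<le> 2 * (s * s) + 2"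
        using sum_squares_bound[of s 1] by (simp add: power2_eq_square algebra_simps)
      then show "(s + 1)\<^sup>2 \<le> 2 * c2 + 2" using s(2) assms(3) by simp
    qed (use assms in auto)
    finally show "(2 + s + 1 / s) * cmod z \<le> rate * t" by (simp add: rate_def mult_ac)
  qed (use s(1) in auto)
  finally show ?thesis .
qed

text \<open>Elapsed time, integral of the control and transfer matrix of a piecewise constant control. The
  integral is recorded because it determines the first order behaviour of the matrix, through
  \<open>drift\<close>, and because the control is recovered from it as a derivative.\<close>

inductive reach :: "real \<Rightarrow> real \<Rightarrow> complex^2^2 \<Rightarrow> bool" where
  reach_0: "reach 0 0 (mat 1)"
| reach_step: "reach \<tau> E M \<Longrightarrow> 0 \<le> t \<Longrightarrow> c1 \<le> e \<Longrightarrow> e \<le> c2 \<Longrightarrow> reach (\<tau> + t) (E + t * e) (flow e t ** M)"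

text \<open>By \<open>ctrl_imp_trajectory\<close> and \<open>trajectory_imp_ctrl\<close> the closure accounts for all measurable
  controls, since the control enters linearly and ranges over an interval.\<close>

definition ctrl :: "real \<Rightarrow> real \<Rightarrow> complex^2^2 \<Rightarrow> bool" where
  "ctrl \<tau> E M \<longleftrightarrow> (\<tau>, E, M) \<in> closure {(\<tau>, E, M). reach \<tau> E M}"

lemma reach_flow: "0 \<le> t \<Longrightarrow> c1 \<le> e \<Longrightarrow> e \<le> c2 \<Longrightarrow> reach t (t * e) (flow e t)"
  using reach_step[OF reach_0, of t e] by simp

lemma reach_mult:
  assumes "reach \<tau>' E' N" "reach \<tau> E M"
  shows "reach (\<tau> + \<tau>') (E + E') (N ** M)"
  using assms
proof (induction rule: reach.induct)
  case reach_0
  then show ?case by simp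
next
  case (reach_step \<tau>' E' N t e)
  then have "reach ((\<tau> + \<tau>') + t) ((E + E') + t * e) (flow e t ** (N ** M))"
    by (intro reach.reach_step) auto
  then show ?case by (simp add: matrix_mul_assoc add.assoc)
qed

lemma reach_estimate:
  assumes "reach \<tau> E M"
  shows "0 \<le> \<tau> \<and> c1 * \<tau> \<le> E \<and> E \<le> c2 * \<tau> \<and> det M = 1 \<and>
    mnorm (M - mat 1 - drift \<tau> E) \<le> exp_rem (rate * \<tau>)"
  using assms
proof (induction rule: reach.induct)
  case reach_0
  have "mat 1 - mat 1 - drift 0 0 = (0 :: complex^2^2)" by (simp add: mat2_eq_iff)
  then show ?case by (simp add: mnorm_def)
next
  case (reach_step \<tau> E M t e)
  have e: "0 < e" using reach_step c1_pos by simp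
  have "0 \<le> c1 * \<tau>" using reach_step c1_pos by simp
  then have "0 \<le> E" using reach_step by linarith
  have te: "0 \<le> t * e" "c1 * t \<le> t * e" "t * e \<le> c2 * t"
    using reach_step e by (auto simp: mult.commute[of t] intro: mult_right_mono)
  have "mnorm (flow e t ** M - mat 1 - (drift \<tau> E + drift t (t * e))) \<le> exp_rem (rate * \<tau> + rate * t)"
    using reach_step e te \<open>0 \<le> E\<close>
    by (intro mnorm_remainder_mult mnorm_drift_le flow_estimate) auto
  then show ?case using reach_step e te by (simp add: drift_add det_mul algebra_simps)
qed

lemma reach_imp_ctrl: "reach \<tau> E M \<Longrightarrow> ctrl \<tau> E M"
  unfolding ctrl_def by (rule subsetD[OF closure_subset]) simp

lemma ctrl_flow: "0 \<le> t \<Longrightarrow> c1 \<le> e \<Longrightarrow> e \<le> c2 \<Longrightarrow> ctrl t (t * e) (flow e t)"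
  by (intro reach_imp_ctrl reach_flow)

lemma ctrl_0: "ctrl 0 0 (mat 1)"
  by (intro reach_imp_ctrl reach_0)

lemma ctrl_approx:
  assumes "ctrl \<tau> E M"
  obtains t e m where "\<And>n :: nat. reach (t n) (e n) (m n)" "t \<longlonglongrightarrow> \<tau>" "e \<longlonglongrightarrow> E" "m \<longlonglongrightarrow> M"
proof -
  obtain x where x: "\<And>n. x n \<in> {(\<tau>, E, M). reach \<tau> E M}" "x \<longlonglongrightarrow> (\<tau>, E, M)"
    using assms unfolding ctrl_def closure_sequential by blast
  show thesis
  proof (rule that[of "\<lambda>n. fst (x n)" "\<lambda>n. fst (snd (x n))" "\<lambda>n. snd (snd (x n))"])
    show "reach (fst (x n)) (fst (snd (x n))) (snd (snd (x n)))" for n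
      using x(1)[of n] by (auto simp: split_def)
    show "(\<lambda>n. fst (x n)) \<longlonglongrightarrow> \<tau>" "(\<lambda>n. fst (snd (x n))) \<longlonglongrightarrow> E" "(\<lambda>n. snd (snd (x n))) \<longlonglongrightarrow> M"
      using tendsto_fst[OF x(2)] tendsto_fst[OF tendsto_snd[OF x(2)]] tendsto_snd[OF tendsto_snd[OF x(2)]] by simp_all
  qed
qed

lemma ctrl_limit:
  assumes "\<And>n :: nat. ctrl (t n) (e n) (m n)" "t \<longlonglongrightarrow> \<tau>" "e \<longlonglongrightarrow> E" "m \<longlonglongrightarrow> M"
  shows "ctrl \<tau> E M"
  unfolding ctrl_def
proof (rule closed_sequentially[OF closed_closure])
  show "(t n, e n, m n) \<in> closure {(\<tau>, E, M). reach \<tau> E M}" for n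
    using assms(1) unfolding ctrl_def .
  show "(\<lambda>n. (t n, e n, m n)) \<longlonglongrightarrow> (\<tau>, E, M)"
    by (intro tendsto_Pair assms)
qed

text \<open>All bounds of \<open>reach_estimate\<close> are closed conditions.\<close>

lemma ctrl_estimate:
  assumes "ctrl \<tau> E M"
  shows "0 \<le> \<tau>" "c1 * \<tau> \<le> E" "E \<le> c2 * \<tau>" "det M = 1"
    "mnorm (M - mat 1 - drift \<tau> E) \<le> exp_rem (rate * \<tau>)"
proof -
  obtain t e m where *: "\<And>n :: nat. reach (t n) (e n) (m n)" "t \<longlonglongrightarrow> \<tau>" "e \<longlonglongrightarrow> E" "m \<longlonglongrightarrow> M"
    using ctrl_approx[OF assms] by metis
  note r = reach_estimate[OF *(1)]
  show "0 \<le> \<tau>" by (rule tendsto_lowerbound[OF *(2)]) (use r in auto)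
  show "c1 * \<tau> \<le> E" by (rule tendsto_le[OF _ *(3) tendsto_mult[OF tendsto_const *(2)]]) (use r in auto)
  show "E \<le> c2 * \<tau>" by (rule tendsto_le[OF _ tendsto_mult[OF tendsto_const *(2)] *(3)]) (use r in auto)
  have "(\<lambda>n. det (m n)) \<longlonglongrightarrow> det M"
    unfolding det_2 by (intro tendsto_intros tendsto_vec_nth *)
  moreover have "(\<lambda>n. det (m n)) = (\<lambda>n. 1)" using r by auto
  ultimately show "det M = 1" by (metis LIMSEQ_unique tendsto_const)
  have lim1: "(\<lambda>n. mnorm (m n - mat 1 - drift (t n) (e n))) \<longlonglongrightarrow> mnorm (M - mat 1 - drift \<tau> E)"
    unfolding mnorm_def vector_minus_component drift_component
    by (intro tendsto_intros tendsto_vec_nth *)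
  have lim2: "(\<lambda>n. exp_rem (rate * t n)) \<longlonglongrightarrow> exp_rem (rate * \<tau>)"
    unfolding exp_rem_def by (intro tendsto_intros *)
  show "mnorm (M - mat 1 - drift \<tau> E) \<le> exp_rem (rate * \<tau>)"
    by (rule tendsto_le[OF _ lim2 lim1]) (use r in auto)
qed

lemma ctrl_E_nonneg: "ctrl \<tau> E M \<Longrightarrow> 0 \<le> E"
  using ctrl_estimate(1,2)[of \<tau> E M] c1_pos by (meson mult_nonneg_nonneg less_imp_le order_trans)

lemma ctrl_mnorm_le:
  assumes "ctrl \<tau> E M"
  shows "mnorm (M - mat 1) \<le> exp (rate * \<tau>) - 1" "mnorm M \<le> exp (rate * \<tau>) + 1"
proof -
  have "M - mat 1 = (M - mat 1 - drift \<tau> E) + drift \<tau> E" by simp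
  then have "mnorm (M - mat 1) \<le> mnorm (M - mat 1 - drift \<tau> E) + mnorm (drift \<tau> E)"
    by (metis mnorm_add)
  also have "\<dots> \<le> exp_rem (rate * \<tau>) + rate * \<tau>"
    using assms by (intro add_mono ctrl_estimate(5) mnorm_drift_le) (auto intro: ctrl_estimate ctrl_E_nonneg)
  finally show *: "mnorm (M - mat 1) \<le> exp (rate * \<tau>) - 1" by (simp add: exp_rem_def)
  have "mnorm M \<le> mnorm (M - mat 1) + mnorm (mat 1)" using mnorm_add[of "M - mat 1" "mat 1"] by simp
  moreover have "mnorm (mat 1) = 2" by (simp add: mnorm_def mat1_component)
  ultimately show "mnorm M \<le> exp (rate * \<tau>) + 1" using * by simp
qed

lemma ctrl_mult:
  assumes "ctrl \<tau>' E' N" "ctrl \<tau> E M"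
  shows "ctrl (\<tau> + \<tau>') (E + E') (N ** M)"
proof -
  obtain t e m where 1: "\<And>n :: nat. reach (t n) (e n) (m n)" "t \<longlonglongrightarrow> \<tau>" "e \<longlonglongrightarrow> E" "m \<longlonglongrightarrow> M"
    using ctrl_approx[OF assms(2)] by metis
  obtain t' e' m' where 2: "\<And>n :: nat. reach (t' n) (e' n) (m' n)" "t' \<longlonglongrightarrow> \<tau>'" "e' \<longlonglongrightarrow> E'" "m' \<longlonglongrightarrow> N"
    using ctrl_approx[OF assms(1)] by metis
  show ?thesis
    by (rule ctrl_limit[OF reach_imp_ctrl[OF reach_mult[OF 2(1) 1(1)]] tendsto_add[OF 1(2) 2(2)]
          tendsto_add[OF 1(3) 2(3)] tendsto_matmul[OF 2(4) 1(4)]])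
qed

lemma compact_ctrl: "compact {(\<tau>, E, M). ctrl \<tau> E M \<and> \<tau> \<le> K}"
proof -
  have eq: "{(\<tau>, E, M). ctrl \<tau> E M \<and> \<tau> \<le> K} =
      closure {(\<tau>, E, M). reach \<tau> E M} \<inter> {x. fst x \<le> K}"
    by (auto simp: ctrl_def)
  have closed: "closed {(\<tau>, E, M). ctrl \<tau> E M \<and> \<tau> \<le> K}"
    unfolding eq by (intro closed_Int closed_closure closed_Collect_le continuous_intros)
  have subset: "{(\<tau>, E, M). ctrl \<tau> E M \<and> \<tau> \<le> K} \<subseteq> {0..K} \<times> {0..c2 * K} \<times> cball 0 (exp (rate * K) + 1)"
  proof
    fix x assume "x \<in> {(\<tau>, E, M). ctrl \<tau> E M \<and> \<tau> \<le> K}"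
    then obtain \<tau> E M where x: "x = (\<tau>, E, M)" and *: "ctrl \<tau> E M" "\<tau> \<le> K" by auto
    have "c2 * \<tau> \<le> c2 * K" using *(2) c2_pos by simp
    moreover have "norm M \<le> exp (rate * K) + 1"
    proof -
      have "exp (rate * \<tau>) \<le> exp (rate * K)" using *(2) rate_nonneg by (simp add: mult_left_mono)
      then show ?thesis using ctrl_mnorm_le(2)[OF *(1)] norm_le_mnorm[of M] by linarith
    qed
    ultimately show "x \<in> {0..K} \<times> {0..c2 * K} \<times> cball 0 (exp (rate * K) + 1)"
      unfolding x
      using ctrl_estimate(1,3)[OF *(1)] ctrl_E_nonneg[OF *(1)] *(2)
      by auto
  qed
  have "compact ({0..K} \<times> {0..c2 * K} \<times> cball (0 :: complex^2^2) (exp (rate * K) + 1))"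
    by (intro compact_Times compact_Icc compact_cball)
  from compact_Int_closed[OF this closed] show ?thesis
    unfolding Int_absorb1[OF subset] .
qed

lemma ctrl_subsequence:
  assumes "\<And>n :: nat. ctrl (t n) (e n) (m n)" "\<And>n. t n \<le> K"
  obtains k \<tau> E M where "strict_mono (k :: nat \<Rightarrow> nat)" "ctrl \<tau> E M"
    "(\<lambda>n. t (k n)) \<longlonglongrightarrow> \<tau>" "(\<lambda>n. e (k n)) \<longlonglongrightarrow> E" "(\<lambda>n. m (k n)) \<longlonglongrightarrow> M"
proof -
  have "\<forall>n. (t n, e n, m n) \<in> {(\<tau>, E, M). ctrl \<tau> E M \<and> \<tau> \<le> K}" using assms by auto
  then obtain x k where x: "x \<in> {(\<tau>, E, M). ctrl \<tau> E M \<and> \<tau> \<le> K}" "strict_mono k"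
    "((\<lambda>n. (t n, e n, m n)) \<circ> k) \<longlonglongrightarrow> x"
    by (rule seq_compactE[OF compact_imp_seq_compact[OF compact_ctrl[of K]]])
  obtain \<tau> E M where [simp]: "x = (\<tau>, E, M)" by (cases x)
  have lim: "(\<lambda>n. (t (k n), e (k n), m (k n))) \<longlonglongrightarrow> (\<tau>, E, M)" using x(3) by (simp add: o_def)
  have "ctrl \<tau> E M" using x(1) by simp
  moreover have "(\<lambda>n. t (k n)) \<longlonglongrightarrow> \<tau>" "(\<lambda>n. e (k n)) \<longlonglongrightarrow> E" "(\<lambda>n. m (k n)) \<longlonglongrightarrow> M"
    using tendsto_fst[OF lim] tendsto_fst[OF tendsto_snd[OF lim]] tendsto_snd[OF tendsto_snd[OF lim]] by simp_all
  ultimately show thesis by (rule that[OF x(2)])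
qed

text \<open>The transfers lie in a compact set and converge along a subsequence. The target need only be
  approached, which is what penalisation provides.\<close>

lemma ctrl_act_limit:
  assumes c: "\<And>n :: nat. ctrl (t n) (e n) (m n)" "\<And>n. t n \<le> K" and u: "u \<longlonglongrightarrow> a" "a \<noteq> 0" and v: "v \<noteq> 0"
    and chord: "(\<lambda>n. chord (m n *v u n) v) \<longlonglongrightarrow> 0"
  obtains k \<tau> E M where "strict_mono (k :: nat \<Rightarrow> nat)" "(\<lambda>n. t (k n)) \<longlonglongrightarrow> \<tau>" "ctrl \<tau> E M" "act M (proj a) = proj v"
proof -
  obtain k \<tau> E M where k: "strict_mono (k :: nat \<Rightarrow> nat)" "ctrl \<tau> E M"
    "(\<lambda>n. t (k n)) \<longlonglongrightarrow> \<tau>" "(\<lambda>n. e (k n)) \<longlonglongrightarrow> E" "(\<lambda>n. m (k n)) \<longlonglongrightarrow> M"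
    by (rule ctrl_subsequence[OF c]) (rule that)
  note sub = LIMSEQ_subseq_LIMSEQ[OF _ k(1), unfolded o_def]
  have Ma: "M *v a \<noteq> 0" using ctrl_estimate(4)[OF k(2)] u(2) by (rule matvec_nonzero)
  have "isCont (\<lambda>y. chord y v) (M *v a)" by (intro isCont_chord continuous_intros Ma v)
  moreover have "(\<lambda>n. m (k n) *v u (k n)) \<longlonglongrightarrow> M *v a" by (intro tendsto_matvec k sub u)
  ultimately have "(\<lambda>n. chord (m (k n) *v u (k n)) v) \<longlonglongrightarrow> chord (M *v a) v"
    by (rule isCont_tendsto_compose)
  then have "chord (M *v a) v = 0" using sub[OF chord] LIMSEQ_unique by blast
  then have "act M (proj a) = proj v" using Ma v u(2) by (simp add: act_proj chord_eq_0_iff)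
  then show thesis using that k by blast
qed

text \<open>If the time \<open>h\<close> falls into the last piece, that piece is divided by \<open>flow_add\<close>.\<close>

lemma reach_split:
  assumes "reach \<tau> E M" "0 \<le> h" "h \<le> \<tau>"
  shows "\<exists>E1 N1 E2 N2. reach h E1 N1 \<and> reach (\<tau> - h) E2 N2 \<and> E = E1 + E2 \<and> M = N2 ** N1"
  using assms
proof (induction rule: reach.induct)
  case reach_0
  then have "h = 0" by simp
  then show ?case using reach.reach_0 by (intro exI[of _ 0] exI[of _ "mat 1"]) simp
next
  case (reach_step \<tau> E M t e)
  show ?case
  proof (cases "h \<le> \<tau>")
    case True
    with reach_step obtain E1 N1 E2 N2 where *: "reach h E1 N1" "reach (\<tau> - h) E2 N2" "E = E1 + E2" "M = N2 ** N1"
      by blast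
    have "reach ((\<tau> - h) + t) (E2 + t * e) (flow e t ** N2)"
      using * reach_step by (intro reach.reach_step) auto
    then show ?thesis using *
      by (intro exI[of _ E1] exI[of _ N1] exI[of _ "E2 + t * e"] exI[of _ "flow e t ** N2"])
        (simp add: matrix_mul_assoc algebra_simps)
  next
    case False
    define s where "s = h - \<tau>"
    have s: "0 \<le> s" "s \<le> t" using False reach_step by (auto simp: s_def)
    have "reach (\<tau> + s) (E + s * e) (flow e s ** M)"
      using s reach_step by (intro reach.reach_step) auto
    then have 1: "reach h (E + s * e) (flow e s ** M)" by (simp add: s_def)
    have "reach (t - s) ((t - s) * e) (flow e (t - s))" using s reach_step by (intro reach_flow) auto
    then have 2: "reach (\<tau> + t - h) ((t - s) * e) (flow e (t - s))" by (simp add: s_def algebra_simps)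
    have "0 < e" using reach_step c1_pos by simp
    then have "flow e t ** M = flow e (t - s) ** (flow e s ** M)"
      using flow_add[of e "t - s" s] by (simp add: matrix_mul_assoc)
    then show ?thesis using 1 2
      by (intro exI[of _ "E + s * e"] exI[of _ "flow e s ** M"] exI[of _ "(t - s) * e"] exI[of _ "flow e (t - s)"])
        (simp add: algebra_simps)
  qed
qed

text \<open>Split approximating piecewise constant controls and pass to a limit of both parts. The approximants
  may last less than \<open>h\<close>, so they are split at the minimum of \<open>h\<close> and their duration.\<close>

lemma ctrl_split:
  assumes "ctrl \<tau> E M" "0 \<le> h" "h \<le> \<tau>"
  obtains E1 N1 E2 N2 where "ctrl h E1 N1" "ctrl (\<tau> - h) E2 N2" "E = E1 + E2" "M = N2 ** N1"
proof -
  obtain t e m where *: "\<And>n :: nat. reach (t n) (e n) (m n)" "t \<longlonglongrightarrow> \<tau>" "e \<longlonglongrightarrow> E" "m \<longlonglongrightarrow> M"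
    using ctrl_approx[OF assms(1)] by metis
  have t0: "0 \<le> t n" for n using reach_estimate[OF *(1)] by blast
  have "\<forall>n. \<exists>E1 N1 E2 N2. reach (min h (t n)) E1 N1 \<and> reach (t n - min h (t n)) E2 N2 \<and> e n = E1 + E2 \<and> m n = N2 ** N1"
    using reach_split[OF *(1)] t0 assms(2) by simp
  then obtain e1 m1 e2 m2 where r: "\<And>n. reach (min h (t n)) (e1 n) (m1 n)"
    "\<And>n. reach (t n - min h (t n)) (e2 n) (m2 n)" "\<And>n. e n = e1 n + e2 n" "\<And>n. m n = m2 n ** m1 n"
    by metis
  \<comment> \<open>a bound for all durations, needed for the compactness of both sequences of parts\<close>
  have "Bseq t" by (rule convergent_imp_Bseq[OF convergentI[OF *(2)]])
  then obtain K where "\<And>n. norm (t n) \<le> K" by (elim BseqE) blast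
  then have K: "t n \<le> K" for n using abs_le_D1 by (metis real_norm_def)
  obtain k \<tau>1 E1 N1 where k: "strict_mono (k :: nat \<Rightarrow> nat)" "ctrl \<tau>1 E1 N1"
    "(\<lambda>n. min h (t (k n))) \<longlonglongrightarrow> \<tau>1" "(\<lambda>n. e1 (k n)) \<longlonglongrightarrow> E1" "(\<lambda>n. m1 (k n)) \<longlonglongrightarrow> N1"
    by (rule ctrl_subsequence[of "\<lambda>n. min h (t n)" e1 m1 K, OF reach_imp_ctrl[OF r(1)] min.coboundedI2[OF K]])
  have K2: "t n - min h (t n) \<le> K" for n using K[of n] t0[of n] assms(2) by (auto simp: min_def)
  obtain j \<tau>2 E2 N2 where j: "strict_mono (j :: nat \<Rightarrow> nat)" "ctrl \<tau>2 E2 N2"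
    "(\<lambda>n. t (k (j n)) - min h (t (k (j n)))) \<longlonglongrightarrow> \<tau>2" "(\<lambda>n. e2 (k (j n))) \<longlonglongrightarrow> E2" "(\<lambda>n. m2 (k (j n))) \<longlonglongrightarrow> N2"
    by (rule ctrl_subsequence[of "\<lambda>n. t (k n) - min h (t (k n))" "\<lambda>n. e2 (k n)" "\<lambda>n. m2 (k n)" K,
          OF reach_imp_ctrl[OF r(2)] K2])
  have kj: "strict_mono (\<lambda>n. k (j n))" using k(1) j(1) by (simp add: strict_mono_def)
  note sub = LIMSEQ_subseq_LIMSEQ[OF _ kj, unfolded o_def]
  note subj = LIMSEQ_subseq_LIMSEQ[OF _ j(1), unfolded o_def]
  have "(\<lambda>n. min h (t (k (j n)))) \<longlonglongrightarrow> min h \<tau>" by (intro tendsto_intros sub *)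
  then have 1: "\<tau>1 = h" using subj[OF k(3)] assms(3) LIMSEQ_unique by fastforce
  have "(\<lambda>n. t (k (j n)) - min h (t (k (j n)))) \<longlonglongrightarrow> \<tau> - min h \<tau>" by (intro tendsto_intros sub *)
  then have 2: "\<tau>2 = \<tau> - h" using j(3) assms(3) LIMSEQ_unique by fastforce
  have "(\<lambda>n. e (k (j n))) \<longlonglongrightarrow> E1 + E2" unfolding r(3) by (intro tendsto_add subj[OF k(4)] j)
  then have 3: "E = E1 + E2" using sub[OF *(3)] LIMSEQ_unique by blast
  have "(\<lambda>n. m (k (j n))) \<longlonglongrightarrow> N2 ** N1" unfolding r(4) by (intro tendsto_matmul subj[OF k(5)] j)
  then have 4: "M = N2 ** N1" using sub[OF *(4)] LIMSEQ_unique by blast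
  show thesis using that[of E1 N1 E2 N2] k(2) j(2) 1 2 3 4 by simp
qed

lemma ctrl_0_imp:
  assumes "ctrl 0 E M"
  shows "M = mat 1"
proof -
  have "mnorm (M - mat 1) \<le> 0" using ctrl_mnorm_le(1)[OF assms] by simp
  then have "norm (M - mat 1) \<le> 0" using norm_le_mnorm[of "M - mat 1"] by linarith
  then show ?thesis by simp
qed

end

section \<open>The hitting time\<close>

context control
begin

definition hit_time :: "sphere \<Rightarrow> sphere \<Rightarrow> ereal" where
  "hit_time x y = Inf {ereal \<tau> | \<tau>. \<exists>E M. ctrl \<tau> E M \<and> act M x = y}"

lemma hit_time_le: "ctrl \<tau> E M \<Longrightarrow> act M x = y \<Longrightarrow> hit_time x y \<le> ereal \<tau>"
  unfolding hit_time_def by (rule Inf_lower) blast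

lemma hit_time_nonneg: "0 \<le> hit_time x y"
  unfolding hit_time_def by (rule Inf_greatest) (auto dest: ctrl_estimate(1))

lemma hit_time_self: "hit_time y y = 0"
  using hit_time_le[OF ctrl_0, of y y] hit_time_nonneg[of y y] by (simp add: zero_ereal_def antisym)

lemma hit_time_attained:
  assumes "hit_time x y \<le> ereal K"
  obtains \<tau> E M where "ctrl \<tau> E M" "act M x = y" "hit_time x y = ereal \<tau>"
proof -
  obtain h where h: "hit_time x y = ereal h"
    using assms hit_time_nonneg[of x y] by (cases "hit_time x y") auto
  have near: "\<exists>t e m. ctrl t e m \<and> act m x = y \<and> t < h + \<delta>" if "0 < \<delta>" for \<delta>
  proof -
    have "hit_time x y < ereal (h + \<delta>)" using h that by simp
    then obtain \<tau> E M where "ctrl \<tau> E M" "act M x = y" "ereal \<tau> < ereal (h + \<delta>)"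
      unfolding hit_time_def Inf_less_iff by blast
    then show ?thesis by (intro exI[of _ \<tau>] exI[of _ E] exI[of _ M]) simp
  qed
  have "\<exists>t e m. ctrl t e m \<and> act m x = y \<and> t < h + inverse (real (Suc n))" for n
    by (rule near) simp
  then obtain t e m where c: "\<And>n. ctrl (t n) (e n) (m n)" "\<And>n. act (m n) x = y" "\<And>n. t n < h + inverse (real (Suc n))"
    by metis
  have inv1: "inverse (real (Suc n)) \<le> 1" for n by (simp add: inverse_le_1_iff)
  have t1: "t n \<le> h + 1" for n using c(3)[of n] inv1[of n] by linarith
  have "chord (m n *v lift x) (lift y) = 0" for n
    using c(2)[of n] matvec_nonzero[OF ctrl_estimate(4)[OF c(1)[of n]], of "lift x"]
    by (simp add: chord_eq_0_iff act_def)
  then have lim: "(\<lambda>n. chord (m n *v lift x) (lift y)) \<longlonglongrightarrow> 0" by simp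
  obtain k \<tau> E M where k: "strict_mono (k :: nat \<Rightarrow> nat)" "(\<lambda>n. t (k n)) \<longlonglongrightarrow> \<tau>" "ctrl \<tau> E M" "act M (proj (lift x)) = proj (lift y)"
    by (rule ctrl_act_limit[OF c(1) t1 tendsto_const lift_nonzero lift_nonzero lim]) (rule that)
  have lim_k: "(\<lambda>n. h + inverse (real (Suc (k n)))) \<longlonglongrightarrow> h + 0"
    using LIMSEQ_subseq_LIMSEQ[OF LIMSEQ_inverse_real_of_nat k(1)] by (intro tendsto_intros) (simp add: o_def)
  have "\<tau> \<le> h + 0" by (rule tendsto_le[OF trivial_limit_sequentially lim_k k(2)]) (intro always_eventually allI less_imp_le c(3))
  moreover have "ereal h \<le> ereal \<tau>" using hit_time_le[OF k(3), of x y] k(4) h by simp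
  ultimately show thesis using that[OF k(3)] k(4) h by auto
qed

text \<open>The sublevel sets are closed: by \<open>ctrl_act_limit\<close> optimal transfers from a convergent sequence of
  points have a limit that is a transfer from the limit point.\<close>

lemma lower_semicontinuous_hit_time: "lower_semicontinuous (\<lambda>x. hit_time x y)"
  unfolding lower_semicontinuous_def
proof (intro allI impI)
  fix x a assume a: "a < hit_time x y"
  have "open {z. a < hit_time z y}"
    unfolding open_sphere_def chart_image_eq
  proof
    fix c
    show "open (chart_inv c -` {z. a < hit_time z y})"
    proof (cases a)
      case PInf
      then show ?thesis by simp
    next
      case MInf
      then have "{z. a < hit_time z y} = UNIV" using hit_time_nonneg[of _ y] by (auto intro: less_le_trans)
      then show ?thesis by simp
    next
      case (real K)
      have "closed {z. hit_time (chart_inv c z) y \<le> ereal K}"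
        unfolding closed_sequential_limits
      proof (intro allI impI, elim conjE)
        fix z b assume z: "\<forall>n. z n \<in> {z. hit_time (chart_inv c z) y \<le> ereal K}" "z \<longlonglongrightarrow> b"
        have "\<exists>t e m. ctrl t e m \<and> act m (chart_inv c (z n)) = y \<and> t \<le> K" for n
          using hit_time_attained[of "chart_inv c (z n)" y K] z(1) by (metis ereal_less_eq(3) mem_Collect_eq)
        then obtain t e m where *: "\<And>n. ctrl (t n) (e n) (m n)" "\<And>n. act (m n) (chart_inv c (z n)) = y" "\<And>n. t n \<le> K"
          by metis
        have u: "(\<lambda>n. chart_lift c (z n)) \<longlonglongrightarrow> chart_lift c b"
          by (rule isCont_tendsto_compose[OF isCont_chart_lift z(2)])
        have "chord (m n *v chart_lift c (z n)) (lift y) = 0" for n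
          using *(2)[of n] matvec_nonzero[OF ctrl_estimate(4)[OF *(1)[of n]], of "chart_lift c (z n)"]
            act_proj[of "chart_lift c (z n)" "m n"]
          by (simp add: chord_eq_0_iff)
        then have lim: "(\<lambda>n. chord (m n *v chart_lift c (z n)) (lift y)) \<longlonglongrightarrow> 0" by simp
        obtain k \<tau> E M where k: "strict_mono (k :: nat \<Rightarrow> nat)" "(\<lambda>n. t (k n)) \<longlonglongrightarrow> \<tau>" "ctrl \<tau> E M" "act M (proj (chart_lift c b)) = proj (lift y)"
          by (rule ctrl_act_limit[OF *(1) *(3) u chart_lift_nonzero lift_nonzero lim]) (rule that)
        have "\<tau> \<le> K" by (rule tendsto_upperbound[OF k(2)]) (use *(3) in auto)
        then show "b \<in> {z. hit_time (chart_inv c z) y \<le> ereal K}"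
          using hit_time_le[OF k(3), of "chart_inv c b" y] k(4) by (auto intro: order_trans)
      qed
      moreover have "chart_inv c -` {z. a < hit_time z y} = - {z. hit_time (chart_inv c z) y \<le> ereal K}"
        using real by (auto simp: not_le)
      ultimately show ?thesis by (simp add: open_Compl)
    qed
  qed
  then show "\<forall>\<^sub>F z in nhds x. a < hit_time z y"
    using a by (auto simp: eventually_nhds)
qed

end

section \<open>The Hamiltonian along constant controls\<close>

lemma has_vector_derivative_vector2:
  fixes f g :: "real \<Rightarrow> complex"
  assumes "(f has_vector_derivative f') F" "(g has_vector_derivative g') F"
  shows "((\<lambda>h. vector [f h, g h] :: complex^2) has_vector_derivative vector [f', g']) F"
proof -
  have lin: "bounded_linear (\<lambda>a. vector [a, 0] :: complex^2)" "bounded_linear (\<lambda>a. vector [0, a] :: complex^2)"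
    by (auto intro!: linearI simp: linear_conv_bounded_linear[symmetric] vec2_eq_iff)
  have eq: "(vector [a, b] :: complex^2) = vector [a, 0] + vector [0, b]" for a b
    by (simp add: vec2_eq_iff)
  have "((\<lambda>h. (vector [f h, 0] :: complex^2) + vector [0, g h]) has_vector_derivative vector [f', 0] + vector [0, g']) F"
    by (intro has_vector_derivative_add bounded_linear.has_vector_derivative[OF lin(1)]
        bounded_linear.has_vector_derivative[OF lin(2)] assms)
  then show ?thesis by (simp only: eq[symmetric])
qed

context control
begin

lemma has_vector_derivative_flow_0:
  assumes "0 < e"
  shows "((\<lambda>h. flow e h *v u) has_vector_derivative gen e *v u) (at 0)"
proof -
  define s where "s = sqrt e"
  have s: "0 < s" "s * s = e" using assms by (auto simp: s_def)
  have e: "complex_of_real e = of_real s * of_real s" using s(2) by (metis of_real_mult)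
  have c: "((\<lambda>h. cos (\<kappa> * of_real s * of_real h)) has_vector_derivative 0) (at 0)"
    and sn: "((\<lambda>h. sin (\<kappa> * of_real s * of_real h)) has_vector_derivative \<kappa> * of_real s) (at 0)"
  proof -
    have lin: "((\<lambda>h. \<kappa> * of_real s * of_real h) has_vector_derivative \<kappa> * of_real s) (at 0)"
      unfolding has_vector_derivative_def
      by (rule has_derivative_eq_rhs[OF bounded_linear_imp_has_derivative[OF
            bounded_linear_compose[OF bounded_linear_mult_right bounded_linear_of_real]]])
        (auto simp: scaleR_conv_of_real)
    have "(cos has_field_derivative 0) (at (\<kappa> * of_real s * of_real 0))"
      "(sin has_field_derivative 1) (at (\<kappa> * of_real s * of_real 0))"
      by (auto intro!: derivative_eq_intros)
    from field_vector_diff_chain_at[OF lin this(1)] field_vector_diff_chain_at[OF lin this(2)]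
    show "((\<lambda>h. cos (\<kappa> * of_real s * of_real h)) has_vector_derivative 0) (at 0)"
      "((\<lambda>h. sin (\<kappa> * of_real s * of_real h)) has_vector_derivative \<kappa> * of_real s) (at 0)"
      by (simp_all add: o_def)
  qed
  have mult: "((\<lambda>h. a * f h) has_vector_derivative a * f') (at 0)"
    if "(f has_vector_derivative f') (at 0)" for f :: "real \<Rightarrow> complex" and a f'
    using that by (rule bounded_linear.has_vector_derivative[OF bounded_linear_mult_right])
  have "((\<lambda>h. vector [u $ 1 * cos (\<kappa> * of_real s * of_real h) + (\<i> * of_real s * u $ 2) * sin (\<kappa> * of_real s * of_real h),
      (\<i> / of_real s * u $ 1) * sin (\<kappa> * of_real s * of_real h) + u $ 2 * cos (\<kappa> * of_real s * of_real h)] :: complex^2)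
    has_vector_derivative vector [u $ 1 * 0 + (\<i> * of_real s * u $ 2) * (\<kappa> * of_real s),
      (\<i> / of_real s * u $ 1) * (\<kappa> * of_real s) + u $ 2 * 0]) (at 0)"
    by (intro has_vector_derivative_vector2 has_vector_derivative_add mult c sn)
  moreover have "vector [u $ 1 * 0 + (\<i> * of_real s * u $ 2) * (\<kappa> * of_real s),
      (\<i> / of_real s * u $ 1) * (\<kappa> * of_real s) + u $ 2 * 0] = gen e *v u"
    using s(1) by (simp add: vec2_eq_iff matvec_component e)
  moreover have "(\<lambda>h. vector [u $ 1 * cos (\<kappa> * of_real s * of_real h) + (\<i> * of_real s * u $ 2) * sin (\<kappa> * of_real s * of_real h),
      (\<i> / of_real s * u $ 1) * sin (\<kappa> * of_real s * of_real h) + u $ 2 * cos (\<kappa> * of_real s * of_real h)])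
     = (\<lambda>h. flow e h *v u)"
    by (simp add: fun_eq_iff vec2_eq_iff matvec_component flow_component s_def mult_ac)
  ultimately show ?thesis by simp
qed

text \<open>The linear system projects to the Riccati equation, in either chart.\<close>

lemma chart_quot_deriv_gen:
  "chart_quot_deriv c z (gen e *v chart_lift c z) = chart_field \<kappa> c z e"
  by (cases c) (simp_all add: matvec_component algebra_simps power2_eq_square)

lemma has_real_derivative_along_flow:
  assumes "is_differential m x l" "x \<in> chart_dom c" "0 < e"
  shows "((\<lambda>h. m (act (flow e h) x)) has_real_derivative
     blinfun_apply (l c) (chart_field \<kappa> c (chart_map c x) e)) (at 0)"
proof -
  let ?u = "chart_lift c (chart_map c x)"
  have "((\<lambda>h. flow e h *v ?u) has_derivative (\<lambda>h. h *\<^sub>R (gen e *v ?u))) (at 0)"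
    using has_vector_derivative_flow_0[OF assms(3), of ?u] by (simp add: has_vector_derivative_def)
  moreover have "((\<lambda>u. m (proj u)) has_derivative (\<lambda>\<xi>. blinfun_apply (l c) (chart_quot_deriv c (chart_map c x) \<xi>)))
     (at (flow e 0 *v ?u))"
    using has_derivative_comp_proj[OF assms(1,2)] by simp
  ultimately have "((\<lambda>u. m (proj u)) \<circ> (\<lambda>h. flow e h *v ?u) has_derivative
     (\<lambda>\<xi>. blinfun_apply (l c) (chart_quot_deriv c (chart_map c x) \<xi>)) \<circ> (\<lambda>h. h *\<^sub>R (gen e *v ?u))) (at 0)"
    by (rule diff_chain_at)
  moreover have "chart_quot_deriv c (chart_map c x) (h *\<^sub>R (gen e *v ?u)) = h *\<^sub>R chart_field \<kappa> c (chart_map c x) e" for h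
  proof -
    have "chart_quot_deriv c z (h *\<^sub>R \<xi>) = h *\<^sub>R chart_quot_deriv c z \<xi>" for z \<xi>
      by (cases c) (simp_all only: chart_quot_deriv.simps vector_scaleR_component, simp_all add: scaleR_conv_of_real algebra_simps)
    then show ?thesis by (simp add: chart_quot_deriv_gen)
  qed
  moreover have "m (proj (flow e h *v ?u)) = m (act (flow e h) x)" for h
    using act_proj[of ?u "flow e h"] assms(2) by simp
  ultimately show ?thesis
    by (simp add: o_def has_field_derivative_def blinfun.scaleR_right mult_commute_abs)
qed

lemma tendsto_flow:
  assumes "(f \<longlongrightarrow> a) F"
  shows "((\<lambda>h. flow e (f h)) \<longlongrightarrow> flow e a) F"
proof (intro vec_tendstoI)
  fix i j :: 2
  have s: "((\<lambda>h. b * sin (\<kappa> * of_real (sqrt e) * of_real (f h))) \<longlongrightarrow> b * sin (\<kappa> * of_real (sqrt e) * of_real a)) F" for b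
    by (intro tendsto_mult_left isCont_tendsto_compose[OF isCont_sin] tendsto_of_real assms)
  have c: "((\<lambda>h. cos (\<kappa> * of_real (sqrt e) * of_real (f h))) \<longlongrightarrow> cos (\<kappa> * of_real (sqrt e) * of_real a)) F"
    by (intro tendsto_mult_left isCont_tendsto_compose[OF isCont_cos] tendsto_of_real assms)
  show "((\<lambda>h. flow e (f h) $ i $ j) \<longlongrightarrow> flow e a $ i $ j) F"
    using exhaust_2[of i] exhaust_2[of j]
    by (elim disjE) (simp_all only: flow_component s c)
qed

lemma isCont_flow_matvec: "isCont (\<lambda>p. flow e (fst p) *v snd p) p"
  unfolding isCont_def by (intro tendsto_matvec tendsto_flow tendsto_intros)

end

locale riccati =
  fixes \<kappa> :: complex and n1 n2 :: real
  assumes n1_pos: "0 < n1" and n1_less_n2: "n1 < n2"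

sublocale riccati \<subseteq> control \<kappa> "n1\<^sup>2" "n2\<^sup>2"
  using n1_pos n1_less_n2 by unfold_locales (auto intro: power_strict_mono)

context riccati
begin

lemma sq_bounds: "0 < n1\<^sup>2" "n1\<^sup>2 \<le> n2\<^sup>2"
  using c1_pos c1_less_c2 by auto

text \<open>The control enters the vector field linearly, so no chart computation is needed for the
  continuity in \<open>e\<close> that the Hamiltonian requires.\<close>

lemma slope_affine:
  fixes L :: "complex \<Rightarrow>\<^sub>L real"
  shows "\<exists>a b. \<forall>e. blinfun_apply L (chart_field \<kappa> c z e) = a + b * e"
proof -
  have "\<exists>A B. \<forall>e. chart_field \<kappa> c z e = A + e *\<^sub>R B"
  proof (cases c)
    case Chart1
    then show ?thesis
      by (intro exI[of _ "\<i> * \<kappa> * (- (z\<^sup>2))"] exI[of _ "\<i> * \<kappa>"])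
        (simp add: scaleR_conv_of_real algebra_simps)
  next
    case Chart2
    then show ?thesis
      by (intro exI[of _ "\<i> * \<kappa> * (- 1)"] exI[of _ "\<i> * \<kappa> * z\<^sup>2"])
        (simp add: scaleR_conv_of_real algebra_simps)
  qed
  then obtain A B where "\<And>e. chart_field \<kappa> c z e = A + e *\<^sub>R B" by blast
  then have "\<forall>e. blinfun_apply L (chart_field \<kappa> c z e) = blinfun_apply L A + blinfun_apply L B * e"
    by (simp add: blinfun.add_right blinfun.scaleR_right mult.commute)
  then show ?thesis by blast
qed

lemma slope_continuous:
  fixes L :: "complex \<Rightarrow>\<^sub>L real"
  shows "continuous_on S (\<lambda>e. - blinfun_apply L (chart_field \<kappa> c z e))"
proof -
  obtain a b where "\<And>e. blinfun_apply L (chart_field \<kappa> c z e) = a + b * e" using slope_affine by metis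
  then have "(\<lambda>e. - blinfun_apply L (chart_field \<kappa> c z e)) = (\<lambda>e. - (a + b * e))" by simp
  then show ?thesis by (simp only:) (intro continuous_intros)
qed

lemma hamiltonian_eq_SUP:
  assumes l: "l \<in> cotangent_space x" and x: "x \<in> chart_dom c"
  shows "hamiltonian n1 n2 \<kappa> x (\<lambda>c. - l c) =
    (SUP e\<in>{n1\<^sup>2..n2\<^sup>2}. - blinfun_apply (l c) (chart_field \<kappa> c (chart_map c x) e))"
proof -
  have ml: "(\<lambda>c. - l c) \<in> cotangent_space x"
    using l unfolding cotangent_space_def by (simp add: uminus_blinfun.rep_eq)
  have pair: "pairing x v (\<lambda>c. - l c) = - blinfun_apply (l c) (v c)" if "v \<in> tangent_space x" for v
    using pairing_chart[OF that ml x] by (simp add: uminus_blinfun.rep_eq)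
  have "(\<lambda>v. pairing x v (\<lambda>c. - l c)) ` velocities n1 n2 \<kappa> x =
     (\<lambda>e. - blinfun_apply (l c) (chart_field \<kappa> c (chart_map c x) e)) ` {n1\<^sup>2..n2\<^sup>2}"
  proof (intro equalityI subsetI)
    fix r assume "r \<in> (\<lambda>v. pairing x v (\<lambda>c. - l c)) ` velocities n1 n2 \<kappa> x"
    then obtain v e where "v \<in> tangent_space x" "e \<in> {n1\<^sup>2..n2\<^sup>2}" "v c = chart_field \<kappa> c (chart_map c x) e"
      "r = pairing x v (\<lambda>c. - l c)"
      using x unfolding velocities_def by blast
    then show "r \<in> (\<lambda>e. - blinfun_apply (l c) (chart_field \<kappa> c (chart_map c x) e)) ` {n1\<^sup>2..n2\<^sup>2}"
      using pair by auto
  next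
    fix r assume "r \<in> (\<lambda>e. - blinfun_apply (l c) (chart_field \<kappa> c (chart_map c x) e)) ` {n1\<^sup>2..n2\<^sup>2}"
    then obtain e where e: "e \<in> {n1\<^sup>2..n2\<^sup>2}" "r = - blinfun_apply (l c) (chart_field \<kappa> c (chart_map c x) e)" by blast
    define v where "v = (\<lambda>c. if x \<in> chart_dom c then chart_field \<kappa> c (chart_map c x) e else 0)"
    have v: "v \<in> tangent_space x" unfolding v_def by (rule chart_field_tangent)
    then have "v \<in> velocities n1 n2 \<kappa> x" using e(1) unfolding velocities_def v_def by auto
    moreover have "r = pairing x v (\<lambda>c. - l c)" using pair[OF v] e(2) x by (simp add: v_def)
    ultimately show "r \<in> (\<lambda>v. pairing x v (\<lambda>c. - l c)) ` velocities n1 n2 \<kappa> x" by blast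
  qed
  then show ?thesis unfolding hamiltonian_def by simp
qed

lemma hamiltonian_le_iff:
  assumes "l \<in> cotangent_space x" "x \<in> chart_dom c"
  shows "hamiltonian n1 n2 \<kappa> x (\<lambda>c. - l c) \<le> 1 \<longleftrightarrow>
     (\<forall>e\<in>{n1\<^sup>2..n2\<^sup>2}. - 1 \<le> blinfun_apply (l c) (chart_field \<kappa> c (chart_map c x) e))"
  unfolding hamiltonian_eq_SUP[OF assms]
  using sq_bounds bdd_above_continuous_image[OF slope_continuous]
  by (subst cSUP_le_iff) (auto simp: minus_le_iff)

text \<open>The supremum is attained, because the slope depends continuously on \<open>e\<close>.\<close>

lemma hamiltonian_ge_iff:
  assumes "l \<in> cotangent_space x" "x \<in> chart_dom c"
  shows "1 \<le> hamiltonian n1 n2 \<kappa> x (\<lambda>c. - l c) \<longleftrightarrow>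
     (\<exists>e\<in>{n1\<^sup>2..n2\<^sup>2}. blinfun_apply (l c) (chart_field \<kappa> c (chart_map c x) e) \<le> - 1)"
  unfolding hamiltonian_eq_SUP[OF assms]
proof
  let ?g = "\<lambda>e. - blinfun_apply (l c) (chart_field \<kappa> c (chart_map c x) e)"
  assume le: "1 \<le> (SUP e\<in>{n1\<^sup>2..n2\<^sup>2}. ?g e)"
  obtain e where e: "e \<in> {n1\<^sup>2..n2\<^sup>2}" "\<And>e'. e' \<in> {n1\<^sup>2..n2\<^sup>2} \<Longrightarrow> ?g e' \<le> ?g e"
    using continuous_attains_sup[OF compact_Icc _ slope_continuous, of "n1\<^sup>2" "n2\<^sup>2" "l c" c "chart_map c x"]
      sq_bounds by auto
  have "(SUP e\<in>{n1\<^sup>2..n2\<^sup>2}. ?g e) \<le> ?g e" by (rule cSUP_least) (use e sq_bounds in auto)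
  then show "\<exists>e\<in>{n1\<^sup>2..n2\<^sup>2}. blinfun_apply (l c) (chart_field \<kappa> c (chart_map c x) e) \<le> - 1"
    using le e(1) by (intro bexI[of _ e]) auto
next
  let ?g = "\<lambda>e. - blinfun_apply (l c) (chart_field \<kappa> c (chart_map c x) e)"
  assume "\<exists>e\<in>{n1\<^sup>2..n2\<^sup>2}. blinfun_apply (l c) (chart_field \<kappa> c (chart_map c x) e) \<le> - 1"
  then obtain e where e: "e \<in> {n1\<^sup>2..n2\<^sup>2}" "1 \<le> ?g e" by auto
  have "?g e \<le> (SUP e\<in>{n1\<^sup>2..n2\<^sup>2}. ?g e)"
    by (rule cSUP_upper[OF e(1) bdd_above_continuous_image[OF slope_continuous]])
  then show "1 \<le> (SUP e\<in>{n1\<^sup>2..n2\<^sup>2}. ?g e)" using e(2) by linarith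
qed

lemma proximal_solution_slope_ge:
  assumes sol: "proximal_solution n1 n2 \<kappa> \<eta> V" and l: "l \<in> proximal_subdifferential V x"
    and c: "x \<in> chart_dom c" and e: "e \<in> {n1\<^sup>2..n2\<^sup>2}"
  shows "- 1 \<le> blinfun_apply (l c) (chart_field \<kappa> c (chart_map c x) e)"
proof -
  have "l \<in> cotangent_space x" using l by (simp add: proximal_subdifferential_def)
  moreover have "hamiltonian n1 n2 \<kappa> x (\<lambda>c. - l c) \<le> 1"
    using sol l unfolding proximal_solution_def by (cases "x = \<eta>") force+
  ultimately show ?thesis using hamiltonian_le_iff c e by blast
qed

lemma proximal_solution_slope_le:
  assumes sol: "proximal_solution n1 n2 \<kappa> \<eta> V" and l: "l \<in> proximal_subdifferential V x"
    and c: "x \<in> chart_dom c" and "x \<noteq> \<eta>"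
  obtains e where "e \<in> {n1\<^sup>2..n2\<^sup>2}" "blinfun_apply (l c) (chart_field \<kappa> c (chart_map c x) e) \<le> - 1"
proof -
  have "l \<in> cotangent_space x" using l by (simp add: proximal_subdifferential_def)
  moreover have "1 \<le> hamiltonian n1 n2 \<kappa> x (\<lambda>c. - l c)"
    using sol l \<open>x \<noteq> \<eta>\<close> unfolding proximal_solution_def by force
  ultimately show ?thesis using hamiltonian_ge_iff c that by blast
qed

end

section \<open>Proximal solutions lie below the hitting time\<close>

context riccati
begin

text \<open>Suppose that \<open>V\<close> exceeds the bound at the starting point of the transfer to \<open>y\<close>. Over times
  \<open>s\<close> in \<open>{0..a}\<close> and unit vectors \<open>u\<close> minimise
  \<open>V (proj u) - (1 + \<delta>) * s + n * chord (flow e s *v u) v\<close>, where \<open>v\<close> represents \<open>y\<close>. For large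
  \<open>n\<close> the penalty keeps the minimum away from \<open>s = a\<close>. Because it is transported by the flow,
  moving \<open>u\<close> along the flow and increasing \<open>s\<close> have the same effect on it: optimality in \<open>u\<close>
  yields a proximal subgradient, whose slope along the flow is at least \<open>- 1\<close> by the equation,
  while optimality in \<open>s\<close> bounds the same slope by \<open>- (1 + \<delta>)\<close>.\<close>

lemma proximal_solution_flow_increase_slack:
  assumes sol: "proximal_solution n1 n2 \<kappa> \<eta> V"
    and e: "e \<in> {n1\<^sup>2..n2\<^sup>2}" and a: "0 \<le> a" and \<delta>: "0 < \<delta>" and y: "V y = ereal r"
  shows "V (act (flow e (- a)) y) \<le> ereal (r + (1 + \<delta>) * a)"
proof (rule ccontr)
  assume "\<not> ?thesis"
  then have gt: "ereal (r + (1 + \<delta>) * a) < V (act (flow e (- a)) y)" by simp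
  then have "a \<noteq> 0" using y by auto
  then have a_pos: "0 < a" using a by simp
  have e0: "0 < e" using e sq_bounds(1) by (meson atLeastAtMost_iff less_le_trans)
  have lsc: "lower_semicontinuous V" and noninf: "\<And>x. V x \<noteq> - \<infinity>"
    using sol unfolding proximal_solution_def by auto
  obtain B where B: "\<And>x. ereal B \<le> V x" using lsc_bounded_below[OF lsc noninf] by blast
  define v where "v = lift y"
  have v0: "v \<noteq> 0" by (simp add: v_def)
  have lsc_proj: "lsc_at (\<lambda>u. V (proj u)) u" if "u \<noteq> 0" for u
    using lsc that by (intro lsc_at_compose[of V proj] isCont_proj) (auto simp: lower_semicontinuous_iff_lsc_at)
  \<comment> \<open>candidates with small \<open>V\<close>; none of them is carried to \<open>y\<close> in time \<open>a\<close>, which gives \<open>c0\<close> below\<close>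
  define K where "K = {u \<in> sphere 0 1. V (proj u) \<le> ereal (r + (1 + \<delta>) * a)}"
  have "closed K"
    unfolding closed_def open_subopen[of "- K"]
  proof
    fix u assume u: "u \<in> - K"
    show "\<exists>T. open T \<and> u \<in> T \<and> T \<subseteq> - K"
    proof (cases "u \<in> sphere 0 1")
      case False
      then show ?thesis by (intro exI[of _ "- sphere 0 1"]) (auto simp: K_def)
    next
      case True
      then have "ereal (r + (1 + \<delta>) * a) < V (proj u)" "u \<noteq> 0" using u by (auto simp: K_def)
      then have "\<forall>\<^sub>F w in nhds u. ereal (r + (1 + \<delta>) * a) < V (proj w)"
        using lsc_proj unfolding lsc_at_def by blast
      then obtain T where "open T" "u \<in> T" "\<And>w. w \<in> T \<Longrightarrow> ereal (r + (1 + \<delta>) * a) < V (proj w)"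
        unfolding eventually_nhds by blast
      moreover have "T \<subseteq> - K"
      proof
        fix w assume "w \<in> T"
        then have "\<not> V (proj w) \<le> ereal (r + (1 + \<delta>) * a)" using calculation(3) by (simp add: not_le)
        then show "w \<in> - K" by (simp add: K_def)
      qed
      ultimately show ?thesis by blast
    qed
  qed
  have "compact K"
  proof -
    have "compact (sphere (0 :: complex^2) 1 \<inter> K)" using \<open>closed K\<close> by (intro compact_Int_closed) auto
    moreover have "sphere 0 1 \<inter> K = K" by (auto simp: K_def)
    ultimately show ?thesis by simp
  qed
  have flow_nz: "flow e s *v u \<noteq> 0" if "u \<noteq> 0" for s u
    using matvec_nonzero[OF det_flow[OF e0] that] .
  have "continuous_on K (\<lambda>u. chord (flow e a *v u) v)"
    unfolding continuous_on_def
  proof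
    fix u assume "u \<in> K"
    then have "u \<noteq> 0" by (auto simp: K_def)
    have "isCont (\<lambda>u. flow e a *v u) u"
      unfolding isCont_def by (intro tendsto_matvec tendsto_intros)
    then have "isCont (\<lambda>u. chord (flow e a *v u) v) u"
      by (intro isCont_chord continuous_const flow_nz \<open>u \<noteq> 0\<close> v0)
    then show "((\<lambda>u. chord (flow e a *v u) v) \<longlongrightarrow> chord (flow e a *v u) v) (at u within K)"
      unfolding isCont_def by (rule tendsto_within_subset) simp
  qed
  moreover have "0 < chord (flow e a *v u) v" if "u \<in> K" for u
  proof (rule ccontr)
    have u: "u \<noteq> 0" using that by (auto simp: K_def)
    assume "\<not> 0 < chord (flow e a *v u) v"
    then have "chord (flow e a *v u) v = 0" using chord_nonneg[of "flow e a *v u" v] by linarith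
    then have y: "act (flow e a) (proj u) = y"
      using u v0 flow_nz[OF u] by (simp add: chord_eq_0_iff act_proj v_def)
    then have "proj u = act (flow e (- a)) y"
      using act_adj2(1)[OF det_flow[OF e0]] unfolding flow_minus[OF e0] y[symmetric] by simp
    moreover have "V (proj u) \<le> ereal (r + (1 + \<delta>) * a)" using that by (simp add: K_def)
    ultimately show False using gt leD by simp
  qed
  ultimately obtain c0 where c0: "0 < c0" "\<And>u. u \<in> K \<Longrightarrow> c0 \<le> chord (flow e a *v u) v"
    using compact_pos_lower_bound[OF \<open>compact K\<close>] by metis
  \<comment> \<open>large enough to exclude a minimum at \<open>s = a\<close>\<close>
  obtain n0 :: nat where n0: "(r - B + (1 + \<delta>) * a) / c0 < real n0" using reals_Archimedean2 by blast
  define n where "n = real n0"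
  have n: "0 \<le> n" "r - B + (1 + \<delta>) * a < n * c0"
    using n0 c0(1) by (simp_all add: n_def pos_divide_less_eq)
  define g where "g p = - (1 + \<delta>) * fst p + n * chord (flow e (fst p) *v snd p) v" for p :: "real \<times> (complex^2)"
  define F where "F p = V (proj (snd p)) + ereal (g p)" for p
  have comp: "compact ({0..a} \<times> sphere (0 :: complex^2) 1)" by (intro compact_Times) auto
  have ne: "{0..a} \<times> sphere (0 :: complex^2) 1 \<noteq> {}"
  proof -
    obtain w where "norm w = 1" "proj w = y" by (rule unit_lift)
    then have "(0, w) \<in> {0..a} \<times> sphere (0 :: complex^2) 1" using a by simp
    then show ?thesis by blast
  qed
  have lsc_F: "lsc_at F p" if "p \<in> {0..a} \<times> sphere (0 :: complex^2) 1" for p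
    unfolding F_def
  proof (rule lsc_at_add_continuous)
    have p: "snd p \<noteq> 0" using that by auto
    show "lsc_at (\<lambda>p. V (proj (snd p))) p"
      using lsc_proj[OF p] by (rule lsc_at_compose[of "\<lambda>u. V (proj u)" snd]) (intro continuous_intros)
    show "isCont g p"
      unfolding g_def by (intro continuous_intros isCont_chord isCont_flow_matvec flow_nz p v0)
  qed
  obtain p where p: "p \<in> {0..a} \<times> sphere (0 :: complex^2) 1"
    "\<And>q. q \<in> {0..a} \<times> sphere (0 :: complex^2) 1 \<Longrightarrow> F p \<le> F q"
    by (rule lsc_attains_min[OF comp ne lsc_F], assumption) (rule that)
  obtain s u where su: "p = (s, u)" "0 \<le> s" "s \<le> a" "norm u = 1" using p(1) by auto
  have u0: "u \<noteq> 0" using su(4) by auto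
  define x where "x = proj u"
  have F_su: "F (s, u) = V x + ereal (g (s, u))" by (simp add: F_def x_def)
  obtain u1 where u1: "norm u1 = 1" "proj u1 = y" by (rule unit_lift)
  have "F p \<le> F (0, u1)" using p(2) a u1 by auto
  also have "F (0, u1) = ereal r"
  proof -
    have "u1 \<noteq> 0" using u1 by auto
    then have "chord u1 v = 0" using v0 by (simp add: chord_eq_0_iff u1 v_def)
    then show ?thesis using y by (simp add: F_def g_def u1)
  qed
  finally have F_le: "F (s, u) \<le> ereal r" by (simp add: su)
  then obtain rx where rx: "V x = ereal rx" using noninf[of x] F_su by (cases "V x") auto
  have s_less: "s < a"
  proof (rule ccontr)
    assume "\<not> s < a"
    then have s: "s = a" using su by simp
    have g: "g (s, u) = n * chord (flow e a *v u) v - (1 + \<delta>) * a"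
      by (simp add: g_def s algebra_simps)
    show False
    proof (cases "u \<in> K")
      case True
      then have "n * c0 \<le> n * chord (flow e a *v u) v" using c0 n by (intro mult_left_mono) auto
      moreover have "B \<le> rx" using B[of x] rx by simp
      ultimately have "r < rx + g (s, u)" using n unfolding g by linarith
      then show False using F_le F_su rx by simp
    next
      case False
      then have "r + (1 + \<delta>) * a < rx" using su rx by (simp add: K_def x_def)
      moreover have "0 \<le> n * chord (flow e a *v u) v" using n by simp
      ultimately have "r < rx + g (s, u)" unfolding g by linarith
      then show False using F_le F_su rx by simp
    qed
  qed
  \<comment> \<open>the test function at the minimiser\<close>
  define m where "m z = (- n) * chord (flow e s *v lift z) v" for z
  have m_proj: "m (proj w) = - n * chord (flow e s *v w) v" if "w \<noteq> 0" for w
    using that by (simp add: m_def chord_matvec_lift_proj)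
  have C2: "sphere_C2_on UNIV m"
    unfolding m_def by (rule sphere_C2_on_chord[OF det_flow[OF e0] v0])
  then obtain l where l: "is_differential m x l"
    by (rule sphere_C2_on_imp_differential) simp
  have "l \<in> proximal_subdifferential V x"
  proof (rule proximal_subdifferentialI[where V = V and x = x, OF rx C2 l])
    fix z
    obtain w where w: "norm w = 1" "proj w = z" by (rule unit_lift)
    have w0: "w \<noteq> 0" using w by auto
    have "F (s, u) \<le> F (s, w)" using p(2)[of "(s, w)"] su w by simp
    moreover have "g (s, w) = - (1 + \<delta>) * s - m z" using m_proj[OF w0] w by (simp add: g_def)
    moreover have "g (s, u) = - (1 + \<delta>) * s - m x" using m_proj[OF u0] by (simp add: g_def x_def)
    ultimately show "ereal (rx - m x) \<le> V z + ereal (- m z)"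
      using rx w(2) by (cases "V z") (auto simp: F_def x_def)
  qed
  moreover obtain c where c: "x \<in> chart_dom c" using chart_cover by blast
  ultimately have ge: "- 1 \<le> blinfun_apply (l c) (chart_field \<kappa> c (chart_map c x) e)"
    using proximal_solution_slope_ge[OF sol _ c e] by blast
  have "blinfun_apply (l c) (chart_field \<kappa> c (chart_map c x) e) \<le> - (1 + \<delta>)"
  proof (rule deriv_le_of_increment_le[OF has_real_derivative_along_flow[OF l c e0]])
    show "0 < a - s" using s_less by simp
    fix h :: real assume h: "0 < h" "h < a - s"
    have "F (s, u) \<le> F (s + h, u)" using p(2)[of "(s + h, u)"] su h by simp
    then have "g (s, u) \<le> g (s + h, u)" using rx by (simp add: F_def x_def)
    moreover have "act (flow e h) x = proj (flow e h *v u)" by (simp add: x_def act_proj u0)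
    moreover have "flow e s *v (flow e h *v u) = flow e (s + h) *v u"
      by (simp add: flow_add[OF e0] matrix_vector_mul_assoc)
    ultimately show "m (act (flow e h) x) - m (act (flow e 0) x) \<le> - (1 + \<delta>) * h"
      using m_proj[OF u0] m_proj[OF flow_nz[OF u0], of h] by (simp add: g_def x_def algebra_simps)
  qed
  then show False using ge \<delta> by simp
qed

lemma proximal_solution_flow_increase:
  assumes sol: "proximal_solution n1 n2 \<kappa> \<eta> V"
    and e: "e \<in> {n1\<^sup>2..n2\<^sup>2}" and a: "0 \<le> a" and y: "V y = ereal r"
  shows "V (act (flow e (- a)) y) \<le> ereal (r + a)"
proof (cases "a = 0")
  case True
  then show ?thesis using y by simp
next
  case False
  have noninf: "V x \<noteq> - \<infinity>" for x using sol unfolding proximal_solution_def by auto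
  have le: "V (act (flow e (- a)) y) \<le> ereal (r + (1 + \<delta>) * a)" if "0 < \<delta>" for \<delta>
    by (rule proximal_solution_flow_increase_slack[OF sol e a that y])
  obtain q where q: "V (act (flow e (- a)) y) = ereal q"
    using le[of 1] noninf[of "act (flow e (- a)) y"] by (cases "V (act (flow e (- a)) y)") auto
  have "q \<le> r + a"
  proof (rule field_le_epsilon)
    fix \<epsilon> :: real assume "0 < \<epsilon>"
    then show "q \<le> r + a + \<epsilon>"
    proof -
      have "(1 + \<epsilon> / a) * a = a + \<epsilon>" using False by (simp add: field_simps)
      moreover have "0 < \<epsilon> / a" using \<open>0 < \<epsilon>\<close> False a by simp
      ultimately show ?thesis using le[of "\<epsilon> / a"] q by simp
    qed
  qed
  then show ?thesis using q by simp
qed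

lemma proximal_solution_reach_increase:
  assumes sol: "proximal_solution n1 n2 \<kappa> \<eta> V" and "reach \<tau> E M" and "V y = ereal r"
  shows "V (act (adj2 M) y) \<le> ereal (r + \<tau>)"
  using assms(2,3)
proof (induction arbitrary: y r rule: reach.induct)
  case reach_0
  then show ?case by simp
next
  case (reach_step \<tau> E M t e)
  have noninf: "V x \<noteq> - \<infinity>" for x using sol unfolding proximal_solution_def by auto
  have e: "e \<in> {n1\<^sup>2..n2\<^sup>2}" using reach_step by simp
  have e0: "0 < e" using reach_step sq_bounds(1) by (meson less_le_trans)
  let ?y = "act (flow e (- t)) y"
  have le: "V ?y \<le> ereal (r + t)"
    by (rule proximal_solution_flow_increase[OF sol e]) (use reach_step in auto)
  then obtain r' where r': "V ?y = ereal r'" using noninf[of ?y] by (cases "V ?y") auto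
  have "V (act (adj2 M) ?y) \<le> ereal (r' + \<tau>)" using reach_step.IH[OF r'] .
  also have "\<dots> \<le> ereal (r + (\<tau> + t))" using le r' by simp
  finally show ?case
    using e0 by (simp add: adj2_mul act_mult flow_minus)
qed

text \<open>Approximate by piecewise constant controls; lower semicontinuity preserves the bound.\<close>

lemma proximal_solution_ctrl_increase:
  assumes sol: "proximal_solution n1 n2 \<kappa> \<eta> V" and c: "ctrl \<tau> E M" and y: "V y = ereal r"
  shows "V (act (adj2 M) y) \<le> ereal (r + \<tau>)"
proof (rule ccontr)
  assume "\<not> ?thesis"
  then have "ereal (r + \<tau>) < V (act (adj2 M) y)" by simp
  then obtain q where q: "ereal (r + \<tau>) < ereal q" "ereal q < V (act (adj2 M) y)"
    using ereal_dense2 by blast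
  have lsc: "lsc_at V (act (adj2 M) y)"
    using sol unfolding proximal_solution_def lower_semicontinuous_iff_lsc_at by auto
  obtain t e m where *: "\<And>n :: nat. reach (t n) (e n) (m n)" "t \<longlonglongrightarrow> \<tau>" "e \<longlonglongrightarrow> E" "m \<longlonglongrightarrow> M"
    using ctrl_approx[OF c] by metis
  have "adj2 M *v lift y \<noteq> 0" using ctrl_estimate(4)[OF c] by (intro matvec_nonzero) auto
  then have "isCont proj (adj2 M *v lift y)" by (rule isCont_proj)
  moreover have "(\<lambda>n. adj2 (m n) *v lift y) \<longlonglongrightarrow> adj2 M *v lift y"
    by (intro tendsto_matvec tendsto_adj2 * tendsto_const)
  ultimately have "(\<lambda>n. act (adj2 (m n)) y) \<longlonglongrightarrow> act (adj2 M) y"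
    unfolding act_def by (rule isCont_tendsto_compose)
  then have "\<forall>\<^sub>F n in sequentially. ereal q < V (act (adj2 (m n)) y)"
    using lsc q(2) unfolding lsc_at_def filterlim_iff by blast
  moreover have "\<forall>\<^sub>F n in sequentially. t n < q - r"
    using *(2) q(1) by (intro order_tendstoD) auto
  ultimately have "\<forall>\<^sub>F n in sequentially. False"
  proof eventually_elim
    case (elim n)
    have "V (act (adj2 (m n)) y) \<le> ereal (r + t n)"
      by (rule proximal_solution_reach_increase[OF sol *(1) y])
    also have "\<dots> < ereal q" using elim(2) by simp
    finally show ?case using elim(1) by simp
  qed
  then show False by simp
qed

lemma proximal_solution_le_hit_time:
  assumes sol: "proximal_solution n1 n2 \<kappa> \<eta> V"
  shows "V x \<le> hit_time x \<eta>"
  unfolding hit_time_def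
proof (rule Inf_greatest, clarify)
  fix \<tau> E M assume c: "ctrl \<tau> E M" "\<eta> = act M x"
  have "V \<eta> = ereal 0" using sol unfolding proximal_solution_def by (simp add: zero_ereal_def)
  from proximal_solution_ctrl_increase[OF sol c(1) this] c(2) show "V x \<le> ereal \<tau>"
    using act_adj2(1)[OF ctrl_estimate(4)[OF c(1)]] by simp
qed

end

section \<open>Penalised value functions\<close>

lemma has_real_derivative_cmod_square:
  assumes "(z has_vector_derivative z') (at t)"
  shows "((\<lambda>h. (cmod (z h))\<^sup>2) has_real_derivative 2 * Re (cnj (z t) * z')) (at t)"
proof -
  have re: "((\<lambda>h. Re (z h)) has_real_derivative Re z') (at t)"
    and im: "((\<lambda>h. Im (z h)) has_real_derivative Im z') (at t)"
    unfolding has_real_derivative_iff_has_vector_derivative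
    by (rule bounded_linear.has_vector_derivative[OF bounded_linear_Re assms],
        rule bounded_linear.has_vector_derivative[OF bounded_linear_Im assms])
  have "((\<lambda>h. (Re (z h))\<^sup>2 + (Im (z h))\<^sup>2) has_real_derivative
      (2 * Re (z t) * Re z' + 2 * Im (z t) * Im z')) (at t)"
    by (rule DERIV_cong[OF DERIV_add[OF DERIV_power[OF re, of 2] DERIV_power[OF im, of 2]]]) (simp add: algebra_simps)
  then show ?thesis by (simp add: cmod_power2 algebra_simps)
qed

context control
begin

lemma flow_component_deriv:
  assumes "0 < e"
  shows "((\<lambda>h. (flow e h *v u) $ i) has_vector_derivative (gen e *v u) $ i) (at 0)"
  by (rule bounded_linear.has_vector_derivative[OF bounded_linear_vec_nth has_vector_derivative_flow_0[OF assms]])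

text \<open>The quotient rule; for unit vectors the denominators are \<open>1\<close>.\<close>

lemma chord_deriv_left:
  assumes "0 < e" "norm u = 1" "norm w = 1"
  shows "((\<lambda>h. chord (flow e h *v u) w) has_real_derivative
     2 * Re (cnj (wedge u w) * wedge (gen e *v u) w) -
     (cmod (wedge u w))\<^sup>2 * (2 * Re (cnj (u $ 1) * (gen e *v u) $ 1) + 2 * Re (cnj (u $ 2) * (gen e *v u) $ 2))) (at 0)"
proof -
  let ?a = "\<lambda>h. flow e h *v u"
  have "((\<lambda>h. ?a h $ 1 * w $ 2 - ?a h $ 2 * w $ 1) has_vector_derivative
      ((gen e *v u) $ 1 * w $ 2 - (gen e *v u) $ 2 * w $ 1)) (at 0)"
    by (intro has_vector_derivative_diff bounded_linear.has_vector_derivative[OF bounded_linear_mult_left]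
        flow_component_deriv assms)
  from has_real_derivative_cmod_square[OF this]
  have num: "((\<lambda>h. (cmod (wedge (?a h) w))\<^sup>2) has_real_derivative
      2 * Re (cnj (wedge u w) * wedge (gen e *v u) w)) (at 0)"
    by (simp add: wedge_def)
  have den: "((\<lambda>h. (norm (?a h))\<^sup>2) has_real_derivative
      (2 * Re (cnj (u $ 1) * (gen e *v u) $ 1) + 2 * Re (cnj (u $ 2) * (gen e *v u) $ 2))) (at 0)"
    unfolding norm_vec2_power2
    using DERIV_add[OF has_real_derivative_cmod_square[OF flow_component_deriv[OF assms(1), of u 1]]
      has_real_derivative_cmod_square[OF flow_component_deriv[OF assms(1), of u 2]]] by simp
  have eq: "chord (?a h) w = (cmod (wedge (?a h) w))\<^sup>2 / (norm (?a h))\<^sup>2" for h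
    using assms by (simp add: chord_def)
  have "((\<lambda>h. (cmod (wedge (?a h) w))\<^sup>2 / (norm (?a h))\<^sup>2) has_real_derivative
     ((2 * Re (cnj (wedge u w) * wedge (gen e *v u) w)) * (norm (?a 0))\<^sup>2 -
      (cmod (wedge (?a 0) w))\<^sup>2 * (2 * Re (cnj (u $ 1) * (gen e *v u) $ 1) + 2 * Re (cnj (u $ 2) * (gen e *v u) $ 2)))
      / ((norm (?a 0))\<^sup>2 * (norm (?a 0))\<^sup>2)) (at 0)"
    by (rule DERIV_divide[OF num den]) (use assms in auto)
  then show ?thesis using assms by (simp add: eq)
qed

text \<open>Moving both points with the same control changes the chordal distance only through the norms, since
  the trace of \<open>gen e\<close> is zero and \<open>wedge\<close> is therefore invariant under the flow. Hence the rate of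
  change is at most a multiple of \<open>chord\<close> itself, which stays small after multiplication with the
  large penalty constant.\<close>

lemma chord_deriv_sum_le:
  assumes "0 < e" "norm u = 1" "norm w = 1"
  obtains p q where "((\<lambda>h. chord (flow e h *v u) w) has_real_derivative p) (at 0)"
    "((\<lambda>h. chord u (flow e h *v w)) has_real_derivative q) (at 0)"
    "p + q \<le> 4 * mnorm (gen e) * chord u w"
proof -
  define n where "n u = 2 * Re (cnj (u $ 1) * (gen e *v u) $ 1) + 2 * Re (cnj (u $ 2) * (gen e *v u) $ 2)" for u
  define p where "p = 2 * Re (cnj (wedge u w) * wedge (gen e *v u) w) - (cmod (wedge u w))\<^sup>2 * n u"
  define q where "q = 2 * Re (cnj (wedge w u) * wedge (gen e *v w) u) - (cmod (wedge w u))\<^sup>2 * n w"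
  have p: "((\<lambda>h. chord (flow e h *v u) w) has_real_derivative p) (at 0)"
    unfolding p_def n_def by (rule chord_deriv_left[OF assms])
  have "((\<lambda>h. chord (flow e h *v w) u) has_real_derivative q) (at 0)"
    unfolding q_def n_def by (rule chord_deriv_left[OF assms(1,3,2)])
  then have q: "((\<lambda>h. chord u (flow e h *v w)) has_real_derivative q) (at 0)"
    by (subst chord_commute)
  have wu: "wedge w u = - wedge u w" by (simp add: wedge_def)
  have tr: "wedge (gen e *v w) u = wedge (gen e *v u) w"
    by (simp add: wedge_def matvec_component algebra_simps)
  have "p + q = - ((cmod (wedge u w))\<^sup>2 * (n u + n w))"
    unfolding p_def q_def wu tr by (simp add: algebra_simps)
  also have "\<dots> = chord u w * (- n u + - n w)"
    using assms by (simp add: chord_def algebra_simps)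
  also have "\<dots> \<le> chord u w * (2 * mnorm (gen e) + 2 * mnorm (gen e))"
  proof (intro mult_left_mono add_mono chord_nonneg)
    have "- n u \<le> 2 * mnorm (gen e)" if "norm u = 1" for u
    proof -
      have c1: "cmod (u $ i) \<le> 1" for i using Finite_Cartesian_Product.norm_nth_le[of u i] that by simp
      have "- Re (cnj (u $ i) * (gen e *v u) $ i) \<le> cmod ((gen e *v u) $ i)" for i
      proof -
        have "- Re (cnj (u $ i) * (gen e *v u) $ i) \<le> cmod (cnj (u $ i) * (gen e *v u) $ i)"
          using abs_Re_le_cmod[of "cnj (u $ i) * (gen e *v u) $ i"] by linarith
        also have "\<dots> = cmod (u $ i) * cmod ((gen e *v u) $ i)" by (simp add: norm_mult)
        also have "\<dots> \<le> 1 * cmod ((gen e *v u) $ i)" using c1 by (intro mult_right_mono) auto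
        finally show ?thesis by simp
      qed
      from this[of 1] this[of 2]
      have 1: "- n u \<le> 2 * (cmod ((gen e *v u) $ 1) + cmod ((gen e *v u) $ 2))" by (simp add: n_def)
      have 2: "cmod ((gen e *v u) $ 1) + cmod ((gen e *v u) $ 2) \<le> mnorm (gen e)"
      proof -
        have "cmod ((gen e *v u) $ 1) = cmod (gen e $ 1 $ 2) * cmod (u $ 2)"
          "cmod ((gen e *v u) $ 2) = cmod (gen e $ 2 $ 1) * cmod (u $ 1)"
          by (simp_all add: matvec_component norm_mult)
        moreover have "cmod (gen e $ 1 $ 2) * cmod (u $ 2) \<le> cmod (gen e $ 1 $ 2) * 1"
          "cmod (gen e $ 2 $ 1) * cmod (u $ 1) \<le> cmod (gen e $ 2 $ 1) * 1"
          using c1 by (intro mult_left_mono; simp)+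
        ultimately show ?thesis unfolding mnorm_def by simp
      qed
      show ?thesis by (rule order_trans[OF 1 mult_left_mono[OF 2]]) simp
    qed
    then show "- n u \<le> 2 * mnorm (gen e)" "- n w \<le> 2 * mnorm (gen e)" using assms by auto
  qed
  also have "\<dots> = 4 * mnorm (gen e) * chord u w" by simp
  finally show thesis using that p q by blast
qed

definition controls :: "(real \<times> real \<times> (complex^2^2)) set" where
  "controls = {(\<tau>, E, M). ctrl \<tau> E M}"

definition payoff :: "real \<Rightarrow> complex^2 \<Rightarrow> complex^2 \<Rightarrow> real \<times> real \<times> (complex^2^2) \<Rightarrow> real" where
  "payoff k v w p = fst p + k * chord (snd (snd p) *v w) v"

text \<open>\<open>payoff k v w\<close> of a transfer is its duration plus \<open>k\<close> times the squared distance to the target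
  \<open>v\<close> left over when starting at \<open>w\<close>. Unlike \<open>hit_time\<close>, the infimum is finite and continuous.\<close>

definition penal :: "real \<Rightarrow> complex^2 \<Rightarrow> complex^2 \<Rightarrow> real" where
  "penal k v w = (INF p\<in>controls. payoff k v w p)"

lemma controls_0: "(0, 0, mat 1) \<in> controls"
  by (simp add: controls_def ctrl_0)

lemma payoff_nonneg: "0 \<le> k \<Longrightarrow> p \<in> controls \<Longrightarrow> 0 \<le> payoff k v w p"
  by (auto simp: controls_def payoff_def dest: ctrl_estimate(1))

lemma bdd_below_payoff: "0 \<le> k \<Longrightarrow> S \<subseteq> controls \<Longrightarrow> bdd_below (payoff k v w ` S)"
  by (rule bdd_belowI[of _ 0]) (auto intro: payoff_nonneg)

lemma penal_le: "0 \<le> k \<Longrightarrow> p \<in> controls \<Longrightarrow> penal k v w \<le> payoff k v w p"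
  unfolding penal_def by (rule cINF_lower[OF bdd_below_payoff]) auto

lemma penal_greatest: "(\<And>p. p \<in> controls \<Longrightarrow> c \<le> payoff k v w p) \<Longrightarrow> c \<le> penal k v w"
  unfolding penal_def using controls_0 by (intro cINF_greatest) auto

lemma penal_nonneg: "0 \<le> k \<Longrightarrow> 0 \<le> penal k v w"
  by (intro penal_greatest payoff_nonneg)

lemma penal_le_chord: "0 \<le> k \<Longrightarrow> penal k v w \<le> k * chord w v"
  using penal_le[OF _ controls_0, of k v w] by (simp add: payoff_def)

lemma penal_le_2k: "0 \<le> k \<Longrightarrow> penal k v w \<le> 2 * k"
proof -
  assume k: "0 \<le> k"
  have "k * chord w v \<le> k * 2" using chord_le_2 k by (rule mult_left_mono)
  then show ?thesis using penal_le_chord[OF k, of v w] by linarith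
qed

lemma penal_proj_cong:
  assumes "w \<noteq> 0" "w' \<noteq> 0" "proj w = proj w'"
  shows "penal k v w = penal k v w'"
proof -
  have "payoff k v w p = payoff k v w' p" for p
    unfolding payoff_def
    using chord_matvec_lift_proj[OF assms(1), of "snd (snd p)" v] chord_matvec_lift_proj[OF assms(2), of "snd (snd p)" v]
      assms(3) by simp
  then show ?thesis by (simp add: penal_def)
qed

lemma penal_target:
  assumes "0 \<le> k" "w \<noteq> 0" "v \<noteq> 0" "proj w = proj v"
  shows "penal k v w = 0"
proof -
  have "chord w v = 0" using assms by (simp add: chord_eq_0_iff)
  then show ?thesis
    using penal_le_chord[OF assms(1), of v w] penal_nonneg[OF assms(1), of v w] by simp
qed

text \<open>Dynamic programming: a transfer from \<open>flow e h *v w\<close> may be preceded by the control \<open>e\<close> for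
  time \<open>h\<close>.\<close>

lemma penal_flow:
  assumes "0 \<le> k" "0 \<le> h" "c1 \<le> e" "e \<le> c2"
  shows "penal k v w - h \<le> penal k v (flow e h *v w)"
proof (rule penal_greatest)
  fix p assume "p \<in> controls"
  then obtain \<tau> E M where p: "p = (\<tau>, E, M)" "ctrl \<tau> E M" by (auto simp: controls_def)
  have "ctrl (h + \<tau>) (h * e + E) (M ** flow e h)"
    by (rule ctrl_mult[OF p(2) ctrl_flow[OF assms(2-4)]])
  then have "penal k v w \<le> payoff k v w (h + \<tau>, h * e + E, M ** flow e h)"
    by (intro penal_le assms) (simp add: controls_def)
  then show "penal k v w - h \<le> payoff k v (flow e h *v w) p"
    by (simp add: payoff_def p(1) matrix_vector_mul_assoc)
qed

text \<open>Doing nothing costs at most \<open>2 * k\<close>, so longer transfers can be ignored.\<close>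

lemma penal_eq_INF_compact:
  assumes "0 \<le> k"
  shows "penal k v w = (INF p\<in>{(\<tau>, E, M). ctrl \<tau> E M \<and> \<tau> \<le> 2 * k}. payoff k v w p)"
proof (rule antisym)
  let ?C = "{(\<tau>, E, M). ctrl \<tau> E M \<and> \<tau> \<le> 2 * k}"
  have C: "?C \<subseteq> controls" by (auto simp: controls_def)
  have C0: "(0, 0, mat 1) \<in> ?C" using assms by (simp add: ctrl_0)
  show "penal k v w \<le> (INF p\<in>?C. payoff k v w p)"
  proof (rule cINF_greatest)
    show "?C \<noteq> {}" using C0 by blast
    fix p assume "p \<in> ?C"
    then show "penal k v w \<le> payoff k v w p" by (intro penal_le[OF assms] subsetD[OF C])
  qed
  show "(INF p\<in>?C. payoff k v w p) \<le> penal k v w"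
  proof (rule penal_greatest)
    fix p assume p: "p \<in> controls"
    show "(INF p\<in>?C. payoff k v w p) \<le> payoff k v w p"
    proof (cases "p \<in> ?C")
      case True
      then show ?thesis by (rule cINF_lower[OF bdd_below_payoff[OF assms C]])
    next
      case False
      then have "2 * k < fst p" using p by (auto simp: controls_def)
      have "(INF p\<in>?C. payoff k v w p) \<le> payoff k v w (0, 0, mat 1)"
        by (rule cINF_lower[OF bdd_below_payoff[OF assms C] C0])
      also have "\<dots> \<le> 2 * k" using mult_left_mono[OF chord_le_2 assms, of w v] by (simp add: payoff_def)
      also have "\<dots> \<le> payoff k v w p" using \<open>2 * k < fst p\<close> assms by (simp add: payoff_def add_increasing2)
      finally show ?thesis .
    qed
  qed
qed

lemma continuous_on_penal_sphere:
  assumes "0 \<le> k" "v \<noteq> 0"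
  shows "continuous_on (sphere 0 1) (penal k v)"
proof -
  let ?C = "{(\<tau>, E, M). ctrl \<tau> E M \<and> \<tau> \<le> 2 * k}"
  have C0: "(0, 0, mat 1) \<in> ?C" using assms by (simp add: ctrl_0)
  have mv: "continuous_on S (\<lambda>q. snd (snd (snd q)) *v fst q)"
    for S :: "((complex^2) \<times> (real \<times> real \<times> (complex^2^2))) set"
    unfolding continuous_on_def by (intro ballI tendsto_matvec tendsto_intros)
  have ne: "?C \<noteq> {}" using C0 by (rule ex_in_conv[THEN iffD1, OF exI])
  have cont: "continuous_on (sphere 0 1 \<times> ?C) (\<lambda>q. fst (snd q) + k * chord (snd (snd (snd q)) *v fst q) v)"
  proof (intro continuous_intros continuous_on_chord mv)
    fix q assume "q \<in> sphere (0 :: complex^2) 1 \<times> ?C"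
    then obtain w \<tau> E M where "q = (w, \<tau>, E, M)" "norm w = 1" "ctrl \<tau> E M" by auto
    then have "det (snd (snd (snd q))) = 1" "fst q \<noteq> 0" using ctrl_estimate(4) by force+
    then show "snd (snd (snd q)) *v fst q \<noteq> 0" by (rule matvec_nonzero)
  qed (use assms in auto)
  have "continuous_on (sphere 0 1) (\<lambda>w. INF p\<in>?C. fst (snd (w, p)) + k * chord (snd (snd (snd (w, p))) *v fst (w, p)) v)"
    by (rule continuous_on_INF_compact[OF compact_sphere compact_ctrl ne cont])
  moreover have "penal k v = (\<lambda>w. INF p\<in>?C. fst (snd (w, p)) + k * chord (snd (snd (snd (w, p))) *v fst (w, p)) v)"
    by (rule ext) (simp add: penal_eq_INF_compact[OF assms(1)] payoff_def)
  ultimately show ?thesis by (simp only:)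
qed

lemma isCont_penal:
  assumes "0 \<le> k" "v \<noteq> 0" "w \<noteq> 0"
  shows "isCont (penal k v) w"
proof -
  have normalised: "(\<lambda>w. inverse (norm w) *\<^sub>R w) ` (- {0}) \<subseteq> sphere (0 :: complex^2) 1"
  proof (rule image_subsetI)
    fix w :: "complex^2" assume "w \<in> - {0}"
    then show "inverse (norm w) *\<^sub>R w \<in> sphere 0 1" by simp
  qed
  have "continuous_on (- {0}) (\<lambda>w :: complex^2. inverse (norm w) *\<^sub>R w)"
    by (intro continuous_intros) auto
  then have "continuous_on (- {0}) (\<lambda>w. penal k v (inverse (norm w) *\<^sub>R w))"
    by (rule continuous_on_compose2[OF continuous_on_penal_sphere[OF assms(1,2)] _ normalised])
  moreover have "penal k v (inverse (norm w) *\<^sub>R w) = penal k v w" if "w \<in> - {0}" for w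
  proof (rule penal_proj_cong)
    have "inverse (norm w) *\<^sub>R w = complex_of_real (inverse (norm w)) *s w"
      unfolding vec2_eq_iff vector_scaleR_component by (simp add: scaleR_conv_of_real)
    then show "proj (inverse (norm w) *\<^sub>R w) = proj w" using that by simp
  qed (use that in auto)
  ultimately have "continuous_on (- {0}) (penal k v)"
    by (rule continuous_on_eq)
  then show ?thesis using assms(3) by (simp add: continuous_on_eq_continuous_at open_Compl)
qed

text \<open>By compactness, since \<open>chord\<close> vanishes only for pairs representing the same point, where \<open>penal\<close>
  takes equal values.\<close>

lemma penal_modulus:
  assumes k: "0 \<le> k" and v: "v \<noteq> 0" and \<epsilon>: "0 < \<epsilon>"
  obtains c where "0 < c" "\<And>u w. norm u = 1 \<Longrightarrow> norm w = 1 \<Longrightarrow> chord u w < c \<Longrightarrow> \<bar>penal k v u - penal k v w\<bar> < \<epsilon>"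
proof -
  let ?S = "sphere (0 :: complex^2) 1 \<times> sphere (0 :: complex^2) 1"
  let ?f = "\<lambda>p. \<bar>penal k v (fst p) - penal k v (snd p)\<bar>"
  have "continuous_on ?S ?f"
    by (intro continuous_intros continuous_on_compose2[OF continuous_on_penal_sphere[OF k v]]) auto
  then have "closed (?S \<inter> ?f -` {\<epsilon>..})"
    by (intro continuous_closed_preimage) (auto intro: closed_Times)
  moreover have "compact ?S" by (intro compact_Times) auto
  ultimately have "compact (?S \<inter> (?S \<inter> ?f -` {\<epsilon>..}))" by (intro compact_Int_closed)
  then have K: "compact (?S \<inter> ?f -` {\<epsilon>..})" by (simp only: Int_assoc[symmetric] Int_absorb)
  have cont: "continuous_on (?S \<inter> ?f -` {\<epsilon>..}) (\<lambda>p. chord (fst p) (snd p))"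
    by (intro continuous_on_chord continuous_intros) auto
  have pos: "0 < chord (fst p) (snd p)" if "p \<in> ?S \<inter> ?f -` {\<epsilon>..}" for p
  proof (rule ccontr)
    assume "\<not> 0 < chord (fst p) (snd p)"
    then have "chord (fst p) (snd p) = 0" using chord_nonneg[of "fst p" "snd p"] by linarith
    moreover have nz: "fst p \<noteq> 0" "snd p \<noteq> 0" using that by auto
    ultimately have "penal k v (fst p) = penal k v (snd p)"
      by (intro penal_proj_cong) (auto simp: chord_eq_0_iff)
    then show False using that \<epsilon> by auto
  qed
  obtain c where c: "0 < c" "\<And>p. p \<in> ?S \<inter> ?f -` {\<epsilon>..} \<Longrightarrow> c \<le> chord (fst p) (snd p)"
    by (rule compact_pos_lower_bound[OF K cont pos], assumption) (rule that)
  show thesis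
  proof (rule that[OF c(1)])
    fix u w :: "complex^2" assume "norm u = 1" "norm w = 1" "chord u w < c"
    then show "\<bar>penal k v u - penal k v w\<bar> < \<epsilon>"
      using c(2)[of "(u, w)"] by (auto simp: not_le[symmetric])
  qed
qed

end

section \<open>Proximal solutions lie above the hitting time\<close>

context riccati
begin

text \<open>Doubling of variables. With \<open>W\<close> for \<open>penal k\<close> and \<open>\<mu> < 1\<close>, minimise
  \<open>V (proj u) - \<mu> * W w + n * chord u w\<close> over pairs of unit vectors, where the minimum is negative
  if the claim fails. Optimality in \<open>u\<close> gives a proximal subgradient of \<open>V\<close> and, away from the
  target, a control \<open>e\<close> along which the penalty has derivative at least \<open>1\<close> in \<open>u\<close>; optimality
  in \<open>w\<close> and dynamic programming for \<open>W\<close> give derivative at least \<open>- \<mu>\<close> in \<open>w\<close> for the same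
  \<open>e\<close>. The sum \<open>1 - \<mu>\<close> is then bounded by a multiple of \<open>n * chord u w\<close>, which is as small as
  desired for large \<open>n\<close> because \<open>W\<close> is uniformly continuous. The factor \<open>\<mu>\<close> only serves to make
  the two inequalities incompatible.\<close>

lemma penal_le_proximal_solution:
  assumes sol: "proximal_solution n1 n2 \<kappa> \<eta> V" and k: "0 < k"
  shows "ereal (penal k (lift \<eta>) (lift x)) \<le> V x"
proof (rule ccontr)
  assume "\<not> ?thesis"
  then have lt: "V x < ereal (penal k (lift \<eta>) (lift x))" by simp
  have lsc: "lower_semicontinuous V" and noninf: "\<And>x. V x \<noteq> - \<infinity>"
    using sol unfolding proximal_solution_def by auto
  define v where "v = lift \<eta>"
  have v0: "v \<noteq> 0" by (simp add: v_def)
  define W where "W = penal k v"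
  have k0: "0 \<le> k" using k by simp
  obtain u0 where u0: "norm u0 = 1" "proj u0 = x" by (rule unit_lift)
  have u0_nz: "u0 \<noteq> 0" using u0 by auto
  have W_u0: "W u0 = penal k (lift \<eta>) (lift x)"
    unfolding W_def v_def by (rule penal_proj_cong) (use u0 u0_nz in auto)
  obtain r0 where r0: "V x = ereal r0" using noninf[of x] lt by (cases "V x") auto
  have W_nonneg: "0 \<le> W u" for u unfolding W_def by (rule penal_nonneg[OF k0])
  have W_le: "W u \<le> 2 * k" for u unfolding W_def by (rule penal_le_2k[OF k0])
  \<comment> \<open>\<open>\<mu>\<close> is so close to \<open>1\<close> that the diagonal value at \<open>x\<close> stays negative\<close>
  obtain \<mu> where \<mu>: "0 < \<mu>" "\<mu> < 1" "r0 < \<mu> * W u0"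
  proof (cases "W u0 = 0")
    case True
    then show ?thesis using lt r0 W_u0 by (intro that[of "1/2"]) auto
  next
    case False
    then have pos: "0 < W u0" using W_nonneg[of u0] by simp
    have "r0 / W u0 < 1" using lt r0 W_u0 pos by (simp add: divide_less_eq)
    then obtain \<mu> where "max (r0 / W u0) 0 < \<mu>" "\<mu> < 1" using dense[of "max (r0 / W u0) 0" 1] by auto
    then show ?thesis using pos by (intro that[of \<mu>]) (auto simp: divide_less_eq)
  qed
  define \<beta> where "\<beta> = \<mu> * W u0 - r0"
  have \<beta>: "0 < \<beta>" using \<mu> by (simp add: \<beta>_def)
  define \<epsilon> where "\<epsilon> = min \<beta> ((1 - \<mu>) / (4 * rate + 1))"
  have \<epsilon>: "0 < \<epsilon>" "\<epsilon> \<le> \<beta>" "4 * rate * \<epsilon> < 1 - \<mu>"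
  proof -
    show "0 < \<epsilon>" using \<beta> \<mu> rate_nonneg by (simp add: \<epsilon>_def)
    show "\<epsilon> \<le> \<beta>" by (simp add: \<epsilon>_def)
    have "\<epsilon> \<le> (1 - \<mu>) / (4 * rate + 1)" by (simp add: \<epsilon>_def)
    then have "(4 * rate + 1) * \<epsilon> \<le> 1 - \<mu>"
      using rate_nonneg by (simp add: pos_le_divide_eq mult.commute)
    then show "4 * rate * \<epsilon> < 1 - \<mu>" using \<open>0 < \<epsilon>\<close> by (simp add: algebra_simps)
  qed
  obtain c0 where c0: "0 < c0"
    "\<And>u w. norm u = 1 \<Longrightarrow> norm w = 1 \<Longrightarrow> chord u w < c0 \<Longrightarrow> \<bar>W u - W w\<bar> < \<epsilon>"
    unfolding W_def using penal_modulus[OF k0 v0 \<epsilon>(1)] by metis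
  \<comment> \<open>makes the minimiser so close to the diagonal that \<open>W\<close> varies by less than \<open>\<epsilon>\<close>\<close>
  define n where "n = 2 * k / c0 + 1"
  have n: "0 < n" "2 * k < n * c0" using k c0(1) by (auto simp: n_def field_simps intro: add_pos_pos)
  define g where "g p = - \<mu> * W (snd p) + n * chord (fst p) (snd p)" for p
  define F where "F p = V (proj (fst p)) + ereal (g p)" for p
  let ?S = "sphere (0 :: complex^2) 1 \<times> sphere (0 :: complex^2) 1"
  have comp: "compact ?S" by (intro compact_Times) auto
  have ne: "?S \<noteq> {}"
  proof -
    have "(u0, u0) \<in> ?S" using u0 by simp
    then show ?thesis by blast
  qed
  have lsc_F: "lsc_at F p" if "p \<in> ?S" for p
    unfolding F_def
  proof (rule lsc_at_add_continuous)
    have p: "fst p \<noteq> 0" "snd p \<noteq> 0" using that by auto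
    have "lsc_at (\<lambda>u. V (proj u)) (fst p)"
      using lsc p by (intro lsc_at_compose[of V proj] isCont_proj) (auto simp: lower_semicontinuous_iff_lsc_at)
    then show "lsc_at (\<lambda>p. V (proj (fst p))) p"
      by (rule lsc_at_compose[of "\<lambda>u. V (proj u)" fst]) (intro continuous_intros)
    have "isCont (\<lambda>p. W (snd p)) p"
      unfolding W_def by (rule isCont_o2[where f = snd and g = "penal k v", OF _ isCont_penal[OF k0 v0 p(2)]]) (intro continuous_intros)
    then show "isCont g p"
      unfolding g_def by (intro continuous_intros isCont_chord p)
  qed
  obtain p where p: "p \<in> ?S" "\<And>q. q \<in> ?S \<Longrightarrow> F p \<le> F q"
    by (rule lsc_attains_min[OF comp ne lsc_F], assumption) (rule that)
  obtain u w where uw: "p = (u, w)" "norm u = 1" "norm w = 1" using p(1) by auto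
  have nz: "u \<noteq> 0" "w \<noteq> 0" using uw by auto
  have F_min: "F (u, w) \<le> F (u', w')" if "u' \<noteq> 0" "w' \<noteq> 0" for u' w'
  proof -
    obtain u1 where u1: "norm u1 = 1" "proj u1 = proj u'" by (rule unit_lift)
    obtain w1 where w1: "norm w1 = 1" "proj w1 = proj w'" by (rule unit_lift)
    have nz1: "u1 \<noteq> 0" "w1 \<noteq> 0" using u1 w1 by auto
    have "chord u1 w1 = chord u' w'"
      using chord_lift_proj[OF nz1(1), of w1] chord_lift_proj[OF that(1), of w1]
        chord_lift_proj[OF nz1(2), of u'] chord_lift_proj[OF that(2), of u'] u1 w1
      by (simp add: chord_commute)
    moreover have "W w1 = W w'" unfolding W_def by (rule penal_proj_cong) (use nz1 that w1 in auto)
    ultimately have "F (u1, w1) = F (u', w')" by (simp add: F_def g_def u1)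
    then show ?thesis using p(2)[of "(u1, w1)"] uw u1 w1 by simp
  qed
  define z where "z = proj u"
  have "F (u, w) \<le> F (u0, u0)" by (rule F_min) (use u0_nz in auto)
  then have F_le: "F (u, w) \<le> ereal (- \<beta>)" using r0 u0 by (simp add: F_def g_def \<beta>_def)
  then obtain rz where rz: "V z = ereal rz" using noninf[of z] by (cases "V z") (auto simp: F_def z_def)
  have "F (u, w) \<le> F (u, u)" by (rule F_min) (use nz in auto)
  then have n_chord: "n * chord u w \<le> \<mu> * (W w - W u)"
    using rz by (simp add: F_def g_def z_def algebra_simps)
  have "\<mu> * (W w - W u) \<le> \<mu> * (2 * k)" using W_le[of w] W_nonneg[of u] \<mu> by (intro mult_left_mono) auto
  also have "\<dots> \<le> 2 * k" using \<mu> k by simp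
  finally have "n * chord u w < n * c0" using n_chord n by linarith
  then have small: "\<bar>W u - W w\<bar> < \<epsilon>" using n uw by (intro c0) auto
  have "\<mu> * (W w - W u) \<le> \<mu> * \<epsilon>" using small \<mu> by (intro mult_left_mono) auto
  also have "\<dots> \<le> \<epsilon>" using \<mu> \<epsilon> by simp
  finally have n_chord_small: "n * chord u w \<le> \<epsilon>" using n_chord by linarith
  \<comment> \<open>at the target the value would exceed \<open>- \<epsilon>\<close>\<close>
  have z_ne: "z \<noteq> \<eta>"
  proof
    assume z: "z = \<eta>"
    have "W u = 0" unfolding W_def by (rule penal_target[OF k0 nz(1) v0]) (use z in \<open>simp add: z_def v_def\<close>)
    then have "W w < \<epsilon>" using small by simp
    moreover have "\<mu> * W w \<le> W w" using \<mu> W_nonneg[of w] by (simp add: mult_left_le_one_le)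
    moreover have "0 \<le> n * chord u w" using n by simp
    moreover have "rz = 0" using sol z rz unfolding proximal_solution_def by (simp add: zero_ereal_def)
    ultimately show False using F_le \<epsilon>(2) rz by (simp add: F_def g_def z_def)
  qed
  \<comment> \<open>the test function for \<open>V\<close> at \<open>z\<close>; the identity matrix only matches the form of \<open>sphere_C2_on_chord\<close>\<close>
  define m where "m y = (- n) * chord (mat 1 *v lift y) w" for y
  have m_proj: "m (proj y) = - n * chord y w" if "y \<noteq> 0" for y
    using that by (simp add: m_def chord_lift_proj)
  have C2: "sphere_C2_on UNIV m"
    unfolding m_def by (rule sphere_C2_on_chord) (use nz in auto)
  then obtain l where l: "is_differential m z l"
    by (rule sphere_C2_on_imp_differential) simp
  have "l \<in> proximal_subdifferential V z"
  proof (rule proximal_subdifferentialI[where V = V and x = z, OF rz C2 l])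
    fix y
    have "F (u, w) \<le> F (lift y, w)" by (rule F_min) (use nz in auto)
    then show "ereal (rz - m z) \<le> V y + ereal (- m y)"
      using rz m_proj[OF nz(1)] m_proj[of "lift y"] by (cases "V y") (auto simp: F_def g_def z_def)
  qed
  moreover obtain c where c: "z \<in> chart_dom c" using chart_cover by blast
  ultimately obtain e where e: "e \<in> {n1\<^sup>2..n2\<^sup>2}"
    and slope: "blinfun_apply (l c) (chart_field \<kappa> c (chart_map c z) e) \<le> - 1"
    using proximal_solution_slope_le[OF sol _ c z_ne] by blast
  have e0: "0 < e" using e sq_bounds(1) by (meson atLeastAtMost_iff less_le_trans)
  have flow_nz: "flow e h *v y \<noteq> 0" if "y \<noteq> 0" for h y
    using matvec_nonzero[OF det_flow[OF e0] that] .
  obtain P Q where PQ: "((\<lambda>h. chord (flow e h *v u) w) has_real_derivative P) (at 0)"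
    "((\<lambda>h. chord u (flow e h *v w)) has_real_derivative Q) (at 0)"
    "P + Q \<le> 4 * mnorm (gen e) * chord u w"
    using chord_deriv_sum_le[OF e0 uw(2,3)] by metis
  have "((\<lambda>h. m (act (flow e h) z)) has_real_derivative - n * P) (at 0)"
  proof -
    have "m (act (flow e h) z) = - n * chord (flow e h *v u) w" for h
      using m_proj[OF flow_nz[OF nz(1)]] by (simp add: z_def act_proj nz)
    then show ?thesis using DERIV_cmult[OF PQ(1), of "- n"] by simp
  qed
  then have "- n * P \<le> - 1"
    using has_real_derivative_along_flow[OF l c e0] slope DERIV_unique by metis
  moreover have "- (n * Q) \<le> \<mu>"
  proof (rule deriv_le_of_increment_le)
    show "((\<lambda>h. - (n * chord u (flow e h *v w))) has_real_derivative - (n * Q)) (at 0)"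
      by (intro DERIV_minus DERIV_cmult PQ)
    fix h :: real assume h: "0 < h" "h < 1"
    have "F (u, w) \<le> F (u, flow e h *v w)" by (rule F_min) (use nz flow_nz in auto)
    then have "- \<mu> * W w + n * chord u w \<le> - \<mu> * W (flow e h *v w) + n * chord u (flow e h *v w)"
      using rz by (simp add: F_def g_def z_def)
    moreover have "\<mu> * (W w - h) \<le> \<mu> * W (flow e h *v w)"
      unfolding W_def using h \<mu> e by (intro mult_left_mono penal_flow k0) auto
    ultimately show "- (n * chord u (flow e h *v w)) - - (n * chord u (flow e 0 *v w)) \<le> \<mu> * h"
      by (simp add: algebra_simps)
  qed simp
  ultimately have "1 - \<mu> \<le> n * (P + Q)" by (simp add: algebra_simps)
  also have "\<dots> \<le> n * (4 * mnorm (gen e) * chord u w)" using PQ(3) n by (intro mult_left_mono) auto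
  also have "\<dots> = 4 * mnorm (gen e) * (n * chord u w)" by simp
  also have "\<dots> \<le> 4 * rate * \<epsilon>"
    using mnorm_gen_le[of e] e e0 n n_chord_small rate_nonneg by (intro mult_mono) auto
  also have "\<dots> < 1 - \<mu>" by (rule \<epsilon>)
  finally show False by simp
qed

text \<open>By the previous bound there are transfers of duration at most about \<open>V x\<close> whose squared distance to the
  target, even multiplied by a large factor, is bounded; a limit of them hits the target.\<close>

lemma hit_time_le_proximal_solution:
  assumes sol: "proximal_solution n1 n2 \<kappa> \<eta> V"
  shows "hit_time x \<eta> \<le> V x"
proof (cases "V x")
  case PInf
  then show ?thesis by simp
next
  case MInf
  then show ?thesis using sol unfolding proximal_solution_def by auto
next
  case (real r)
  have "\<exists>t e m. ctrl t e m \<and> t + real (Suc n) * chord (m *v lift x) (lift \<eta>) < r + inverse (real (Suc n))" for n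
  proof (rule ccontr)
    assume "\<not> ?thesis"
    then have "r + inverse (real (Suc n)) \<le> penal (real (Suc n)) (lift \<eta>) (lift x)"
      by (intro penal_greatest) (force simp: not_less controls_def payoff_def)
    moreover have "penal (real (Suc n)) (lift \<eta>) (lift x) \<le> r"
      using penal_le_proximal_solution[OF sol, of "real (Suc n)" x] real by simp
    moreover have "0 < inverse (real (Suc n))" by simp
    ultimately show False by linarith
  qed
  then obtain t e m where c: "\<And>n. ctrl (t n) (e n) (m n)"
    "\<And>n. t n + real (Suc n) * chord (m n *v lift x) (lift \<eta>) < r + inverse (real (Suc n))" by metis
  have t: "t n \<le> r + inverse (real (Suc n))" for n
  proof -
    have "0 \<le> real (Suc n) * chord (m n *v lift x) (lift \<eta>)" by simp
    then show ?thesis using c(2)[of n] by linarith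
  qed
  have inv1: "inverse (real (Suc n)) \<le> 1" for n by (simp add: inverse_le_1_iff)
  have t1: "t n \<le> r + 1" for n using t[of n] inv1[of n] by linarith
  have chord_le: "chord (m n *v lift x) (lift \<eta>) \<le> (r + 1) * inverse (real (Suc n))" for n
  proof -
    have "real (Suc n) * chord (m n *v lift x) (lift \<eta>) \<le> r + 1"
      using c(2)[of n] inv1[of n] ctrl_estimate(1)[OF c(1)[of n]] by linarith
    then have "chord (m n *v lift x) (lift \<eta>) * real (Suc n) \<le> r + 1"
      by (subst mult.commute)
    moreover have "0 < real (Suc n)" by simp
    ultimately show ?thesis by (simp only: divide_inverse[symmetric] pos_le_divide_eq)
  qed
  have "(\<lambda>n. (r + 1) * inverse (real (Suc n))) \<longlonglongrightarrow> 0"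
    using tendsto_mult_right_zero[OF LIMSEQ_inverse_real_of_nat] by blast
  then have lim: "(\<lambda>n. chord (m n *v lift x) (lift \<eta>)) \<longlonglongrightarrow> 0"
    by (rule Lim_null_comparison[rotated]) (simp only: real_norm_def abs_of_nonneg chord_nonneg chord_le eventually_True)
  obtain k \<tau> E M where k: "strict_mono (k :: nat \<Rightarrow> nat)" "(\<lambda>n. t (k n)) \<longlonglongrightarrow> \<tau>" "ctrl \<tau> E M" "act M (proj (lift x)) = proj (lift \<eta>)"
    by (rule ctrl_act_limit[OF c(1) t1 tendsto_const lift_nonzero lift_nonzero lim]) (rule that)
  have lim_k: "(\<lambda>n. r + inverse (real (Suc (k n)))) \<longlonglongrightarrow> r + 0"
    using LIMSEQ_subseq_LIMSEQ[OF LIMSEQ_inverse_real_of_nat k(1)] by (intro tendsto_intros) (simp add: o_def)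
  have "\<tau> \<le> r + 0" by (rule tendsto_le[OF _ lim_k k(2)]) (use t in auto)
  then show ?thesis using hit_time_le[OF k(3), of x \<eta>] k(4) real by (simp add: order_trans)
qed

theorem proximal_solution_unique:
  assumes "proximal_solution n1 n2 \<kappa> \<eta> V"
  shows "V = (\<lambda>x. hit_time x \<eta>)"
  using proximal_solution_le_hit_time[OF assms] hit_time_le_proximal_solution[OF assms]
  by (intro ext antisym)

end

section \<open>The hitting time is a proximal solution\<close>

context riccati
begin

text \<open>Running the control \<open>e\<close> backwards for time \<open>h\<close> increases the hitting time by at most \<open>h\<close>, so a
  test function increases by at most \<open>h\<close>.\<close>

lemma hit_time_slope_ge:
  assumes l: "l \<in> proximal_subdifferential (\<lambda>x. hit_time x \<eta>) x" and c: "x \<in> chart_dom c"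
    and e: "e \<in> {n1\<^sup>2..n2\<^sup>2}"
  shows "- 1 \<le> blinfun_apply (l c) (chart_field \<kappa> c (chart_map c x) e)"
proof -
  obtain m \<Omega> r where m: "open \<Omega>" "x \<in> \<Omega>" "is_differential m x l" "hit_time x \<eta> = ereal r"
    "\<And>z q. z \<in> \<Omega> \<Longrightarrow> hit_time z \<eta> \<le> ereal q \<Longrightarrow> m z - m x \<le> q - r"
  proof (rule proximal_subdifferentialE[OF l])
    show "hit_time x \<eta> \<noteq> - \<infinity>" using hit_time_nonneg[of x \<eta>] by auto
  qed (rule that)
  have e0: "0 < e" using e sq_bounds(1) by (meson atLeastAtMost_iff less_le_trans)
  obtain \<tau> E M where opt: "ctrl \<tau> E M" "act M x = \<eta>" "r = \<tau>"
    using hit_time_attained[of x \<eta> r] m(4) by auto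
  have "isCont (\<lambda>h. flow e h *v lift x) 0"
    unfolding isCont_def by (intro tendsto_matvec tendsto_flow tendsto_intros)
  then have "isCont (\<lambda>h. act (flow e h) x) 0"
    unfolding act_def by (rule isCont_o2) (simp add: isCont_proj)
  then have "((\<lambda>h. act (flow e h) x) \<longlongrightarrow> act (flow e 0) x) (nhds 0)"
    unfolding isCont_def by (rule tendsto_at_iff_tendsto_nhds[THEN iffD1])
  then have "\<forall>\<^sub>F h in nhds 0. act (flow e h) x \<in> \<Omega>"
    by (rule topological_tendstoD) (use m(1,2) in auto)
  then obtain d where d: "d > 0" "\<And>h. \<bar>h\<bar> < d \<Longrightarrow> act (flow e h) x \<in> \<Omega>"
    unfolding eventually_nhds_metric by (auto simp: dist_real_def)
  have "- blinfun_apply (l c) (chart_field \<kappa> c (chart_map c x) e) \<le> 1"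
  proof (rule deriv_le_of_increment_le[OF _ d(1)])
    have "((\<lambda>h. m (act (flow e h) x)) has_real_derivative blinfun_apply (l c) (chart_field \<kappa> c (chart_map c x) e)) (at (- 0))"
      using has_real_derivative_along_flow[OF m(3) c e0] by simp
    then show "((\<lambda>h. m (act (flow e (- h)) x)) has_real_derivative - blinfun_apply (l c) (chart_field \<kappa> c (chart_map c x) e)) (at 0)"
      by (simp only: DERIV_mirror)
    fix h assume h: "0 < h" "h < d"
    have "act (M ** flow e h) (act (flow e (- h)) x) = \<eta>"
      using act_adj2(2)[OF det_flow[OF e0]] opt(2) by (simp add: flow_minus[OF e0] act_mult det_flow[OF e0])
    moreover have "ctrl (h + \<tau>) (h * e + E) (M ** flow e h)"
      by (rule ctrl_mult[OF opt(1) ctrl_flow]) (use h e in auto)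
    ultimately have "hit_time (act (flow e (- h)) x) \<eta> \<le> ereal (h + \<tau>)" using hit_time_le by blast
    then show "m (act (flow e (- h)) x) - m (act (flow e (- 0)) x) \<le> 1 * h"
      using m(5)[OF d(2)[of "- h"]] h opt(3) by fastforce
  qed
  then show ?thesis by simp
qed

text \<open>Split an optimal transfer after a short time \<open>h\<close>: the hitting time has decreased by \<open>h\<close>, and so
  has, at least, a test function. By \<open>ctrl_estimate\<close> the direction of the first part is
  \<open>gen q\<close> up to \<open>O(h)\<close>, where \<open>q\<close> is the mean of the control over the first part; the means
  accumulate at a value \<open>e\<close> with the required slope.\<close>

lemma hit_time_slope_le:
  assumes l: "l \<in> proximal_subdifferential (\<lambda>x. hit_time x \<eta>) x" and c: "x \<in> chart_dom c" and ne: "x \<noteq> \<eta>"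
  shows "\<exists>e\<in>{n1\<^sup>2..n2\<^sup>2}. blinfun_apply (l c) (chart_field \<kappa> c (chart_map c x) e) \<le> - 1"
proof -
  obtain m \<Omega> r where m: "open \<Omega>" "x \<in> \<Omega>" "is_differential m x l" "hit_time x \<eta> = ereal r"
    "\<And>z q. z \<in> \<Omega> \<Longrightarrow> hit_time z \<eta> \<le> ereal q \<Longrightarrow> m z - m x \<le> q - r"
  proof (rule proximal_subdifferentialE[OF l])
    show "hit_time x \<eta> \<noteq> - \<infinity>" using hit_time_nonneg[of x \<eta>] by auto
  qed (rule that)
  obtain \<tau> E M where opt: "ctrl \<tau> E M" "act M x = \<eta>" "r = \<tau>"
    using hit_time_attained[of x \<eta> r] m(4) by auto
  have "\<tau> \<noteq> 0" using ctrl_0_imp[of E M] opt ne by auto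
  then have \<tau>: "0 < \<tau>" using ctrl_estimate(1)[OF opt(1)] by simp
  define h where "h n = \<tau> * inverse (real (Suc n))" for n
  have h: "0 < h n" "h n \<le> \<tau>" for n
    using \<tau> by (auto simp: h_def field_simps)
  have h_lim: "h \<longlonglongrightarrow> 0"
    unfolding h_def using tendsto_mult_right_zero[OF LIMSEQ_inverse_real_of_nat] by blast
  have "\<exists>E1 N E2 N2. ctrl (h n) E1 N \<and> ctrl (\<tau> - h n) E2 N2 \<and> M = N2 ** N" for n
    using ctrl_split[OF opt(1), of "h n"] h[of n] by (metis less_imp_le)
  then obtain E1 N E2 N2 where N: "\<And>n. ctrl (h n) (E1 n) (N n)" "\<And>n. ctrl (\<tau> - h n) (E2 n) (N2 n)" "\<And>n. M = N2 n ** N n"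
    by metis
  \<comment> \<open>the mean of the control over the first part\<close>
  define q where "q n = E1 n / h n" for n
  have q: "q n \<in> {n1\<^sup>2..n2\<^sup>2}" for n
    using ctrl_estimate(2,3)[OF N(1)[of n]] h(1)[of n] by (simp add: q_def field_simps)
  then obtain e k where e: "e \<in> {n1\<^sup>2..n2\<^sup>2}" and k: "strict_mono (k :: nat \<Rightarrow> nat)" and lim_q: "(q \<circ> k) \<longlonglongrightarrow> e"
    using compact_Icc[of "n1\<^sup>2" "n2\<^sup>2"] unfolding compact_eq_seq_compact_metric seq_compact_def by meson
  define u where "u = chart_lift c (chart_map c x)"
  have proj_u: "proj u = x" using c by (simp add: u_def)
  have u0: "u \<noteq> 0" by (simp add: u_def)
  have hk: "(\<lambda>n. h (k n)) \<longlonglongrightarrow> 0" using LIMSEQ_subseq_LIMSEQ[OF h_lim k] by (simp add: o_def)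
  have quot: "(\<lambda>n. (N (k n) *v u - u) /\<^sub>R h (k n)) \<longlonglongrightarrow> gen e *v u"
  proof -
    define R where "R n = (N n - mat 1 - drift (h n) (E1 n)) *v u" for n
    have eq: "(N n *v u - u) /\<^sub>R h n = gen (q n) *v u + R n /\<^sub>R h n" for n
    proof -
      have "drift (h n) (E1 n) *v u = h n *\<^sub>R (gen (q n) *v u)"
        unfolding vec2_eq_iff vector_scaleR_component matvec_component
        using h(1)[of n] by (simp add: q_def scaleR_conv_of_real)
      moreover have "N n *v u - u = drift (h n) (E1 n) *v u + R n"
        by (simp add: R_def matrix_vector_mult_diff_rdistrib)
      ultimately show ?thesis using h(1)[of n] by (simp add: scaleR_add_right)
    qed
    have R_le: "norm (R n /\<^sub>R h n) \<le> h n * (rate\<^sup>2 * exp (rate * \<tau>) * norm u)" for n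
    proof -
      have "norm (R n) \<le> exp_rem (rate * h n) * norm u"
        unfolding R_def
        by (rule order_trans[OF norm_matvec_le mult_right_mono[OF ctrl_estimate(5)[OF N(1)]]]) simp
      also have "\<dots> \<le> ((rate * h n)\<^sup>2 * exp (rate * h n)) * norm u"
        using h[of n] rate_nonneg by (intro mult_right_mono exp_rem_le_square) auto
      also have "\<dots> \<le> ((rate * h n)\<^sup>2 * exp (rate * \<tau>)) * norm u"
        using h[of n] rate_nonneg by (intro mult_right_mono mult_left_mono) (auto intro: mult_left_mono)
      finally have "norm (R n) \<le> h n * (h n * (rate\<^sup>2 * exp (rate * \<tau>) * norm u))"
        by (simp add: power_mult_distrib power2_eq_square mult_ac)
      moreover have "norm (R n /\<^sub>R h n) = norm (R n) / h n"
        using h(1)[of n] by (simp add: divide_inverse mult.commute)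
      ultimately show ?thesis using h(1)[of n] by (simp add: divide_le_eq mult.commute)
    qed
    have "(\<lambda>n. h (k n) * (rate\<^sup>2 * exp (rate * \<tau>) * norm u)) \<longlonglongrightarrow> 0"
      by (rule tendsto_mult_left_zero[OF hk])
    then have "(\<lambda>n. R (k n) /\<^sub>R h (k n)) \<longlonglongrightarrow> 0"
      by (rule Lim_null_comparison[OF always_eventually[OF allI[OF R_le]]])
    moreover have "(\<lambda>n. gen (q (k n)) *v u) \<longlonglongrightarrow> gen e *v u"
    proof (rule vec_tendstoI)
      fix i :: 2
      have lq: "(\<lambda>n. complex_of_real (q (k n))) \<longlonglongrightarrow> of_real e"
        using lim_q by (intro tendsto_of_real) (simp add: o_def)
      have "(\<lambda>n. (gen (q (k n)) *v u) $ 1) \<longlonglongrightarrow> (gen e *v u) $ 1"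
        "(\<lambda>n. (gen (q (k n)) *v u) $ 2) \<longlonglongrightarrow> (gen e *v u) $ 2"
        unfolding matvec_component gen_component by (intro tendsto_intros lq)+
      then show "(\<lambda>n. (gen (q (k n)) *v u) $ i) \<longlonglongrightarrow> (gen e *v u) $ i"
        using exhaust_2[of i] by (elim disjE) (simp_all only:)
    qed
    ultimately show ?thesis unfolding eq using tendsto_add by fastforce
  qed
  have deriv: "((\<lambda>u. m (proj u)) has_derivative (\<lambda>\<xi>. blinfun_apply (l c) (chart_quot_deriv c (chart_map c x) \<xi>))) (at u)"
    unfolding u_def by (rule has_derivative_comp_proj[OF m(3) c])
  have lim: "(\<lambda>n. (m (proj (N (k n) *v u)) - m (proj u)) / h (k n)) \<longlonglongrightarrow>
      blinfun_apply (l c) (chart_quot_deriv c (chart_map c x) (gen e *v u))"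
    by (rule has_derivative_quotient_limit[OF deriv hk _ quot]) (rule h)
  have Nu: "(\<lambda>n. N (k n) *v u) \<longlonglongrightarrow> u"
  proof -
    have "(\<lambda>n. h (k n) *\<^sub>R ((N (k n) *v u - u) /\<^sub>R h (k n))) \<longlonglongrightarrow> 0 *\<^sub>R (gen e *v u)"
      by (intro tendsto_scaleR hk quot)
    moreover have "h (k n) *\<^sub>R ((N (k n) *v u - u) /\<^sub>R h (k n)) = N (k n) *v u - u" for n
      using h(1)[of "k n"] by simp
    ultimately have "(\<lambda>n. N (k n) *v u - u) \<longlonglongrightarrow> 0" by simp
    then show ?thesis by (rule LIM_zero_cancel)
  qed
  have "(\<lambda>n. proj (N (k n) *v u)) \<longlonglongrightarrow> x"
    using isCont_tendsto_compose[OF isCont_proj[OF u0] Nu] proj_u by simp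
  then have "\<forall>\<^sub>F n in sequentially. proj (N (k n) *v u) \<in> \<Omega>"
    using m(1,2) by (rule topological_tendstoD)
  then have "\<forall>\<^sub>F n in sequentially. (m (proj (N (k n) *v u)) - m (proj u)) / h (k n) \<le> - 1"
  proof eventually_elim
    case (elim n)
    have "act (N2 (k n)) (proj (N (k n) *v u)) = \<eta>"
      using act_mult[OF ctrl_estimate(4)[OF N(1)[of "k n"]], of "N2 (k n)" x] N(3)[of "k n"] opt(2)
        act_proj[OF u0, of "N (k n)"] proj_u by simp
    then have "hit_time (proj (N (k n) *v u)) \<eta> \<le> ereal (\<tau> - h (k n))"
      by (rule hit_time_le[OF N(2)])
    from m(5)[OF elim this] have "m (proj (N (k n) *v u)) - m (proj u) \<le> - h (k n)"
      using opt(3) proj_u by simp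
    then show ?case using h(1)[of "k n"] by (simp add: field_simps)
  qed
  then have "blinfun_apply (l c) (chart_quot_deriv c (chart_map c x) (gen e *v u)) \<le> - 1"
    by (rule tendsto_upperbound[OF lim]) simp
  then show ?thesis using e unfolding u_def chart_quot_deriv_gen by blast
qed

theorem proximal_solution_hit_time: "proximal_solution n1 n2 \<kappa> \<eta> (\<lambda>x. hit_time x \<eta>)"
  unfolding proximal_solution_def
proof (intro conjI allI impI ballI)
  fix x show "hit_time x \<eta> \<noteq> - \<infinity>" using hit_time_nonneg[of x \<eta>] by auto
next
  show "lower_semicontinuous (\<lambda>x. hit_time x \<eta>)" by (rule lower_semicontinuous_hit_time)
next
  show "hit_time \<eta> \<eta> = 0" by (rule hit_time_self)
next
  fix l assume l: "l \<in> proximal_subdifferential (\<lambda>x. hit_time x \<eta>) \<eta>"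
  then have lc: "l \<in> cotangent_space \<eta>" by (simp add: proximal_subdifferential_def)
  obtain c where c: "\<eta> \<in> chart_dom c" using chart_cover by blast
  show "0 \<le> 1 - hamiltonian n1 n2 \<kappa> \<eta> (\<lambda>c. - l c)"
    using hamiltonian_le_iff[OF lc c] hit_time_slope_ge[OF l c] by simp
next
  fix x l assume *: "x \<noteq> \<eta> \<and> l \<in> proximal_subdifferential (\<lambda>x. hit_time x \<eta>) x"
  then have l: "l \<in> proximal_subdifferential (\<lambda>x. hit_time x \<eta>) x" by blast
  then have lc: "l \<in> cotangent_space x" by (simp add: proximal_subdifferential_def)
  obtain c where c: "x \<in> chart_dom c" using chart_cover by blast
  have "hamiltonian n1 n2 \<kappa> x (\<lambda>c. - l c) \<le> 1"
    using hamiltonian_le_iff[OF lc c] hit_time_slope_ge[OF l c] by simp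
  moreover have "1 \<le> hamiltonian n1 n2 \<kappa> x (\<lambda>c. - l c)"
    using hamiltonian_ge_iff[OF lc c] hit_time_slope_le[OF l c] * by simp
  ultimately show "0 = 1 - hamiltonian n1 n2 \<kappa> x (\<lambda>c. - l c)" by simp
qed

end

section \<open>Curves of transfer matrices\<close>

context control
begin

text \<open>The accumulated control and the transfer matrix as functions of time: an integral form of the
  linear system, stated through increments so that it passes to limits.\<close>

definition is_curve :: "real \<Rightarrow> (real \<Rightarrow> real) \<Rightarrow> (real \<Rightarrow> complex^2^2) \<Rightarrow> bool" where
  "is_curve T e m \<longleftrightarrow> e 0 = 0 \<and> m 0 = mat 1 \<and>
     (\<forall>a b. 0 \<le> a \<and> a \<le> b \<and> b \<le> T \<longrightarrow> ctrl (b - a) (e b - e a) (m b ** adj2 (m a)))"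

lemma is_curveD:
  assumes "is_curve T e m"
  shows "e 0 = 0" "m 0 = mat 1" "\<And>a b. 0 \<le> a \<Longrightarrow> a \<le> b \<Longrightarrow> b \<le> T \<Longrightarrow> ctrl (b - a) (e b - e a) (m b ** adj2 (m a))"
  using assms unfolding is_curve_def by blast+

lemma is_curve_ctrl:
  assumes "is_curve T e m" "0 \<le> s" "s \<le> T"
  shows "ctrl s (e s) (m s)"
  using is_curveD(3)[OF assms(1), of 0 s] is_curveD(1,2)[OF assms(1)] assms(2,3) by simp

lemma is_curve_det: "is_curve T e m \<Longrightarrow> 0 \<le> s \<Longrightarrow> s \<le> T \<Longrightarrow> det (m s) = 1"
  by (blast intro: ctrl_estimate(4) is_curve_ctrl)

lemma is_curve_mono: "is_curve T e m \<Longrightarrow> T' \<le> T \<Longrightarrow> is_curve T' e m"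
  unfolding is_curve_def by auto

lemma is_curve_increment:
  assumes "is_curve T e m" "0 \<le> a" "a \<le> b" "b \<le> T"
  obtains N where "ctrl (b - a) (e b - e a) N" "m b = N ** m a"
proof (rule that[OF is_curveD(3)[OF assms]])
  have "adj2 (m a) ** m a = mat 1" using is_curve_det[OF assms(1)] assms by (intro adj2_mult) auto
  then show "m b = (m b ** adj2 (m a)) ** m a" by (simp add: matrix_mul_assoc[symmetric])
qed

lemma is_curve_mnorm_le:
  assumes "is_curve T e m" "0 \<le> s" "s \<le> T"
  shows "mnorm (m s) \<le> exp (rate * T) + 1"
proof -
  have "exp (rate * s) \<le> exp (rate * T)" using assms rate_nonneg by (simp add: mult_left_mono)
  then show ?thesis using ctrl_mnorm_le(2)[OF is_curve_ctrl[OF assms]] by linarith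
qed

definition curve_lip :: "real \<Rightarrow> real" where
  "curve_lip T = rate * exp (rate * T) * (exp (rate * T) + 1)"

lemma is_curve_lipschitz:
  assumes c: "is_curve T e m" "0 \<le> a" "a \<le> b" "b \<le> T"
  shows "mnorm (m b - m a) \<le> curve_lip T * (b - a)" "\<bar>e b - e a\<bar> \<le> c2 * (b - a)"
proof -
  obtain N where N: "ctrl (b - a) (e b - e a) N" "m b = N ** m a" by (rule is_curve_increment[OF c])
  have "m b - m a = (N - mat 1) ** m a" by (simp add: N(2) mat2_eq_iff matmul_component mat1_component algebra_simps)
  then have "mnorm (m b - m a) \<le> mnorm (N - mat 1) * mnorm (m a)" by (metis mnorm_mult)
  also have "\<dots> \<le> (rate * (b - a) * exp (rate * T)) * (exp (rate * T) + 1)"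
  proof (intro mult_mono is_curve_mnorm_le[OF c(1)])
    define x where "x = rate * (b - a)"
    have x: "0 \<le> x" "x \<le> rate * T" using c rate_nonneg by (auto simp: x_def intro: mult_left_mono)
    have "(1 + - x) * exp x \<le> exp (- x) * exp x" by (intro mult_right_mono exp_ge_add_one_self) auto
    then have "exp x - 1 \<le> x * exp x" by (simp add: exp_minus algebra_simps)
    also have "\<dots> \<le> x * exp (rate * T)" using x by (intro mult_left_mono) auto
    finally show "mnorm (N - mat 1) \<le> rate * (b - a) * exp (rate * T)"
      using ctrl_mnorm_le(1)[OF N(1)] by (simp add: x_def)
  qed (use c rate_nonneg in auto)
  also have "\<dots> = curve_lip T * (b - a)" by (simp add: curve_lip_def)
  finally show "mnorm (m b - m a) \<le> curve_lip T * (b - a)" .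
  show "\<bar>e b - e a\<bar> \<le> c2 * (b - a)"
    using ctrl_estimate(3)[OF N(1)] ctrl_E_nonneg[OF N(1)] by simp
qed

lemma is_curve_extend:
  assumes c: "is_curve T e m" "0 \<le> T" and t: "0 \<le> t" and f: "c1 \<le> f" "f \<le> c2"
  shows "is_curve (T + t) (\<lambda>s. if s \<le> T then e s else e T + (s - T) * f)
     (\<lambda>s. if s \<le> T then m s else flow f (s - T) ** m T)" (is "is_curve _ ?e ?m")
  unfolding is_curve_def
proof (intro conjI allI impI)
  show "?e 0 = 0" "?m 0 = mat 1" using is_curveD(1,2)[OF c(1)] c(2) by simp_all
  fix a b assume ab: "0 \<le> a \<and> a \<le> b \<and> b \<le> T + t"
  have f0: "0 < f" using f c1_pos by simp
  show "ctrl (b - a) (?e b - ?e a) (?m b ** adj2 (?m a))"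
  proof (cases "b \<le> T")
    case True
    then show ?thesis using is_curveD(3)[OF c(1), of a b] ab by simp
  next
    case bT: False
    show ?thesis
    proof (cases "a \<le> T")
      case True
      have "ctrl ((T - a) + (b - T)) ((e T - e a) + (b - T) * f) (flow f (b - T) ** (m T ** adj2 (m a)))"
        by (intro ctrl_mult ctrl_flow is_curveD(3)[OF c(1)]) (use True bT ab f in auto)
      then show ?thesis using True bT by (simp add: matrix_mul_assoc algebra_simps)
    next
      case False
      have "m T ** adj2 (m T) = mat 1" using is_curve_det[OF c(1)] c(2) by (intro adj2_mult) auto
      then have "(flow f (b - T) ** m T) ** adj2 (flow f (a - T) ** m T) = flow f (b - T) ** adj2 (flow f (a - T))"
        unfolding adj2_mul by (metis matrix_mul_assoc matrix_mul_rid)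
      also have "\<dots> = flow f ((b - T) + (- (a - T)))" unfolding flow_add[OF f0] flow_minus[OF f0] ..
      finally have "(flow f (b - T) ** m T) ** adj2 (flow f (a - T) ** m T) = flow f (b - a)" by simp
      moreover have "ctrl (b - a) ((b - a) * f) (flow f (b - a))" using ab f by (intro ctrl_flow) auto
      ultimately show ?thesis using False bT by (simp add: algebra_simps)
    qed
  qed
qed

lemma is_curve_0: "is_curve 0 (\<lambda>_. 0) (\<lambda>_. mat 1)"
  unfolding is_curve_def
proof (intro conjI allI impI)
  fix a b :: real assume "0 \<le> a \<and> a \<le> b \<and> b \<le> 0"
  then have "a = 0" "b = 0" by auto
  then show "ctrl (b - a) (0 - 0) (mat 1 ** adj2 (mat 1))" using ctrl_0 by simp
qed auto

text \<open>Arzela-Ascoli, with the uniform Lipschitz constants of \<open>is_curve_lipschitz\<close>; closedness of \<open>ctrl\<close>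
  makes the limit a curve.\<close>

lemma is_curve_limit:
  assumes c: "\<And>n :: nat. is_curve T (e n) (m n)" and "0 \<le> T"
  obtains k e' m' where "strict_mono (k :: nat \<Rightarrow> nat)" "is_curve T e' m'"
    "\<And>s. s \<in> {0..T} \<Longrightarrow> (\<lambda>n. e (k n) s) \<longlonglongrightarrow> e' s" "\<And>s. s \<in> {0..T} \<Longrightarrow> (\<lambda>n. m (k n) s) \<longlonglongrightarrow> m' s"
proof -
  define \<F> where "\<F> n s = (e n s, m n s)" for n s
  define L where "L = c2 + curve_lip T"
  have lip: "norm (\<F> n x - \<F> n y) \<le> L * \<bar>x - y\<bar>" if "x \<in> {0..T}" "y \<in> {0..T}" for n x y
  proof -
    have *: "norm (\<F> n v - \<F> n u) \<le> L * (v - u)" if "0 \<le> u" "u \<le> v" "v \<le> T" for u v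
    proof -
      have "norm (\<F> n v - \<F> n u) \<le> norm (e n v - e n u) + norm (m n v - m n u)"
        using norm_Pair_le[of "e n v - e n u" "m n v - m n u"] by (simp add: \<F>_def)
      also have "\<dots> \<le> c2 * (v - u) + curve_lip T * (v - u)"
        using is_curve_lipschitz[OF c that, of n] norm_le_mnorm[of "m n v - m n u"] by (simp add: add_mono)
      finally show ?thesis by (simp add: L_def algebra_simps)
    qed
    show ?thesis using *[of x y] *[of y x] that by (cases "x \<le> y") (auto simp: norm_minus_commute)
  qed
  have L0: "0 \<le> L" using rate_nonneg c2_pos by (simp add: L_def curve_lip_def)
  obtain g k where k: "strict_mono (k :: nat \<Rightarrow> nat)"
    and conv: "\<And>\<epsilon>. 0 < \<epsilon> \<Longrightarrow> \<exists>N. \<forall>n x. n \<ge> N \<and> x \<in> {0..T} \<longrightarrow> norm (\<F> (k n) x - g x) < \<epsilon>"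
  proof (rule Arzela_Ascoli[of "{0..T}" \<F> "1 + norm (mat 1 :: complex^2^2) + L * T"])
    fix n x assume x: "x \<in> {0..T}"
    have "\<F> n 0 = (0, mat 1)" using is_curveD(1,2)[OF c] by (simp add: \<F>_def)
    then have "norm (\<F> n 0) \<le> norm (mat 1 :: complex^2^2)" by (simp add: norm_Pair)
    moreover have "norm (\<F> n x - \<F> n 0) \<le> L * \<bar>x - 0\<bar>" by (rule lip) (use x in auto)
    moreover have "L * \<bar>x - 0\<bar> \<le> L * T" using x L0 by (intro mult_left_mono) auto
    moreover have "norm (\<F> n x) \<le> norm (\<F> n 0) + norm (\<F> n x - \<F> n 0)" by (metis norm_triangle_sub)
    ultimately show "norm (\<F> n x) \<le> 1 + norm (mat 1 :: complex^2^2) + L * T" by linarith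
  next
    fix x \<epsilon> :: real assume x: "x \<in> {0..T}" and \<epsilon>: "0 < \<epsilon>"
    show "\<exists>d>0. \<forall>n y. y \<in> {0..T} \<and> norm (x - y) < d \<longrightarrow> norm (\<F> n x - \<F> n y) < \<epsilon>"
    proof (intro exI[of _ "\<epsilon> / (L + 1)"] conjI allI impI)
      show "0 < \<epsilon> / (L + 1)" using \<epsilon> L0 by simp
      fix n y assume y: "y \<in> {0..T} \<and> norm (x - y) < \<epsilon> / (L + 1)"
      have "norm (\<F> n x - \<F> n y) \<le> L * \<bar>x - y\<bar>" by (rule lip) (use x y in auto)
      also have "\<dots> \<le> (L + 1) * \<bar>x - y\<bar>" by (intro mult_right_mono) auto
      also have "\<dots> < \<epsilon>" using y L0 by (simp add: field_simps)
      finally show "norm (\<F> n x - \<F> n y) < \<epsilon>" .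
    qed
  qed (auto intro: that)
  have lim: "(\<lambda>n. \<F> (k n) s) \<longlonglongrightarrow> g s" if "s \<in> {0..T}" for s
    using conv that by (intro LIMSEQ_I) blast
  define e' where "e' s = fst (g s)" for s
  define m' where "m' s = snd (g s)" for s
  have e': "(\<lambda>n. e (k n) s) \<longlonglongrightarrow> e' s" and m': "(\<lambda>n. m (k n) s) \<longlonglongrightarrow> m' s" if "s \<in> {0..T}" for s
    using tendsto_fst[OF lim[OF that]] tendsto_snd[OF lim[OF that]] by (simp_all add: \<F>_def e'_def m'_def)
  have "is_curve T e' m'"
    unfolding is_curve_def
  proof (intro conjI allI impI)
    have "(\<lambda>n. 0) \<longlonglongrightarrow> e' 0" "(\<lambda>n. mat 1) \<longlonglongrightarrow> m' 0"
      using e'[of 0] m'[of 0] is_curveD(1,2)[OF c] \<open>0 \<le> T\<close> by simp_all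
    then show "e' 0 = 0" "m' 0 = mat 1" by (simp_all add: LIMSEQ_const_iff)
    fix a b assume ab: "0 \<le> a \<and> a \<le> b \<and> b \<le> T"
    show "ctrl (b - a) (e' b - e' a) (m' b ** adj2 (m' a))"
    proof (rule ctrl_limit)
      show "ctrl (b - a) (e (k n) b - e (k n) a) (m (k n) b ** adj2 (m (k n) a))" for n
        using is_curveD(3)[OF c] ab by blast
    qed (use ab in \<open>auto intro!: tendsto_intros tendsto_matmul tendsto_adj2 e' m'\<close>)
  qed
  then show thesis using that k e' m' by blast
qed

lemma is_curve_of_reach:
  assumes "reach \<tau> E M"
  shows "\<exists>e m. is_curve \<tau> e m \<and> e \<tau> = E \<and> m \<tau> = M"
  using assms
proof (induction rule: reach.induct)
  case reach_0
  show ?case using is_curve_0 by blast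
next
  case (reach_step \<tau> E M t f)
  then obtain e m where em: "is_curve \<tau> e m" "e \<tau> = E" "m \<tau> = M" by blast
  have "0 \<le> \<tau>" using reach_estimate[OF reach_step(1)] by blast
  show ?case
  proof (cases "t = 0")
    case True
    then show ?thesis using em by auto
  next
    case False
    let ?e = "\<lambda>s. if s \<le> \<tau> then e s else e \<tau> + (s - \<tau>) * f"
    let ?m = "\<lambda>s. if s \<le> \<tau> then m s else flow f (s - \<tau>) ** m \<tau>"
    have "is_curve (\<tau> + t) ?e ?m"
      by (rule is_curve_extend[OF em(1) \<open>0 \<le> \<tau>\<close> reach_step(2-4)])
    moreover have "?e (\<tau> + t) = E + t * f" "?m (\<tau> + t) = flow f t ** M"
      using em(2,3) False reach_step(2) by auto
    ultimately show ?thesis by blast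
  qed
qed

text \<open>Approximate by piecewise constant controls. Their durations differ from \<open>\<tau>\<close>, so the curves are
  first extended to a common interval.\<close>

lemma is_curve_of_ctrl:
  assumes "ctrl \<tau> E M"
  obtains e m where "is_curve \<tau> e m" "m \<tau> = M"
proof -
  obtain t E' M' where r: "\<And>n :: nat. reach (t n) (E' n) (M' n)" "t \<longlonglongrightarrow> \<tau>" "M' \<longlonglongrightarrow> M"
    using ctrl_approx[OF assms] by metis
  have t0: "0 \<le> t n" for n using reach_estimate[OF r(1)] by blast
  have "Bseq t" by (rule convergent_imp_Bseq[OF convergentI[OF r(2)]])
  then obtain K where "\<And>n. norm (t n) \<le> K" by (elim BseqE) blast
  then have K: "t n \<le> K" for n using abs_le_D1 by (metis real_norm_def)
  have "\<tau> \<le> K" by (rule tendsto_upperbound[OF r(2)]) (use K in auto)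
  have "0 \<le> \<tau>" by (rule ctrl_estimate(1)[OF assms])
  have "\<exists>e m. is_curve K e m \<and> m (t n) = M' n" for n
  proof -
    obtain e m where em: "is_curve (t n) e m" "m (t n) = M' n" using is_curve_of_reach[OF r(1)] by blast
    let ?m = "\<lambda>s. if s \<le> t n then m s else flow c1 (s - t n) ** m (t n)"
    have "is_curve (t n + (K - t n)) (\<lambda>s. if s \<le> t n then e s else e (t n) + (s - t n) * c1) ?m"
      by (rule is_curve_extend[OF em(1) t0]) (use K[of n] c1_less_c2 in auto)
    then have "is_curve K (\<lambda>s. if s \<le> t n then e s else e (t n) + (s - t n) * c1) ?m" by simp
    moreover have "?m (t n) = M' n" using em(2) by simp
    ultimately show ?thesis by blast
  qed
  then obtain e m where em: "\<And>n. is_curve K (e n) (m n)" "\<And>n. m n (t n) = M' n" by metis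
  have "0 \<le> K" using \<open>0 \<le> \<tau>\<close> \<open>\<tau> \<le> K\<close> by simp
  obtain k e' m' where k: "strict_mono (k :: nat \<Rightarrow> nat)" "is_curve K e' m'"
    "\<And>s. s \<in> {0..K} \<Longrightarrow> (\<lambda>n. m (k n) s) \<longlonglongrightarrow> m' s"
    by (rule is_curve_limit[OF em(1) \<open>0 \<le> K\<close>]) (rule that)
  note sub = LIMSEQ_subseq_LIMSEQ[OF _ k(1), unfolded o_def]
  have diff: "norm (m (k n) (t (k n)) - m (k n) \<tau>) \<le> curve_lip K * \<bar>t (k n) - \<tau>\<bar>" for n
  proof -
    have *: "norm (m (k n) v - m (k n) u) \<le> curve_lip K * (v - u)" if "0 \<le> u" "u \<le> v" "v \<le> K" for u v
      using is_curve_lipschitz(1)[OF em(1) that] norm_le_mnorm order_trans by blast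
    show ?thesis
    proof (cases "\<tau> \<le> t (k n)")
      case True
      then show ?thesis using *[OF \<open>0 \<le> \<tau>\<close> True K] by simp
    next
      case False
      then show ?thesis using *[of "t (k n)" \<tau>] t0[of "k n"] \<open>\<tau> \<le> K\<close> by (simp add: norm_minus_commute)
    qed
  qed
  have "(\<lambda>n. curve_lip K * \<bar>t (k n) - \<tau>\<bar>) \<longlonglongrightarrow> curve_lip K * \<bar>\<tau> - \<tau>\<bar>"
    by (intro tendsto_mult_left tendsto_rabs tendsto_diff tendsto_const sub[OF r(2)])
  then have "(\<lambda>n. curve_lip K * \<bar>t (k n) - \<tau>\<bar>) \<longlonglongrightarrow> 0" by simp
  then have "(\<lambda>n. m (k n) (t (k n)) - m (k n) \<tau>) \<longlonglongrightarrow> 0"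
    by (rule Lim_null_comparison[OF always_eventually[OF allI[OF diff]]])
  moreover have "(\<lambda>n. m (k n) \<tau>) \<longlonglongrightarrow> m' \<tau>" using k(3) \<open>0 \<le> \<tau>\<close> \<open>\<tau> \<le> K\<close> by simp
  ultimately have "(\<lambda>n. (m (k n) (t (k n)) - m (k n) \<tau>) + m (k n) \<tau>) \<longlonglongrightarrow> 0 + m' \<tau>" by (rule tendsto_add)
  then have "(\<lambda>n. M' (k n)) \<longlonglongrightarrow> m' \<tau>" by (simp add: em(2))
  then have "m' \<tau> = M" using sub[OF r(3)] LIMSEQ_unique by blast
  then show thesis using that is_curve_mono[OF k(2) \<open>\<tau> \<le> K\<close>] by blast
qed

text \<open>Interpolate \<open>E\<close> linearly on finer and finer grids; the slopes are admissible constant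
  controls.\<close>

lemma is_curve_of_control:
  assumes "0 \<le> T" "E 0 = 0"
    and slope: "\<And>a b. 0 \<le> a \<Longrightarrow> a \<le> b \<Longrightarrow> b \<le> T \<Longrightarrow> c1 * (b - a) \<le> E b - E a \<and> E b - E a \<le> c2 * (b - a)"
  obtains m where "is_curve T E m"
proof (cases "T = 0")
  case True
  have "is_curve 0 E (\<lambda>_. mat 1)"
    unfolding is_curve_def
  proof (intro conjI allI impI)
    fix a b :: real assume "0 \<le> a \<and> a \<le> b \<and> b \<le> 0"
    then have "a = 0" "b = 0" by auto
    then show "ctrl (b - a) (E b - E a) (mat 1 ** adj2 (mat 1))" using ctrl_0 by simp
  qed (use assms(2) in auto)
  then show thesis using that True by blast
next
  case False
  then have T: "0 < T" using assms(1) by simp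
  \<comment> \<open>piecewise constant controls with integral \<open>E\<close> at the grid points\<close>
  have grid: "\<exists>e m. is_curve (real j * h) e m \<and> (\<forall>i\<le>j. e (real i * h) = E (real i * h))"
    if h: "0 < h" "real j * h \<le> T" for h j
    using h(2)
  proof (induction j)
    case 0
    show ?case using is_curve_0 assms(2) by (intro exI[of _ "\<lambda>_. 0"] exI[of _ "\<lambda>_. mat 1"]) auto
  next
    case (Suc j)
    have jh: "real j * h \<le> T" using Suc.prems h by (simp add: algebra_simps)
    obtain e m where em: "is_curve (real j * h) e m" "\<And>i. i \<le> j \<Longrightarrow> e (real i * h) = E (real i * h)"
      using Suc.IH[OF jh] by blast
    define f where "f = (E (real (Suc j) * h) - E (real j * h)) / h"
    have "c1 * h \<le> E (real (Suc j) * h) - E (real j * h) \<and> E (real (Suc j) * h) - E (real j * h) \<le> c2 * h"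
      using slope[of "real j * h" "real (Suc j) * h"] Suc.prems h(1) by (simp add: algebra_simps)
    then have f: "c1 \<le> f" "f \<le> c2" using h(1) by (simp_all add: f_def field_simps)
    let ?e = "\<lambda>s. if s \<le> real j * h then e s else e (real j * h) + (s - real j * h) * f"
    let ?m = "\<lambda>s. if s \<le> real j * h then m s else flow f (s - real j * h) ** m (real j * h)"
    have curve: "is_curve (real j * h + h) ?e ?m"
      by (rule is_curve_extend[OF em(1)]) (use h(1) f in auto)
    have vals: "?e (real i * h) = E (real i * h)" if "i \<le> Suc j" for i
    proof (cases "i = Suc j")
      case True
      have fh: "h * f = E (real (Suc j) * h) - E (real j * h)" using h(1) by (simp add: f_def)
      have step: "real (Suc j) * h - real j * h = h" by (simp add: algebra_simps)
      then have "\<not> real (Suc j) * h \<le> real j * h" using h(1) by linarith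
      then have "?e (real (Suc j) * h) = e (real j * h) + h * f" by (simp only: if_False step)
      then show ?thesis unfolding True fh em(2)[OF order_refl] by simp
    next
      case False
      then show ?thesis using that em(2)[of i] h(1) by (simp add: mult_right_mono)
    qed
    have "real j * h + h = real (Suc j) * h" by (simp add: algebra_simps)
    then have "is_curve (real (Suc j) * h) ?e ?m" using curve by (simp only:)
    with vals show ?case by blast
  qed
  define h where "h n = T * inverse (real (Suc n))" for n
  have h: "0 < h n" for n using T by (simp add: h_def)
  have hT: "real (Suc n) * h n = T" for n by (simp add: h_def)
  have "\<exists>e m. is_curve T e m \<and> (\<forall>i\<le>Suc n. e (real i * h n) = E (real i * h n))" for n
    using grid[OF h[of n], of "Suc n"] hT[of n] by simp
  then obtain e m where em: "\<And>n. is_curve T (e n) (m n)" "\<And>n i. i \<le> Suc n \<Longrightarrow> e n (real i * h n) = E (real i * h n)"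
    by metis
  obtain k e' m' where k: "strict_mono (k :: nat \<Rightarrow> nat)" "is_curve T e' m'"
    "\<And>s. s \<in> {0..T} \<Longrightarrow> (\<lambda>n. e (k n) s) \<longlonglongrightarrow> e' s"
    by (rule is_curve_limit[OF em(1) assms(1)]) (rule that)
  have close: "\<bar>e n s - E s\<bar> \<le> 2 * c2 * h n" if s: "s \<in> {0..T}" for n s
  proof -
    define i where "i = nat \<lfloor>s / h n\<rfloor>"
    have i: "real i \<le> s / h n" "s / h n < real i + 1"
      using s h[of n] by (auto simp: i_def)
    then have ih: "real i * h n \<le> s" "s - real i * h n \<le> h n" using h[of n] by (simp_all add: field_simps)
    have "real i * h n \<le> real (Suc n) * h n" using ih(1) s hT[of n] by simp
    then have "i \<le> Suc n" using h[of n] by simp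
    have pos: "0 \<le> real i * h n" using h[of n] by simp
    have "\<bar>e n s - e n (real i * h n)\<bar> \<le> c2 * (s - real i * h n)"
      by (rule is_curve_lipschitz(2)[OF em(1) pos ih(1)]) (use s in auto)
    moreover have "\<bar>E s - E (real i * h n)\<bar> \<le> c2 * (s - real i * h n)"
    proof -
      have "0 \<le> c1 * (s - real i * h n)" using ih(1) c1_pos by simp
      moreover have "s \<le> T" using s by simp
      ultimately show ?thesis using slope[OF pos ih(1)] by linarith
    qed
    moreover have "c2 * (s - real i * h n) \<le> c2 * h n" using ih(2) c2_pos by (intro mult_left_mono) auto
    ultimately show ?thesis using em(2)[OF \<open>i \<le> Suc n\<close>] by linarith
  qed
  have h_lim: "h \<longlonglongrightarrow> 0"
    unfolding h_def by (rule tendsto_mult_right_zero[OF LIMSEQ_inverse_real_of_nat])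
  have E_eq: "e' s = E s" if s: "s \<in> {0..T}" for s
  proof -
    have "(\<lambda>n. 2 * c2 * h n) \<longlonglongrightarrow> 0" by (rule tendsto_mult_right_zero[OF h_lim])
    then have "(\<lambda>n. e n s - E s) \<longlonglongrightarrow> 0"
      by (rule Lim_null_comparison[rotated]) (use close[OF s] in auto)
    then have "(\<lambda>n. e n s) \<longlonglongrightarrow> E s" by (rule LIM_zero_cancel)
    then show ?thesis using LIMSEQ_subseq_LIMSEQ[OF _ k(1), unfolded o_def] k(3)[OF s] LIMSEQ_unique by blast
  qed
  have "is_curve T E m'"
    using k(2) E_eq unfolding is_curve_def by (auto simp: assms(2))
  then show thesis by (rule that)
qed

text \<open>The base point \<open>s\<close> may be either end, which gives both one-sided derivatives of the curve.\<close>

lemma is_curve_increment_estimate: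
  assumes c: "is_curve T e m" "0 \<le> a" "a \<le> b" "b \<le> T" and s: "s = a \<or> s = b"
  shows "norm (m b *v u - m a *v u - drift (b - a) (e b - e a) *v (m s *v u)) \<le>
     (rate\<^sup>2 * exp (rate * T) * (exp (rate * T) + 1) + rate * curve_lip T) * norm u * (b - a)\<^sup>2"
proof -
  obtain N where N: "ctrl (b - a) (e b - e a) N" "m b = N ** m a" by (rule is_curve_increment[OF c])
  define X where "X = drift (b - a) (e b - e a)"
  define R where "R = N - mat 1 - X"
  have "m b *v u - m a *v u - X *v (m s *v u) = R *v (m a *v u) + X *v ((m a - m s) *v u)"
    by (simp add: vec2_eq_iff matvec_component matmul_component N(2) R_def mat1_component algebra_simps)
  then have "norm (m b *v u - m a *v u - X *v (m s *v u)) \<le> norm (R *v (m a *v u)) + norm (X *v ((m a - m s) *v u))"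
    by (simp add: norm_triangle_ineq)
  also have "\<dots> \<le> mnorm R * (mnorm (m a) * norm u) + mnorm X * (mnorm (m a - m s) * norm u)"
    by (intro add_mono order_trans[OF norm_matvec_le] mult_left_mono norm_matvec_le mnorm_nonneg)
  also have "\<dots> \<le> (rate\<^sup>2 * (b - a)\<^sup>2 * exp (rate * T)) * ((exp (rate * T) + 1) * norm u) +
      (rate * (b - a)) * ((curve_lip T * (b - a)) * norm u)"
  proof (intro add_mono mult_mono mult_right_mono is_curve_mnorm_le[OF c(1)])
    have "mnorm R \<le> exp_rem (rate * (b - a))" unfolding R_def X_def by (rule ctrl_estimate(5)[OF N(1)])
    also have "\<dots> \<le> (rate * (b - a))\<^sup>2 * exp (rate * (b - a))"
      using c rate_nonneg by (intro exp_rem_le_square) auto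
    also have "\<dots> \<le> (rate * (b - a))\<^sup>2 * exp (rate * T)"
      using c rate_nonneg by (intro mult_left_mono) (auto intro: mult_left_mono)
    finally show "mnorm R \<le> rate\<^sup>2 * (b - a)\<^sup>2 * exp (rate * T)" by (simp add: power_mult_distrib)
    show "mnorm X \<le> rate * (b - a)"
      unfolding X_def by (rule mnorm_drift_le) (use c ctrl_E_nonneg[OF N(1)] ctrl_estimate(3)[OF N(1)] in auto)
    have lip0: "0 \<le> curve_lip T * (b - a)"
      using c rate_nonneg by (simp add: curve_lip_def)
    have "mnorm (m a - m b) = mnorm (m b - m a)" by (simp add: mnorm_def norm_minus_commute)
    moreover have "mnorm (m a - m a) = 0" by (simp add: mnorm_def)
    ultimately show "mnorm (m a - m s) \<le> curve_lip T * (b - a)"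
      using is_curve_lipschitz(1)[OF c] s lip0 by auto
    then show "0 \<le> curve_lip T * (b - a)" by (rule order_trans[OF mnorm_nonneg])
  qed (use c rate_nonneg in auto)
  also have "\<dots> = (rate\<^sup>2 * exp (rate * T) * (exp (rate * T) + 1) + rate * curve_lip T) * norm u * (b - a)\<^sup>2"
    by (simp add: algebra_simps power2_eq_square)
  finally show ?thesis unfolding X_def .
qed

lemma is_curve_has_vector_derivative:
  assumes c: "is_curve T e m" and s: "0 \<le> s" "s \<le> T"
    and e: "(e has_real_derivative f) (at s within {0..T})"
  shows "((\<lambda>s. m s *v u) has_vector_derivative gen f *v (m s *v u)) (at s within {0..T})"
  unfolding has_vector_derivative_def has_derivative_within_alt
proof (intro conjI allI impI)
  show "bounded_linear (\<lambda>x. x *\<^sub>R (gen f *v (m s *v u)))" by (rule bounded_linear_scaleR_left)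
  fix \<epsilon> :: real assume \<epsilon>: "0 < \<epsilon>"
  define K where "K = (rate\<^sup>2 * exp (rate * T) * (exp (rate * T) + 1) + rate * curve_lip T) * norm u"
  have K: "0 \<le> K" using rate_nonneg by (simp add: K_def curve_lip_def)
  define w where "w = m s *v u"
  define J where "J = cmod \<kappa> * norm w"
  have J: "0 \<le> J" by (simp add: J_def)
  have "0 < \<epsilon> / (2 * (J + 1))" using \<epsilon> J by simp
  then obtain d where d: "d > 0" "\<And>y. y \<in> {0..T} \<Longrightarrow> \<bar>y - s\<bar> < d \<Longrightarrow>
      \<bar>e y - e s - f * (y - s)\<bar> \<le> \<epsilon> / (2 * (J + 1)) * \<bar>y - s\<bar>"
    using e unfolding has_field_derivative_def has_derivative_within_alt by (metis real_norm_def)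
  show "\<exists>d>0. \<forall>y\<in>{0..T}. norm (y - s) < d \<longrightarrow>
      norm (m y *v u - m s *v u - (y - s) *\<^sub>R (gen f *v (m s *v u))) \<le> \<epsilon> * norm (y - s)"
  proof (intro exI[of _ "min d (\<epsilon> / (2 * (K + 1)))"] conjI ballI impI)
    show "0 < min d (\<epsilon> / (2 * (K + 1)))" using d \<epsilon> K by simp
    fix y assume y: "y \<in> {0..T}" "norm (y - s) < min d (\<epsilon> / (2 * (K + 1)))"
    have 1: "norm (m y *v u - m s *v u - drift (y - s) (e y - e s) *v w) \<le> K * (y - s)\<^sup>2"
    proof (cases "s \<le> y")
      case True
      then show ?thesis using is_curve_increment_estimate[OF c s(1) True, of s u] y by (simp add: w_def K_def)
    next
      case False
      have "drift (s - y) (e s - e y) *v w = - (drift (y - s) (e y - e s) *v w)"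
        by (simp add: vec2_eq_iff matvec_component algebra_simps)
      then have "m s *v u - m y *v u - drift (s - y) (e s - e y) *v w =
          - (m y *v u - m s *v u - drift (y - s) (e y - e s) *v w)" by simp
      then have "norm (m y *v u - m s *v u - drift (y - s) (e y - e s) *v w) =
          norm (m s *v u - m y *v u - drift (s - y) (e s - e y) *v w)" by (simp only: norm_minus_cancel)
      also have "\<dots> \<le> K * (s - y)\<^sup>2"
        unfolding w_def K_def by (rule is_curve_increment_estimate[OF c]) (use False y s in auto)
      finally show ?thesis by (simp add: power2_commute)
    qed
    \<comment> \<open>the error from replacing the increment of \<open>e\<close> by its linear part\<close>
    define q where "q = e y - e s - f * (y - s)"
    have "drift (y - s) (e y - e s) *v w - (y - s) *\<^sub>R (gen f *v w) = drift 0 q *v w"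
      unfolding vec2_eq_iff vector_minus_component vector_scaleR_component matvec_component
      by (simp add: q_def scaleR_conv_of_real algebra_simps)
    moreover have "norm (drift 0 q *v w) \<le> \<bar>q\<bar> * J"
    proof -
      have "norm (drift 0 q *v w) \<le> mnorm (drift 0 q) * norm w" by (rule norm_matvec_le)
      also have "mnorm (drift 0 q) = cmod \<kappa> * \<bar>q\<bar>" by (simp add: mnorm_def norm_mult)
      finally show ?thesis by (simp add: J_def mult_ac)
    qed
    ultimately have 2: "norm (drift (y - s) (e y - e s) *v w - (y - s) *\<^sub>R (gen f *v w)) \<le> \<bar>q\<bar> * J" by simp
    have "m y *v u - m s *v u - (y - s) *\<^sub>R (gen f *v w) = (m y *v u - m s *v u - drift (y - s) (e y - e s) *v w) +
        (drift (y - s) (e y - e s) *v w - (y - s) *\<^sub>R (gen f *v w))" by simp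
    then have "norm (m y *v u - m s *v u - (y - s) *\<^sub>R (gen f *v w)) \<le> K * (y - s)\<^sup>2 + \<bar>q\<bar> * J"
      using norm_triangle_mono[OF 1 2] by (simp only:)
    also have "K * (y - s)\<^sup>2 \<le> \<epsilon> / 2 * \<bar>y - s\<bar>"
    proof -
      have "K * \<bar>y - s\<bar> \<le> (K + 1) * (\<epsilon> / (2 * (K + 1)))" using y K by (intro mult_mono) auto
      also have "\<dots> = \<epsilon> / 2" using K by (simp add: field_simps)
      finally have "(K * \<bar>y - s\<bar>) * \<bar>y - s\<bar> \<le> \<epsilon> / 2 * \<bar>y - s\<bar>" by (intro mult_right_mono) auto
      moreover have "K * (y - s)\<^sup>2 = (K * \<bar>y - s\<bar>) * \<bar>y - s\<bar>"
        by (simp only: power2_eq_square mult.assoc abs_mult_self_eq)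
      ultimately show ?thesis by (simp only:)
    qed
    also have "\<bar>q\<bar> * J \<le> \<epsilon> / 2 * \<bar>y - s\<bar>"
    proof -
      have "\<bar>q\<bar> * J \<le> (\<epsilon> / (2 * (J + 1)) * \<bar>y - s\<bar>) * (J + 1)"
        unfolding q_def using d(2)[OF y(1)] y(2) J by (intro mult_mono) auto
      also have "\<dots> = \<epsilon> / 2 * \<bar>y - s\<bar>" using J by (simp add: field_simps)
      finally show ?thesis .
    qed
    finally show "norm (m y *v u - m s *v u - (y - s) *\<^sub>R (gen f *v (m s *v u))) \<le> \<epsilon> * norm (y - s)"
      by (simp add: w_def)
  qed
qed

lemma is_curve_lipschitz_matvec:
  assumes "is_curve T e m" "0 \<le> s" "s \<le> t" "t \<le> T"
  shows "norm (m t *v w - m s *v w) \<le> curve_lip T * norm w * (t - s)"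
proof -
  have "m t *v w - m s *v w = (m t - m s) *v w"
    by (simp add: vec2_eq_iff matvec_component algebra_simps)
  then have "norm (m t *v w - m s *v w) \<le> mnorm (m t - m s) * norm w" by (simp add: norm_matvec_le)
  also have "\<dots> \<le> (curve_lip T * (t - s)) * norm w"
    by (intro mult_right_mono is_curve_lipschitz(1)[OF assms]) simp
  finally show ?thesis by (simp add: mult_ac)
qed

lemma is_curve_has_vector_derivative_shift:
  assumes c: "is_curve T e m" and e: "(e has_real_derivative f) (at (s - s0) within {0..T})"
    and ab: "s0 \<le> a" "b \<le> s0 + T" "s \<in> {a..b}"
  shows "((\<lambda>s. m (s - s0) *v w) has_vector_derivative gen f *v (m (s - s0) *v w)) (at s within {a..b})"
proof -
  have "((\<lambda>s. m s *v w) has_vector_derivative gen f *v (m (s - s0) *v w)) (at (s - s0) within {0..T})"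
    by (rule is_curve_has_vector_derivative[OF c _ _ e]) (use ab in auto)
  then have "((\<lambda>s. m s *v w) has_vector_derivative gen f *v (m (s - s0) *v w))
      (at (s - s0) within (\<lambda>s. s - s0) ` {a..b})"
    by (rule has_vector_derivative_within_subset) (use ab in auto)
  moreover have "((\<lambda>s. s - s0) has_vector_derivative 1) (at s within {a..b})"
    by (auto intro!: derivative_eq_intros)
  ultimately have "((\<lambda>s. m s *v w) \<circ> (\<lambda>s. s - s0) has_vector_derivative
      1 *\<^sub>R (gen f *v (m (s - s0) *v w))) (at s within {a..b})"
    by (intro vector_diff_chain_within)
  then show ?thesis by (simp add: o_def)
qed

end

section \<open>Trajectories are projected curves\<close>

context control
begin

text \<open>The quotient rule for a solution of the linear system reproduces the Riccati equation in the
  chart.\<close>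

lemma chart_quot_derivative_eq:
  assumes "chart_den c u \<noteq> 0"
  shows "(chart_num c (gen f *v u) * chart_den c u - chart_num c u * chart_den c (gen f *v u)) / (chart_den c u * chart_den c u)
     = chart_field \<kappa> c (chart_quot c u) f"
  using assms by (cases c) (simp_all add: matvec_component field_simps power2_eq_square)

text \<open>If \<open>z\<close> solves the Riccati equation and \<open>u\<close> the linear system, the left side is the derivative
  of \<open>chart_num c u - z * chart_den c u\<close>. The defect therefore satisfies a linear equation.\<close>

lemma chart_defect_derivative_eq:
  "chart_num c (gen f *v u) - (chart_field \<kappa> c z f * chart_den c u + z * chart_den c (gen f *v u)) =
     (case c of Chart1 \<Rightarrow> - (\<i> * \<kappa> * z) | Chart2 \<Rightarrow> \<i> * \<kappa> * of_real f * z) * (chart_num c u - z * chart_den c u)"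
  by (cases c) (simp_all add: matvec_component algebra_simps power2_eq_square)

lemma trajectory_of_curve:
  assumes c: "is_curve T e m" and T: "0 \<le> T" and u0: "u0 \<noteq> 0" and N: "negligible N"
    and e: "\<And>s. s \<in> {0..T} - N \<Longrightarrow> (e has_real_derivative f s) (at s within {0..T})"
  shows "trajectory \<kappa> (\<lambda>s. f (s - s0)) s0 (s0 + T) (\<lambda>s. proj (m (s - s0) *v u0))"
proof -
  define u where "u s = m (s - s0) *v u0" for s
  have u_nz: "u s \<noteq> 0" if "s \<in> {s0..s0 + T}" for s
    unfolding u_def by (rule matvec_nonzero[OF is_curve_det[OF c] u0]) (use that in auto)
  have u_lip: "norm (u t - u s) \<le> curve_lip T * norm u0 * (t - s)" if "s0 \<le> s" "s \<le> t" "t \<le> s0 + T" for s t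
    using is_curve_lipschitz_matvec[OF c, of "s - s0" "t - s0" u0] that by (simp add: u_def)
  have "continuous_on {s0..s0 + T} u"
    by (rule abs_continuous_on_imp_continuous_on[OF abs_continuous_on_if_lipschitz[OF u_lip]])
  then have cont: "continuous_on {s0..s0 + T} (\<lambda>s. proj (u s))"
    unfolding continuous_on_def using u_nz by (auto intro: isCont_tendsto_compose[OF isCont_proj])
  show ?thesis
    unfolding trajectory_def u_def[symmetric]
  proof (intro conjI allI impI cont; elim conjE)
    fix c' a b assume ab: "s0 \<le> a" "a \<le> b" "b \<le> s0 + T" and dom: "(\<lambda>s. proj (u s)) ` {a..b} \<subseteq> chart_dom c'"
    have den: "chart_den c' (u s) \<noteq> 0" if "s \<in> {a..b}" for s
    proof -
      have "proj (u s) \<in> chart_dom c'" using dom that by blast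
      then show ?thesis using proj_in_chart_dom[OF u_nz] that ab by auto
    qed
    have rep: "chart_map c' (proj (u s)) = chart_num c' (u s) / chart_den c' (u s)" if "s \<in> {a..b}" for s
      using chart_map_proj[OF den[OF that]] by (simp add: chart_quot_eq)
    have ac: "abs_continuous_on a b (\<lambda>s. chart_num c' (u s) / chart_den c' (u s))"
    proof (rule abs_continuous_on_lipschitz_quotient[OF _ _ den])
      fix s t assume st: "a \<le> s" "s \<le> t" "t \<le> b"
      have "norm (u t - u s) \<le> curve_lip T * norm u0 * (t - s)" by (rule u_lip) (use st ab in auto)
      then show "norm (chart_num c' (u t) - chart_num c' (u s)) \<le> curve_lip T * norm u0 * (t - s)"
        "norm (chart_den c' (u t) - chart_den c' (u s)) \<le> curve_lip T * norm u0 * (t - s)"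
        using cmod_chart_num_le[of c' "u t - u s"] cmod_chart_den_le[of c' "u t - u s"]
        by (simp_all add: linear_diff[OF bounded_linear.linear[OF bounded_linear_chart_num]]
            linear_diff[OF bounded_linear.linear[OF bounded_linear_chart_den]])
    qed
    show "abs_continuous_on a b (\<lambda>s. chart_map c' (proj (u s)))"
      by (rule abs_continuous_on_cong[OF ac rep])
    show "AE s in lebesgue_on {a..b}. ((\<lambda>s. chart_map c' (proj (u s))) has_vector_derivative
        chart_field \<kappa> c' (chart_map c' (proj (u s))) (f (s - s0))) (at s within {a..b})"
    proof (rule negligible_imp_AE_lebesgue_on)
      show "negligible ((+) s0 ` N)" using N by (rule negligible_translation)
      fix s assume s: "s \<in> {a..b} - (+) s0 ` N"
      then have sN: "s - s0 \<in> {0..T} - N" using ab by (force simp: image_iff)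
      have u': "(u has_vector_derivative gen (f (s - s0)) *v u s) (at s within {a..b})"
        unfolding u_def by (rule is_curve_has_vector_derivative_shift[OF c e[OF sN]]) (use ab s in auto)
      define u1 where "u1 = gen (f (s - s0)) *v u s"
      have num: "((\<lambda>s. chart_num c' (u s)) has_derivative (\<lambda>h. h *\<^sub>R chart_num c' u1)) (at s within {a..b})"
        using bounded_linear.has_vector_derivative[OF bounded_linear_chart_num u']
        by (simp add: has_vector_derivative_def u1_def)
      have den': "((\<lambda>s. chart_den c' (u s)) has_derivative (\<lambda>h. h *\<^sub>R chart_den c' u1)) (at s within {a..b})"
        using bounded_linear.has_vector_derivative[OF bounded_linear_chart_den u']
        by (simp add: has_vector_derivative_def u1_def)
      have sab: "s \<in> {a..b}" using s by simp
      have "((\<lambda>s. chart_num c' (u s) / chart_den c' (u s)) has_derivative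
          (\<lambda>h. (h *\<^sub>R chart_num c' u1 * chart_den c' (u s) - chart_num c' (u s) * h *\<^sub>R chart_den c' u1) /
            (chart_den c' (u s) * chart_den c' (u s)))) (at s within {a..b})"
        by (rule has_derivative_divide'[OF num den' den[OF sab]])
      moreover have "(\<lambda>h. (h *\<^sub>R chart_num c' u1 * chart_den c' (u s) - chart_num c' (u s) * h *\<^sub>R chart_den c' u1) /
            (chart_den c' (u s) * chart_den c' (u s))) = (\<lambda>h. h *\<^sub>R chart_field \<kappa> c' (chart_quot c' (u s)) (f (s - s0)))"
        unfolding chart_quot_derivative_eq[OF den[OF sab], symmetric] u1_def[symmetric]
        by (simp add: fun_eq_iff scaleR_conv_of_real algebra_simps)
      ultimately have quot: "((\<lambda>s. chart_num c' (u s) / chart_den c' (u s)) has_vector_derivative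
          chart_field \<kappa> c' (chart_quot c' (u s)) (f (s - s0))) (at s within {a..b})"
        by (simp add: has_vector_derivative_def)
      have "((\<lambda>s. chart_map c' (proj (u s))) has_vector_derivative
          chart_field \<kappa> c' (chart_quot c' (u s)) (f (s - s0))) (at s within {a..b})"
        by (rule has_vector_derivative_transform[OF sab rep quot])
      then show "((\<lambda>s. chart_map c' (proj (u s))) has_vector_derivative
        chart_field \<kappa> c' (chart_map c' (proj (u s))) (f (s - s0))) (at s within {a..b})"
        by (simp add: chart_map_proj den[OF sab])
    qed simp
  qed
qed

text \<open>The defect \<open>chart_num c u - z * chart_den c u\<close> is absolutely continuous and solves a linear
  equation, so it stays zero.\<close>

lemma trajectory_chart_unique:
  assumes ac: "abs_continuous_on a b z"
    and N: "negligible N"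
    and z: "\<And>s. s \<in> {a..b} - N \<Longrightarrow> (z has_vector_derivative chart_field \<kappa> c (z s) (f s)) (at s within {a..b})"
    and u: "\<And>s. s \<in> {a..b} - N \<Longrightarrow> (u has_vector_derivative gen (f s) *v u s) (at s within {a..b})"
    and f: "\<And>s. s \<in> {a..b} - N \<Longrightarrow> 0 \<le> f s \<and> f s \<le> c2"
    and lip: "\<And>s t. a \<le> s \<Longrightarrow> s \<le> t \<Longrightarrow> t \<le> b \<Longrightarrow> norm (u t - u s) \<le> L * (t - s)"
    and nz: "\<And>s. s \<in> {a..b} \<Longrightarrow> u s \<noteq> 0"
    and init: "proj (u a) = chart_inv c (z a)" and "a \<le> b"
  shows "proj (u b) = chart_inv c (z b)"
proof -
  define g where "g s = chart_num c (u s) - z s * chart_den c (u s)" for s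
  have num_lip: "norm (chart_num c (u t) - chart_num c (u s)) \<le> L * (t - s)"
    and den_lip: "norm (chart_den c (u t) - chart_den c (u s)) \<le> L * (t - s)"
    if "a \<le> s" "s \<le> t" "t \<le> b" for s t
    using lip[OF that] cmod_chart_num_le[of c "u t - u s"] cmod_chart_den_le[of c "u t - u s"]
    by (simp_all add: linear_diff[OF bounded_linear.linear[OF bounded_linear_chart_num]]
        linear_diff[OF bounded_linear.linear[OF bounded_linear_chart_den]])
  have ac_g: "abs_continuous_on a b g"
    unfolding g_def
    by (intro abs_continuous_on_diff abs_continuous_on_if_lipschitz[OF num_lip]
        abs_continuous_on_mult_lipschitz[OF ac den_lip])
  have "bounded (z ` {a..b})"
    by (intro compact_imp_bounded compact_continuous_image abs_continuous_on_imp_continuous_on ac compact_Icc)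
  then obtain Z where Z: "0 < Z" "\<And>s. s \<in> {a..b} \<Longrightarrow> norm (z s) \<le> Z" unfolding bounded_pos by blast
  have "g a = 0"
    unfolding g_def using init proj_eq_chart_inv_iff[OF nz[of a], of c "z a"] \<open>a \<le> b\<close> by simp
  have "g b = 0"
  proof (rule abs_continuous_on_gronwall_zero[OF ac_g N \<open>g a = 0\<close>])
    show "b \<in> {a..b}" using \<open>a \<le> b\<close> by simp
    fix s assume s: "s \<in> {a..b} - N"
    define \<rho> where "\<rho> = (case c of Chart1 \<Rightarrow> - (\<i> * \<kappa> * z s) | Chart2 \<Rightarrow> \<i> * \<kappa> * of_real (f s) * z s)"
    have "(g has_vector_derivative chart_num c (gen (f s) *v u s) -
        (z s * chart_den c (gen (f s) *v u s) + chart_field \<kappa> c (z s) (f s) * chart_den c (u s))) (at s within {a..b})"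
      unfolding g_def
      by (intro has_vector_derivative_diff has_vector_derivative_mult z[OF s]
          bounded_linear.has_vector_derivative[OF bounded_linear_chart_num u[OF s]]
          bounded_linear.has_vector_derivative[OF bounded_linear_chart_den u[OF s]])
    moreover have "chart_num c (gen (f s) *v u s) -
        (z s * chart_den c (gen (f s) *v u s) + chart_field \<kappa> c (z s) (f s) * chart_den c (u s)) = \<rho> * g s"
      using chart_defect_derivative_eq[of c "f s" "u s" "z s"] by (simp add: \<rho>_def g_def add.commute)
    moreover have "norm (\<rho> * g s) \<le> (cmod \<kappa> * (1 + c2) * Z) * norm (g s)"
    proof -
      have zs: "norm (z s) \<le> Z" using Z s by simp
      have "cmod \<rho> \<le> cmod \<kappa> * (1 + c2) * Z"
      proof (cases c)
        case Chart1
        have "cmod \<rho> = cmod \<kappa> * 1 * cmod (z s)" using Chart1 by (simp add: \<rho>_def norm_mult)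
        also have "\<dots> \<le> cmod \<kappa> * (1 + c2) * Z" using zs c2_pos by (intro mult_mono) auto
        finally show ?thesis .
      next
        case Chart2
        have "cmod \<rho> = cmod \<kappa> * f s * cmod (z s)" using Chart2 f[OF s] by (simp add: \<rho>_def norm_mult)
        also have "\<dots> \<le> cmod \<kappa> * (1 + c2) * Z" using zs f[OF s] c2_pos by (intro mult_mono) auto
        finally show ?thesis .
      qed
      then show ?thesis unfolding norm_mult by (rule mult_right_mono) simp
    qed
    ultimately show "\<exists>v. (g has_vector_derivative v) (at s within {a..b}) \<and> norm v \<le> (cmod \<kappa> * (1 + c2) * Z) * norm (g s)"
      by auto
  qed
  then show ?thesis
    using proj_eq_chart_inv_iff[OF nz[of b], of c "z b"] \<open>a \<le> b\<close> by (simp add: g_def)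
qed

text \<open>The agreement of \<open>x\<close> with the projected curve propagates over every short interval, on which \<open>x\<close>
  stays in one chart; compactness of the time interval does the rest.\<close>

lemma trajectory_eq_proj_curve:
  assumes tr: "trajectory \<kappa> \<epsilon> s0 (s0 + T) x" and T: "0 \<le> T"
    and c: "is_curve T e m" and N: "negligible N"
    and e: "\<And>s. s \<in> {s0..s0 + T} - N \<Longrightarrow> (e has_real_derivative \<epsilon> s) (at (s - s0) within {0..T}) \<and> 0 \<le> \<epsilon> s \<and> \<epsilon> s \<le> c2"
  shows "x (s0 + T) = act (m T) (x s0)"
proof -
  define u where "u s = m (s - s0) *v lift (x s0)" for s
  have u_nz: "u s \<noteq> 0" if "s \<in> {s0..s0 + T}" for s
    unfolding u_def by (rule matvec_nonzero[OF is_curve_det[OF c]]) (use that in auto)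
  have u_lip: "norm (u t - u s) \<le> curve_lip T * norm (lift (x s0)) * (t - s)" if "s0 \<le> s" "s \<le> t" "t \<le> s0 + T" for s t
    using is_curve_lipschitz_matvec[OF c, of "s - s0" "t - s0" "lift (x s0)"] that by (simp add: u_def)
  define P where "P a b \<longleftrightarrow> (s0 \<le> a \<and> b \<le> s0 + T \<longrightarrow> x a = proj (u a) \<longrightarrow> x b = proj (u b))" for a b
  have "P s0 (s0 + T)"
  proof (rule Bolzano)
    show "s0 \<le> s0 + T" using T by simp
    show "P a c" if "P a b" "P b c" "a \<le> b" "b \<le> c" for a b c
      using that unfolding P_def by auto
    fix s assume s: "s0 \<le> s" "s \<le> s0 + T"
    obtain c' where c': "x s \<in> chart_dom c'" using chart_cover by blast
    have "continuous_on {s0..s0 + T} x" using tr unfolding trajectory_def by blast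
    then have "(x \<longlongrightarrow> x s) (at s within {s0..s0 + T})" using s by (simp add: continuous_on_def)
    then have "\<forall>\<^sub>F t in at s within {s0..s0 + T}. x t \<in> chart_dom c'"
      using open_chart_dom c' by (rule topological_tendstoD)
    then obtain d where d: "d > 0" "\<And>t. t \<in> {s0..s0 + T} \<Longrightarrow> t \<noteq> s \<Longrightarrow> dist t s < d \<Longrightarrow> x t \<in> chart_dom c'"
      unfolding eventually_at by blast
    have dom: "x t \<in> chart_dom c'" if "t \<in> {s0..s0 + T}" "\<bar>t - s\<bar> < d" for t
      using d(2)[of t] that c' by (cases "t = s") (auto simp: dist_real_def)
    show "\<exists>d>0. \<forall>a b. a \<le> s \<and> s \<le> b \<and> b - a < d \<longrightarrow> P a b"
    proof (intro exI[of _ d] conjI allI impI d(1))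
      fix a b assume ab: "a \<le> s \<and> s \<le> b \<and> b - a < d"
      show "P a b"
        unfolding P_def
      proof (intro impI)
        assume ab': "s0 \<le> a \<and> b \<le> s0 + T" and init: "x a = proj (u a)"
        have ab_dom: "x ` {a..b} \<subseteq> chart_dom c'" using dom ab ab' by force
        define z where "z t = chart_map c' (x t)" for t
        have inv: "chart_inv c' (z t) = x t" if "t \<in> {a..b}" for t
          unfolding z_def by (rule chart_inv_map) (use ab_dom that in blast)
        have "s0 \<le> a \<and> a \<le> b \<and> b \<le> s0 + T \<and> x ` {a..b} \<subseteq> chart_dom c'" using ab ab' ab_dom by auto
        then have ac: "abs_continuous_on a b z"
          and ae: "AE t in lebesgue_on {a..b}. (z has_vector_derivative chart_field \<kappa> c' (z t) (\<epsilon> t)) (at t within {a..b})"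
          using tr unfolding trajectory_def z_def by blast+
        obtain N' where N': "negligible N'"
          "\<And>t. t \<in> {a..b} - N' \<Longrightarrow> (z has_vector_derivative chart_field \<kappa> c' (z t) (\<epsilon> t)) (at t within {a..b})"
          by (rule AE_lebesgue_on_imp_negligible[OF ae]) (auto intro: that)
        have "proj (u b) = chart_inv c' (z b)"
        proof (rule trajectory_chart_unique[OF ac])
          show "negligible (N \<union> N')" using N N'(1) by (rule negligible_Un)
          fix t assume t: "t \<in> {a..b} - (N \<union> N')"
          show "(z has_vector_derivative chart_field \<kappa> c' (z t) (\<epsilon> t)) (at t within {a..b})" using N'(2) t by blast
          have tT: "t \<in> {s0..s0 + T} - N" using t ab' by auto
          show "0 \<le> \<epsilon> t \<and> \<epsilon> t \<le> c2" using e[OF tT] by blast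
          show "(u has_vector_derivative gen (\<epsilon> t) *v u t) (at t within {a..b})"
            unfolding u_def by (rule is_curve_has_vector_derivative_shift[OF c]) (use e[OF tT] t ab' in auto)
        next
          show "proj (u a) = chart_inv c' (z a)" using inv[of a] ab init by simp
          show "a \<le> b" using ab by simp
          show "u t \<noteq> 0" if "t \<in> {a..b}" for t using u_nz that ab' by auto
          show "norm (u t - u s) \<le> curve_lip T * norm (lift (x s0)) * (t - s)" if "a \<le> s" "s \<le> t" "t \<le> b" for s t
            using u_lip that ab' by auto
        qed
        then show "x b = proj (u b)" using inv[of b] ab by simp
      qed
    qed
  qed
  moreover have "proj (u s0) = x s0" unfolding u_def by (simp add: is_curveD(2)[OF c])
  ultimately have "x (s0 + T) = proj (u (s0 + T))" unfolding P_def by simp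
  then show ?thesis by (simp add: act_def u_def)
qed

text \<open>Extend \<open>e\<close> with slope \<open>c1\<close> beyond \<open>{0..T}\<close> to obtain a bi-Lipschitz function on the line.\<close>

lemma is_curve_imp_control:
  assumes c: "is_curve T e m" and T: "0 \<le> T"
  obtains f N where "f \<in> borel_measurable borel" "\<And>s. c1 \<le> f s \<and> f s \<le> c2" "negligible N"
    "\<And>s. s \<in> {0..T} - N \<Longrightarrow> (e has_real_derivative f s) (at s within {0..T})"
proof -
  define cl where "cl s = max 0 (min T s)" for s
  define E where "E s = e (cl s) + c1 * (s - cl s)" for s
  have "c1 * (t - s) \<le> E t - E s \<and> E t - E s \<le> c2 * (t - s)" if "s \<le> t" for s t
  proof -
    have cl: "0 \<le> cl s" "cl s \<le> cl t" "cl t \<le> T" "cl t - cl s \<le> t - s"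
      using that T by (auto simp: cl_def)
    have "ctrl (cl t - cl s) (e (cl t) - e (cl s)) (m (cl t) ** adj2 (m (cl s)))"
      by (rule is_curveD(3)[OF c cl(1-3)])
    from ctrl_estimate(2,3)[OF this]
    have "c1 * (cl t - cl s) \<le> e (cl t) - e (cl s)" "e (cl t) - e (cl s) \<le> c2 * (cl t - cl s)" .
    moreover have "E t - E s = (e (cl t) - e (cl s)) + c1 * ((t - s) - (cl t - cl s))"
      by (simp add: E_def algebra_simps)
    moreover have "c1 * ((t - s) - (cl t - cl s)) \<le> c2 * ((t - s) - (cl t - cl s))"
      using cl(4) c1_less_c2 by (intro mult_right_mono) auto
    ultimately show ?thesis by (simp add: algebra_simps)
  qed
  then obtain f where f: "f \<in> borel_measurable borel" "\<And>x. c1 \<le> f x \<and> f x \<le> c2"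
    "negligible {x. \<not> (E has_real_derivative f x) (at x)}"
    using bilipschitz_ae_derivative[OF c1_pos, of E c2] by blast
  show thesis
  proof (rule that[OF f])
    fix s assume s: "s \<in> {0..T} - {x. \<not> (E has_real_derivative f x) (at x)}"
    then have "(E has_derivative (*) (f s)) (at s within {0..T})"
      unfolding has_field_derivative_def by (auto intro: has_derivative_at_withinI)
    then have "(e has_derivative (*) (f s)) (at s within {0..T})"
      by (rule has_derivative_transform[rotated 2]) (use s in \<open>auto simp: E_def cl_def\<close>)
    then show "(e has_real_derivative f s) (at s within {0..T})" by (simp add: has_field_derivative_def)
  qed
qed

lemma control_imp_is_curve:
  assumes g: "g \<in> borel_measurable lebesgue" "\<And>s. c1 \<le> g s \<and> g s \<le> c2" and T: "0 \<le> T"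
  obtains m where "is_curve T (\<lambda>s. integral {s0..s0 + s} g) m"
proof -
  have int: "g integrable_on {a..b}" for a b
  proof (rule measurable_bounded_by_integrable_imp_integrable)
    show "g \<in> borel_measurable (lebesgue_on {a..b})"
      using g(1) by (rule measurable_restrict_space1)
    show "(\<lambda>_. c2) integrable_on {a..b}" by (rule integrable_const_ivl)
    show "norm (g s) \<le> c2" for s using g(2)[of s] c1_pos by simp
  qed simp
  show thesis
  proof (rule is_curve_of_control[OF T, of "\<lambda>s. integral {s0..s0 + s} g"])
    show "integral {s0..s0 + 0} g = 0" by simp
    fix a b assume ab: "0 \<le> a" "a \<le> b" "b \<le> T"
    have "integral {s0..s0 + a} g + integral {s0 + a..s0 + b} g = integral {s0..s0 + b} g"
      by (rule Henstock_Kurzweil_Integration.integral_combine[OF _ _ int]) (use ab in auto)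
    moreover have "integral {s0 + a..s0 + b} (\<lambda>_. c1) \<le> integral {s0 + a..s0 + b} g"
      "integral {s0 + a..s0 + b} g \<le> integral {s0 + a..s0 + b} (\<lambda>_. c2)"
      by (intro integral_le int integrable_const_ivl; use g(2) in blast)+
    ultimately show "c1 * (b - a) \<le> integral {s0..s0 + b} g - integral {s0..s0 + a} g \<and>
        integral {s0..s0 + b} g - integral {s0..s0 + a} g \<le> c2 * (b - a)"
      using ab by (simp add: mult.commute)
  qed (rule that)
qed

end

context riccati
begin

lemma ctrl_imp_trajectory:
  assumes "ctrl T E M"
  shows "\<exists>\<epsilon> x. feasible_control n1 n2 s0 \<epsilon> \<and> trajectory \<kappa> \<epsilon> s0 (s0 + T) x \<and> x s0 = \<eta> \<and> x (s0 + T) = act M \<eta>"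
proof -
  have T: "0 \<le> T" by (rule ctrl_estimate(1)[OF assms])
  obtain e m where c: "is_curve T e m" "m T = M" using is_curve_of_ctrl[OF assms] by blast
  obtain f N where f: "f \<in> borel_measurable borel" "\<And>s. n1\<^sup>2 \<le> f s \<and> f s \<le> n2\<^sup>2" "negligible N"
    "\<And>s. s \<in> {0..T} - N \<Longrightarrow> (e has_real_derivative f s) (at s within {0..T})"
    using is_curve_imp_control[OF c(1) T] by metis
  let ?\<epsilon> = "\<lambda>s. f (s - s0)" and ?x = "\<lambda>s. proj (m (s - s0) *v lift \<eta>)"
  have "?\<epsilon> \<in> borel_measurable borel" using f(1) by measurable
  then have "?\<epsilon> \<in> borel_measurable (lebesgue_on {s0<..})"
    by (intro measurable_restrict_space1 measurable_completion) simp
  then have "feasible_control n1 n2 s0 ?\<epsilon>" using f(2) by (simp add: feasible_control_def)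
  moreover have "trajectory \<kappa> ?\<epsilon> s0 (s0 + T) ?x"
    by (rule trajectory_of_curve[OF c(1) T lift_nonzero f(3,4)])
  moreover have "?x s0 = \<eta>" using is_curveD(2)[OF c(1)] by simp
  moreover have "?x (s0 + T) = act M \<eta>" using c(2) by (simp add: act_def)
  ultimately show ?thesis by blast
qed

text \<open>The control is replaced by one that is bounded everywhere and agrees with it almost everywhere
  after \<open>s0\<close>; its integral has the control as derivative almost everywhere.\<close>

lemma trajectory_imp_ctrl:
  assumes \<epsilon>: "feasible_control n1 n2 s0 \<epsilon>" and tr: "trajectory \<kappa> \<epsilon> s0 (s0 + T) x" and T: "0 \<le> T"
  shows "\<exists>E M. ctrl T E M \<and> act M (x s0) = x (s0 + T)"
proof -
  define g where "g s = max (n1\<^sup>2) (min (n2\<^sup>2) (if s \<in> {s0<..} then \<epsilon> s else 0))" for s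
  have "(\<lambda>s. if s \<in> {s0<..} then \<epsilon> s else 0) \<in> borel_measurable lebesgue"
    using \<epsilon> unfolding feasible_control_def by (intro borel_measurable_if_I) auto
  then have g_meas: "g \<in> borel_measurable lebesgue" unfolding g_def by measurable
  have g_bounds: "n1\<^sup>2 \<le> g s \<and> g s \<le> n2\<^sup>2" for s using sq_bounds by (auto simp: g_def)
  define e where "e s = integral {s0..s0 + s} g" for s
  obtain m where c: "is_curve T e m"
    unfolding e_def using control_imp_is_curve[OF g_meas g_bounds T] by metis
  have "g integrable_on {s0..s0 + T}"
  proof (rule measurable_bounded_by_integrable_imp_integrable)
    show "g \<in> borel_measurable (lebesgue_on {s0..s0 + T})"
      using g_meas by (rule measurable_restrict_space1)
    show "(\<lambda>_. n2\<^sup>2) integrable_on {s0..s0 + T}" by (rule integrable_const_ivl)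
    show "norm (g s) \<le> n2\<^sup>2" for s
    proof -
      have "0 \<le> g s" using g_bounds[of s] sq_bounds(1) by linarith
      then show ?thesis using g_bounds[of s] by simp
    qed
  qed simp
  then have N1: "negligible {s\<in>{s0<..<s0 + T}. \<not> ((\<lambda>t. integral {s0..t} g) has_real_derivative g s) (at s)}"
    by (rule lebesgue_differentiation)
  have "AE s in lebesgue_on {s0<..}. n1\<^sup>2 \<le> \<epsilon> s \<and> \<epsilon> s \<le> n2\<^sup>2"
    using \<epsilon> unfolding feasible_control_def by blast
  then obtain N2 where N2: "negligible N2" "\<And>s. s \<in> {s0<..} - N2 \<Longrightarrow> n1\<^sup>2 \<le> \<epsilon> s \<and> \<epsilon> s \<le> n2\<^sup>2"
    by (rule AE_lebesgue_on_imp_negligible) (auto intro: that)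
  \<comment> \<open>the end points are excluded to have two-sided derivatives and \<open>s > s0\<close>\<close>
  define N where "N = {s\<in>{s0<..<s0 + T}. \<not> ((\<lambda>t. integral {s0..t} g) has_real_derivative g s) (at s)} \<union> N2 \<union> {s0, s0 + T}"
  have "negligible N"
    unfolding N_def by (intro negligible_Un N1 N2(1) negligible_finite) auto
  have "x (s0 + T) = act (m T) (x s0)"
  proof (rule trajectory_eq_proj_curve[OF tr T c \<open>negligible N\<close>])
    fix s assume s: "s \<in> {s0..s0 + T} - N"
    then have s': "s \<in> {s0<..<s0 + T}" "s \<notin> N2" by (auto simp: N_def)
    then have \<epsilon>_s: "n1\<^sup>2 \<le> \<epsilon> s \<and> \<epsilon> s \<le> n2\<^sup>2" using N2(2)[of s] by simp
    then have "g s = \<epsilon> s" using s' by (simp add: g_def)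
    then have "((\<lambda>t. integral {s0..t} g) has_real_derivative \<epsilon> s) (at s)"
      using s s' by (simp add: N_def)
    then have "((\<lambda>t. integral {s0..t} g) has_real_derivative \<epsilon> s) (at ((s - s0) + s0))" by simp
    then have "((\<lambda>t. integral {s0..t + s0} g) has_real_derivative \<epsilon> s) (at (s - s0))"
      by (simp only: DERIV_shift)
    then have "(e has_real_derivative \<epsilon> s) (at (s - s0))"
      by (simp add: e_def[abs_def] add.commute)
    moreover have "0 \<le> \<epsilon> s" using \<epsilon>_s sq_bounds(1) by linarith
    ultimately show "(e has_real_derivative \<epsilon> s) (at (s - s0) within {0..T}) \<and> 0 \<le> \<epsilon> s \<and> \<epsilon> s \<le> n2\<^sup>2"
      using \<epsilon>_s by (auto intro: has_field_derivative_at_within)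
  qed
  moreover have "ctrl T (e T) (m T)" by (rule is_curve_ctrl[OF c T]) simp
  ultimately show ?thesis by metis
qed

end

section \<open>The minimal time and its two Hamilton-Jacobi-Bellman equations\<close>

context riccati
begin

lemma min_time_eq_hit_time: "min_time n1 n2 s0 \<kappa> \<eta>0 \<eta>1 = hit_time \<eta>0 \<eta>1"
proof -
  have "(0 \<le> t \<and> (\<exists>\<epsilon> x. feasible_control n1 n2 s0 \<epsilon> \<and> trajectory \<kappa> \<epsilon> s0 (s0 + t) x \<and> x s0 = \<eta>0 \<and> x (s0 + t) = \<eta>1))
      \<longleftrightarrow> (\<exists>E M. ctrl t E M \<and> act M \<eta>0 = \<eta>1)" (is "?L \<longleftrightarrow> ?R") for t
  proof
    assume ?L
    then show ?R using trajectory_imp_ctrl by metis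
  next
    assume ?R
    then obtain E M where *: "ctrl t E M" "act M \<eta>0 = \<eta>1" by blast
    then show ?L using ctrl_imp_trajectory[OF *(1), of s0 \<eta>0] ctrl_estimate(1)[OF *(1)] by blast
  qed
  then show ?thesis unfolding min_time_def hit_time_def by simp
qed

theorem proximal_solution_iff_min_time:
  "proximal_solution n1 n2 \<kappa> \<eta> V \<longleftrightarrow> V = (\<lambda>x. min_time n1 n2 s0 \<kappa> x \<eta>)"
  unfolding min_time_eq_hit_time
  using proximal_solution_hit_time proximal_solution_unique by blast

end

text \<open>Changing the sign of \<open>\<kappa>\<close> inverts every \<open>flow e t\<close>, so the reversed sequence of pieces has the
  inverse product.\<close>

lemma ctrl_time_reversal:
  assumes "control c1 c2" "control.ctrl \<kappa> c1 c2 \<tau> E M"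
  shows "control.ctrl (- \<kappa>) c1 c2 \<tau> E (adj2 M)"
proof -
  interpret control \<kappa> c1 c2 by (rule assms(1))
  interpret neg: control "- \<kappa>" c1 c2 by (rule assms(1))
  have flow: "neg.flow e t = adj2 (flow e t)" for e t
    by (simp add: mat2_eq_iff flow_component neg.flow_component)
  have reach: "neg.reach \<tau> E (adj2 M)" if "reach \<tau> E M" for \<tau> E M
    using that
  proof (induction rule: reach.induct)
    case reach_0
    then show ?case using neg.reach_0 by simp
  next
    case (reach_step \<tau> E M t e)
    have "neg.reach (t + \<tau>) (t * e + E) (adj2 M ** neg.flow e t)"
      by (intro neg.reach_mult neg.reach_flow reach_step)
    then show ?case by (simp add: adj2_mul flow add.commute)
  qed
  obtain t e m where *: "\<And>n :: nat. reach (t n) (e n) (m n)" "t \<longlonglongrightarrow> \<tau>" "e \<longlonglongrightarrow> E" "m \<longlonglongrightarrow> M"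
    using ctrl_approx[OF assms(2)] by metis
  show ?thesis
    by (rule neg.ctrl_limit[OF neg.reach_imp_ctrl[OF reach[OF *(1)]] *(2,3) tendsto_adj2[OF *(4)]])
qed

text \<open>The inverse of a transfer from \<open>\<eta>0\<close> to \<open>\<eta>1\<close> leads back, for the system with \<open>- \<kappa>\<close>, in the
  same time.\<close>

lemma min_time_reversal:
  assumes "0 < n1" "n1 < n2"
  shows "min_time n1 n2 s0 \<kappa> \<eta>0 \<eta>1 = min_time n1 n2 s0 (- \<kappa>) \<eta>1 \<eta>0"
proof -
  interpret riccati \<kappa> n1 n2 using assms by unfold_locales
  interpret neg: riccati "- \<kappa>" n1 n2 using assms by unfold_locales
  have "(\<exists>E M. ctrl t E M \<and> act M \<eta>0 = \<eta>1) \<longleftrightarrow> (\<exists>E M. neg.ctrl t E M \<and> act M \<eta>1 = \<eta>0)" for t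
  proof
    assume "\<exists>E M. ctrl t E M \<and> act M \<eta>0 = \<eta>1"
    then obtain E M where *: "ctrl t E M" "act M \<eta>0 = \<eta>1" by blast
    have "neg.ctrl t E (adj2 M)" by (rule ctrl_time_reversal[OF control_axioms *(1)])
    moreover have "act (adj2 M) \<eta>1 = \<eta>0" using act_adj2(1)[OF ctrl_estimate(4)[OF *(1)]] *(2) by blast
    ultimately show "\<exists>E M. neg.ctrl t E M \<and> act M \<eta>1 = \<eta>0" by blast
  next
    assume "\<exists>E M. neg.ctrl t E M \<and> act M \<eta>1 = \<eta>0"
    then obtain E M where *: "neg.ctrl t E M" "act M \<eta>1 = \<eta>0" by blast
    have "ctrl t E (adj2 M)" using ctrl_time_reversal[OF control_axioms *(1)] by simp
    moreover have "act (adj2 M) \<eta>0 = \<eta>1" using act_adj2(1)[OF neg.ctrl_estimate(4)[OF *(1)]] *(2) by blast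
    ultimately show "\<exists>E M. ctrl t E M \<and> act M \<eta>0 = \<eta>1" by blast
  qed
  then show ?thesis
    unfolding min_time_eq_hit_time neg.min_time_eq_hit_time hit_time_def neg.hit_time_def by simp
qed

theorem corollary3p3:
  fixes n1 n2 s0 :: real and \<kappa> :: complex
  assumes "0 < n1" and "n1 < n2" and "\<kappa> \<noteq> 0"
  shows "(\<forall>\<eta>1.
            lower_semicontinuous (\<lambda>x. min_time n1 n2 s0 \<kappa> x \<eta>1) \<and>
            proximal_solution n1 n2 \<kappa> \<eta>1 (\<lambda>x. min_time n1 n2 s0 \<kappa> x \<eta>1) \<and>
            (\<forall>V. proximal_solution n1 n2 \<kappa> \<eta>1 V \<longrightarrow> V = (\<lambda>x. min_time n1 n2 s0 \<kappa> x \<eta>1)))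
       \<and> (\<forall>\<eta>0.
            lower_semicontinuous (\<lambda>x. min_time n1 n2 s0 \<kappa> \<eta>0 x) \<and>
            proximal_solution n1 n2 (- \<kappa>) \<eta>0 (\<lambda>x. min_time n1 n2 s0 \<kappa> \<eta>0 x) \<and>
            (\<forall>V. proximal_solution n1 n2 (- \<kappa>) \<eta>0 V \<longrightarrow> V = (\<lambda>x. min_time n1 n2 s0 \<kappa> \<eta>0 x)))"
proof -
  interpret riccati \<kappa> n1 n2 using assms by unfold_locales
  interpret neg: riccati "- \<kappa>" n1 n2 using assms by unfold_locales
  have i: "proximal_solution n1 n2 \<kappa> \<eta> V \<longleftrightarrow> V = (\<lambda>x. min_time n1 n2 s0 \<kappa> x \<eta>)" for \<eta> V
    by (rule proximal_solution_iff_min_time)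
  have ii: "proximal_solution n1 n2 (- \<kappa>) \<eta> V \<longleftrightarrow> V = (\<lambda>x. min_time n1 n2 s0 \<kappa> \<eta> x)" for \<eta> V
    unfolding min_time_reversal[OF assms(1,2), of s0 \<kappa> \<eta>] by (rule neg.proximal_solution_iff_min_time)
  have lsc: "lower_semicontinuous V" if "proximal_solution n1 n2 \<kappa>' \<eta> V" for \<kappa>' \<eta> V
    using that unfolding proximal_solution_def by (elim conjE)
  show ?thesis
    by (intro conjI allI impI) (simp_all only: i ii lsc[OF i[THEN iffD2, OF refl]] lsc[OF ii[THEN iffD2, OF refl]])
qed

end
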